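(* Let $(K,v)$ be a valued field, $\overline{K}$ an algebraic closure of $K$, $\overline{v}$ an extension of $v$ to $\overline{K}$, and $X$ transcendental over $K$. Let $w$ be a valuation transcendental extension of $v$ to $K(X)$. Let $\overline{w}$ be a common extension of $w$ and $\overline{v}$ to $\overline{K}(X)$, and fix an extension of $\overline{w}$ to an algebraic closure $\overline{K(X)}$ of $K(X)$ containing $\overline{K}(X)$. Let $(a,\gamma)$ be a minimal pair of definition for $(K(X)|K,w)$ with $\overline{w}=\overline{v}_{a,\gamma}$, and let $a'$ be a $K$-conjugate of $a$. Then: (i) $\overline{v}_{a,\gamma} = \overline{v}_{a',\gamma}$ if and only if $a'$ is an $IC_K(w)$-conjugate of $a$; (ii) $\overline{v}_{a,\gamma}|_{K(X)} = w = \overline{v}_{a',\gamma}|_{K(X)}$ if and only if $a'$ is a $K^h$-conjugate of $a$.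
   Context: Valuations are written additively, with values in ordered abelian groups (plus $\infty$); $Kv$ denotes the residue field and $vK$ the value group. An extension $w$ of $v$ to $K(X)$ is valuation transcendental if $\dim_{\mathbb{Q}}\left(\mathbb{Q}\otimes_{\mathbb{Z}} (wK(X)/vK)\right) + \mathrm{trdeg}[K(X)w:Kv] = 1$. A common extension of $w$ and $\overline{v}$ to $\overline{K}(X)$ is a valuation on $\overline{K}(X)$ restricting to $w$ on $K(X)$ and to $\overline{v}$ on $\overline{K}$; its values lie in the divisible hull of $wK(X)$, which contains $\overline{v}\overline{K}$. For $a\in\overline{K}$ and $\gamma$ in an ordered abelian group containing $\overline{v}\overline{K}$, $\overline{v}_{a,\gamma}$ denotes the monomial valuation on $\overline{K}(X)$ given by $\overline{v}_{a,\gamma}\left(\sum_i c_i (X-a)^i\right) = \min_i\{\overline{v}c_i + i\gamma\}$ for $c_i\in\overline{K}$. Equivalently, it extends $\overline{v}$ and satisfies $\overline{v}_{a,\gamma}(X-z)=\min\{\gamma,\overline{v}(a-z)\}$ for all $z\in\overline{K}$. A pair $(a,\gamma)$ is a pair of definition for $(K(X)|K,w)$ if $\overline{v}_{a,\gamma}$ is a common extension of $w$ and $\overline{v}$. It is a minimal pair of definition if moreover, for all $b\in\overline{K}$, $\overline{v}(a-b)\geq\gamma$ implies $[K(a):K]\leq[K(b):K]$. $K^h$ denotes the henselization of $(K,v)$ inside $(\overline{K},\overline{v})$, and $K(X)^h$ the henselization of $(K(X),w)$ inside $\overline{K(X)}$ with respect to the fixed extension of $\overline{w}$. The implicit constant field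 is $IC_K(w):=\overline{K}\cap K(X)^h$. For a field $L$ with $K\subseteq L\subseteq\overline{K}$, $a'$ is an $L$-conjugate of $a$ if $a'=\sigma a$ for some $\sigma\in\mathrm{Aut}(\overline{K}|L)$. *)

theory Defs
  imports
    "HOL-Library.Extended"
    "HOL-Algebra.QuotRing"
    "HOL-Algebra.Generated_Fields"
    "HOL-Algebra.Free_Abelian_Groups"
    "HOL-Algebra.Algebraic_Closure_Type"
begin

section \<open>Subfields of an ambient field\<close>

text \<open>
  All fields live inside one ambient field, given by the type \<open>'f\<close>; in the theorem it is the
  algebraic closure of \<open>K(x)\<close>, where the transcendental \<open>x\<close> is the variable of the rational
  function field (HOL-Algebra reserves the letter \<open>X\<close> as syntax). Subfields are sets, handled
  with the notions of HOL-Algebra for the ring \<open>\<Omega>\<close> whose carrier is the whole type.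
\<close>

abbreviation ambient :: "'f::field ring"  (\<open>\<Omega>\<close>)
  where "\<Omega> \<equiv> ring_of_type_algebra"

definition adjoin :: "'f::field set \<Rightarrow> 'f \<Rightarrow> 'f set"
  where "adjoin L x = generate_field \<Omega> (insert x L)"

definition ext_degree :: "'f::field set \<Rightarrow> 'f \<Rightarrow> nat"
  where "ext_degree K a = ring.dim \<Omega> K (adjoin K a)"

definition field_auts :: "'f::field set \<Rightarrow> 'f set \<Rightarrow> ('f \<Rightarrow> 'f) set"
  where "field_auts F L =
    {\<sigma> \<in> ring_iso (\<Omega>\<lparr>carrier := F\<rparr>) (\<Omega>\<lparr>carrier := F\<rparr>). \<forall>x\<in>L. \<sigma> x = x}"

definition conjugate :: "'f::field set \<Rightarrow> 'f set \<Rightarrow> 'f \<Rightarrow> 'f \<Rightarrow> bool"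
  where "conjugate Kbar L a a' \<longleftrightarrow> (\<exists>\<sigma>\<in>field_auts Kbar L. a' = \<sigma> a)"


section \<open>Valuations\<close>

text \<open>
  A valuation on a subfield \<open>L\<close> is a function on the ambient field of which only the values on \<open>L\<close>
  matter. Its values lie in an ordered abelian group \<open>'g\<close> together with \<^term>\<open>Pinf\<close>; the element
  \<^term>\<open>Minf\<close> of \<^typ>\<open>'g extended\<close> is excluded. The value group is the set of finite
  values, which may be smaller than \<open>'g\<close>.
\<close>

definition valuation_on ::
    "'f::field set \<Rightarrow> ('f \<Rightarrow> 'g::linordered_ab_group_add extended) \<Rightarrow> bool"
  where "valuation_on L v \<longleftrightarrow>
    (\<forall>x\<in>L. v x \<noteq> Minf) \<and>
    (\<forall>x\<in>L. v x = Pinf \<longleftrightarrow> x = 0) \<and>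
    (\<forall>x\<in>L. \<forall>y\<in>L. v (x * y) = v x + v y) \<and>
    (\<forall>x\<in>L. \<forall>y\<in>L. min (v x) (v y) \<le> v (x + y))"

definition extends_on :: "'f set \<Rightarrow> ('f \<Rightarrow> 'b) \<Rightarrow> ('f \<Rightarrow> 'b) \<Rightarrow> bool"
  where "extends_on L v w \<longleftrightarrow> (\<forall>x\<in>L. w x = v x)"

definition value_group ::
    "'f::field set \<Rightarrow> ('f \<Rightarrow> 'g::linordered_ab_group_add extended) \<Rightarrow> 'g monoid"
  where "value_group L v =
    \<lparr>carrier = {g. \<exists>x\<in>L. v x = Fin g}, monoid.mult = (+), one = 0\<rparr>"

definition val_ring ::
    "'f::field set \<Rightarrow> ('f \<Rightarrow> 'g::linordered_ab_group_add extended) \<Rightarrow> 'f set"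
  where "val_ring L v = {x \<in> L. 0 \<le> v x}"

definition val_ideal ::
    "'f::field set \<Rightarrow> ('f \<Rightarrow> 'g::linordered_ab_group_add extended) \<Rightarrow> 'f set"
  where "val_ideal L v = {x \<in> L. 0 < v x}"

definition residue_field ::
    "'f::field set \<Rightarrow> ('f \<Rightarrow> 'g::linordered_ab_group_add extended) \<Rightarrow> 'f set ring"
  where "residue_field L v = (\<Omega>\<lparr>carrier := val_ring L v\<rparr>) Quot (val_ideal L v)"

text \<open>
  For an extension \<open>w\<close> to \<open>L\<close> of a valuation \<open>v\<close> on \<open>K\<close>, the copy of \<open>Kv\<close> inside \<open>Lw\<close>, that is, the
  image of the embedding sending the class of \<open>x\<close> modulo the maximal ideal of \<open>v\<close> to the class
  of \<open>x\<close> modulo that of \<open>w\<close>.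
\<close>

definition residue_image :: "'f::field set \<Rightarrow> ('f \<Rightarrow> 'g::linordered_ab_group_add extended) \<Rightarrow>
    'f set \<Rightarrow> ('f \<Rightarrow> 'g extended) \<Rightarrow> 'f set set"
  where "residue_image K v L w =
    (\<lambda>C. val_ideal L w <+>\<^bsub>\<Omega>\<^esub> C) ` carrier (residue_field K v)"


section \<open>Valuation transcendental extensions\<close>

text \<open>
  The tensor product of the rationals with an abelian group \<open>M\<close> (written multiplicatively, as usual
  in HOL-Algebra) over the integers: the free abelian group on the pairs \<open>(q, m)\<close> modulo the
  bilinearity relations, with the rationals acting on the first factor.
\<close>

definition rat_tensor_rels :: "('m, 'e) monoid_scheme \<Rightarrow> (rat \<times> 'm \<Rightarrow>\<^sub>0 int) set"
  where "rat_tensor_rels M = generate (free_Abelian_group (UNIV \<times> carrier M))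
    ({frag_of (p + q, m) - frag_of (p, m) - frag_of (q, m) | p q m. m \<in> carrier M} \<union>
     {frag_of (q, m \<otimes>\<^bsub>M\<^esub> n) - frag_of (q, m) - frag_of (q, n) | q m n.
        m \<in> carrier M \<and> n \<in> carrier M})"

definition rat_tensor :: "('m, 'e) monoid_scheme \<Rightarrow> (rat \<times> 'm \<Rightarrow>\<^sub>0 int) set monoid"
  where "rat_tensor M = free_Abelian_group (UNIV \<times> carrier M) Mod rat_tensor_rels M"

definition rat_tensor_smult ::
    "('m, 'e) monoid_scheme \<Rightarrow> rat \<Rightarrow> (rat \<times> 'm \<Rightarrow>\<^sub>0 int) set \<Rightarrow> (rat \<times> 'm \<Rightarrow>\<^sub>0 int) set"
  where "rat_tensor_smult M q C =
    (\<Union>c\<in>C. rat_tensor_rels M #>\<^bsub>free_Abelian_group (UNIV \<times> carrier M)\<^esub>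
      frag_extend (\<lambda>(p, m). frag_of (q * p, m)) c)"

text \<open>
  The tensor product has dimension \<open>n\<close> over the rationals: it has a basis of \<open>n\<close> elements, a basis
  being a set over which every element has a unique coordinate vector.
\<close>

definition has_rational_rank :: "('m, 'e) monoid_scheme \<Rightarrow> nat \<Rightarrow> bool"
  where "has_rational_rank M n \<longleftrightarrow>
    (\<exists>B. B \<subseteq> carrier (rat_tensor M) \<and> finite B \<and> card B = n \<and>
      (\<forall>t\<in>carrier (rat_tensor M). \<exists>!c. c \<in> B \<rightarrow>\<^sub>E UNIV \<and>
        t = finprod (rat_tensor M) (\<lambda>b. rat_tensor_smult M (c b) b) B))"

text \<open>
  Algebraic independence of a finite set: the monomials in its elements, indexed by their exponent
  functions, are linearly independent over \<open>k\<close>.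
\<close>

definition alg_independent :: "('a, 'e) ring_scheme \<Rightarrow> 'a set \<Rightarrow> 'a set \<Rightarrow> bool"
  where "alg_independent R k B \<longleftrightarrow>
    (\<forall>E c. E \<subseteq> B \<rightarrow>\<^sub>E (UNIV :: nat set) \<and> finite E \<and> c \<in> E \<rightarrow> k \<and>
        finsum R (\<lambda>e. c e \<otimes>\<^bsub>R\<^esub> finprod R (\<lambda>b. b [^]\<^bsub>R\<^esub> (e b)) B) E = \<zero>\<^bsub>R\<^esub>
      \<longrightarrow> (\<forall>e\<in>E. c e = \<zero>\<^bsub>R\<^esub>))"

definition has_trdeg :: "('a, 'e) ring_scheme \<Rightarrow> 'a set \<Rightarrow> nat \<Rightarrow> bool"
  where "has_trdeg R k n \<longleftrightarrow>
    (\<exists>B. B \<subseteq> carrier R \<and> finite B \<and> card B = n \<and> alg_independent R k B \<and>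
      (\<forall>x\<in>carrier R. (ring.algebraic R over generate_field R (k \<union> B)) x))"

definition valuation_transcendental :: "'f::field set \<Rightarrow> 'f \<Rightarrow>
    ('f \<Rightarrow> 'g::linordered_ab_group_add extended) \<Rightarrow> ('f \<Rightarrow> 'g extended) \<Rightarrow> bool"
  where "valuation_transcendental K x v w \<longleftrightarrow>
    (\<exists>r t. has_rational_rank (value_group (adjoin K x) w Mod carrier (value_group K v)) r \<and>
           has_trdeg (residue_field (adjoin K x) w) (residue_image K v (adjoin K x) w) t \<and>
           r + t = 1)"


section \<open>Monomial valuations and pairs of definition\<close>

definition common_extension :: "'f::field set \<Rightarrow> 'f set \<Rightarrow> 'f \<Rightarrow>
    ('f \<Rightarrow> 'g::linordered_ab_group_add extended) \<Rightarrow> ('f \<Rightarrow> 'g extended) \<Rightarrow>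
    ('f \<Rightarrow> 'g extended) \<Rightarrow> bool"
  where "common_extension K Kbar x w vbar u \<longleftrightarrow>
    valuation_on (adjoin Kbar x) u \<and> extends_on (adjoin K x) w u \<and> extends_on Kbar vbar u"

text \<open>
  The polynomial \<open>p\<close> stands for \<open>\<Sum>i. c\<^sub>i (x - a) ^ i\<close>, where \<open>c\<^sub>i\<close> is the \<open>i\<close>-th coefficient
  of \<open>p\<close>; the sum with \<open>i\<close> equal terms \<open>\<gamma>\<close> is the multiple \<open>i\<gamma>\<close>.
\<close>

definition gauss_value ::
    "('f::field \<Rightarrow> 'g::linordered_ab_group_add extended) \<Rightarrow> 'g \<Rightarrow> 'f poly \<Rightarrow> 'g extended"
  where "gauss_value v \<gamma> p =
    Min ((\<lambda>i. v (Polynomial.coeff p i) + Fin (\<Sum>j<i. \<gamma>)) ` {..Polynomial.degree p})"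

text \<open>
  On the elements \<open>z = p(x - a) / q(x - a)\<close> of \<open>Kbar(x)\<close>, the value is the difference of the values
  of \<open>p\<close> and \<open>q\<close>.
\<close>

definition monomial_val :: "'f::field set \<Rightarrow> ('f \<Rightarrow> 'g::linordered_ab_group_add extended) \<Rightarrow>
    'f \<Rightarrow> 'f \<Rightarrow> 'g \<Rightarrow> 'f \<Rightarrow> 'g extended"
  where "monomial_val Kbar vbar x a \<gamma> z = (THE y. \<exists>p q.
    set (Polynomial.coeffs p) \<subseteq> Kbar \<and> set (Polynomial.coeffs q) \<subseteq> Kbar \<and> q \<noteq> 0 \<and>
    z = Polynomial.poly p (x - a) / Polynomial.poly q (x - a) \<and>
    y = gauss_value vbar \<gamma> p - gauss_value vbar \<gamma> q)"

definition pair_of_definition :: "'f::field set \<Rightarrow> 'f set \<Rightarrow> 'f \<Rightarrow>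
    ('f \<Rightarrow> 'g::linordered_ab_group_add extended) \<Rightarrow> ('f \<Rightarrow> 'g extended) \<Rightarrow> 'f \<Rightarrow> 'g \<Rightarrow> bool"
  where "pair_of_definition K Kbar x w vbar a \<gamma> \<longleftrightarrow>
    a \<in> Kbar \<and> common_extension K Kbar x w vbar (monomial_val Kbar vbar x a \<gamma>)"

definition minimal_pair_of_definition :: "'f::field set \<Rightarrow> 'f set \<Rightarrow> 'f \<Rightarrow>
    ('f \<Rightarrow> 'g::linordered_ab_group_add extended) \<Rightarrow> ('f \<Rightarrow> 'g extended) \<Rightarrow> 'f \<Rightarrow> 'g \<Rightarrow> bool"
  where "minimal_pair_of_definition K Kbar x w vbar a \<gamma> \<longleftrightarrow>
    pair_of_definition K Kbar x w vbar a \<gamma> \<and>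
    (\<forall>b\<in>Kbar. Fin \<gamma> \<le> vbar (a - b) \<longrightarrow> ext_degree K a \<le> ext_degree K b)"


section \<open>Henselizations\<close>

text \<open>
  \<open>F\<close> is an algebraic closure of \<open>L\<close> and \<open>u\<close> is a valuation on \<open>F\<close>. The valued field
  \<open>(L, u|L)\<close> is henselian if \<open>u|L\<close> has a unique extension to \<open>F\<close>. Considering only extensions with
  values in \<open>'g\<close> is no loss: \<open>'g\<close> contains the value group of \<open>u\<close> on \<open>F\<close>, which is the divisible
  hull of the value group on \<open>L\<close>, and as \<open>'g\<close> is torsion-free, two extensions with the same
  valuation ring are equal.
\<close>

definition henselian_in :: "'f::field set \<Rightarrow>
    ('f \<Rightarrow> 'g::linordered_ab_group_add extended) \<Rightarrow> 'f set \<Rightarrow> bool"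
  where "henselian_in F u L \<longleftrightarrow>
    (\<forall>u'. valuation_on F u' \<and> extends_on L u u' \<longrightarrow> (\<forall>x\<in>F. u' x = u x))"

text \<open>
  The henselization of \<open>(K, u|K)\<close> inside its algebraic closure \<open>(F, u)\<close>: the smallest henselian field
  between \<open>K\<close> and \<open>F\<close>.
\<close>

definition henselization :: "'f::field set \<Rightarrow>
    ('f \<Rightarrow> 'g::linordered_ab_group_add extended) \<Rightarrow> 'f set \<Rightarrow> 'f set"
  where "henselization F u K =
    \<Inter>{L. subfield L \<Omega> \<and> K \<subseteq> L \<and> L \<subseteq> F \<and> henselian_in F u L}"

text \<open>\<open>W\<close> is the chosen valuation on the algebraic closure of \<open>K(x)\<close>, which is the whole type.\<close>

definition implicit_constant_field :: "'f::field set \<Rightarrow> 'f set \<Rightarrow> 'f \<Rightarrow>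
    ('f \<Rightarrow> 'g::linordered_ab_group_add extended) \<Rightarrow> 'f set"
  where "implicit_constant_field K Kbar x W = Kbar \<inter> henselization UNIV W (adjoin K x)"

end

theory Submission imports Defs begin

text \<open>
  Two valuations on an algebraic closure \<open>F\<close> of \<open>L\<close> that agree on \<open>L\<close> are conjugate under
  \<open>Aut(F|L)\<close>. Consequently \<open>Aut(F|L\<^sup>h)\<close> is the decomposition group of the valuation, that is, the
  group of all automorphisms over \<open>L\<close> that preserve it. Let \<open>n\<close> be the degree of \<open>a\<close> over \<open>K\<close>.
  By minimality of the pair, a polynomial \<open>p\<close> over \<open>K\<close> of degree less than \<open>n\<close> has no root in the
  ball of radius \<open>\<gamma>\<close> around \<open>a\<close>, so the monomial valuation at \<open>(a, \<gamma>)\<close> takes at \<open>p(x)\<close> the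
  value of \<open>p(a)\<close>, whereas the one at \<open>(a', \<gamma>)\<close> never exceeds the value of \<open>p(a')\<close>. Hence, if both
  agree on \<open>K(x)\<close>, then \<open>p(a) \<mapsto> p(a')\<close> cannot decrease values; as it is an isomorphism of
  fields, it preserves them, and by conjugacy it extends to an element of the decomposition group.
  For (i), this automorphism, extended to \<open>Kbar(x)\<close> by fixing \<open>x\<close>, preserves \<open>wbar\<close> if both
  monomial valuations are equal, so by conjugacy once more it extends to an element of the
  decomposition group over \<open>K(x)\<close>, which fixes \<open>IC\<close>. The converse directions hold because an
  automorphism over the henselization preserves the valuation.
\<close>

section \<open>Partial isomorphisms\<close>

text \<open>Conjugacy is needed for infinite, possibly inseparable extensions, and it is reached
  without Galois theory: Zorn's lemma on graphs of partial isomorphisms reduces it to adjoining one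
  element \<open>z\<close>. The obstacle there is that failure yields, for each conjugate
  \<open>y\<close> of \<open>z\<close>, its own polynomial distinguishing the two valuations;
  classically, an approximation theorem merges these into one element. Here they become the
  coefficients of one polynomial in an auxiliary indeterminate, compared by the Gauss valuation with
  radius 0, that is, by the minimum of the coefficient values. The product over all conjugates is
  invariant, so both valuations agree on its coefficients, and negativity of all its roots for one
  valuation carries over to the other. Invariant elements may be inseparable over the base field;
  they are replaced by powers, which loses nothing because ordered groups are torsion-free. The same
  device shows that the henselization, defined as an intersection, is itself henselian, although the
  fixed field of the decomposition group, where this is proved first, may be strictly
  larger.\<close>

lemma subfield_ambient_iff:
  fixes E :: "'f::field set"
  shows "subfield E \<Omega> \<longleftrightarrow> 0 \<in> E \<and> 1 \<in> E \<and> (\<forall>x\<in>E. \<forall>y\<in>E. x + y \<in> E \<and> x * y \<in> E) \<and>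
    (\<forall>x\<in>E. - x \<in> E \<and> inverse x \<in> E)"
proof -
  interpret field "\<Omega> :: 'f ring"
    by rule
  have uminus: "\<ominus>\<^bsub>\<Omega>\<^esub> x = - x" for x :: 'f
    by (rule minus_equality) (auto simp: ring_of_type_algebra_def)
  have inv: "inv\<^bsub>\<Omega>\<^esub> x = inverse x" if "x \<noteq> 0" for x :: 'f
    by (rule comm_inv_char) (use that in \<open>auto simp: ring_of_type_algebra_def\<close>)
  show ?thesis
  proof
    assume E: "subfield E \<Omega>"
    show "0 \<in> E \<and> 1 \<in> E \<and> (\<forall>x\<in>E. \<forall>y\<in>E. x + y \<in> E \<and> x * y \<in> E) \<and>
      (\<forall>x\<in>E. - x \<in> E \<and> inverse x \<in> E)"
    proof (intro conjI ballI)
      \<comment> \<open>The convention \<open>inverse 0 = 0\<close> is what allows closure under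
        inverses without excluding 0.\<close>
      show "inverse x \<in> E" if "x \<in> E" for x
        using subfield_m_inv(1)[OF E, of x] inv[of x] that
        by (cases "x = 0") (auto simp: ring_of_type_algebra_def)
    qed (use subringE[OF subfieldE(1)[OF E]] uminus in \<open>auto simp: ring_of_type_algebra_def\<close>)
  next
    assume E: "0 \<in> E \<and> 1 \<in> E \<and> (\<forall>x\<in>E. \<forall>y\<in>E. x + y \<in> E \<and> x * y \<in> E) \<and>
      (\<forall>x\<in>E. - x \<in> E \<and> inverse x \<in> E)"
    show "subfield E \<Omega>"
    proof (rule subfieldI')
      show "subring E \<Omega>"
        by (rule subringI) (use E uminus in \<open>auto simp: ring_of_type_algebra_def\<close>)
    qed (use E inv in \<open>auto simp: ring_of_type_algebra_def\<close>)
  qed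
qed

lemma subfield_closed:
  assumes "subfield E (\<Omega> :: 'f::field ring)"
  shows subfield_0: "0 \<in> E" and subfield_1: "1 \<in> E"
    and subfield_add: "x \<in> E \<Longrightarrow> y \<in> E \<Longrightarrow> x + y \<in> E"
    and subfield_diff: "x \<in> E \<Longrightarrow> y \<in> E \<Longrightarrow> x - y \<in> E"
    and subfield_mult: "x \<in> E \<Longrightarrow> y \<in> E \<Longrightarrow> x * y \<in> E"
    and subfield_divide: "x \<in> E \<Longrightarrow> y \<in> E \<Longrightarrow> x / y \<in> E"
    and subfield_uminus: "x \<in> E \<Longrightarrow> - x \<in> E"
    and subfield_inverse: "x \<in> E \<Longrightarrow> inverse x \<in> E"
    and subfield_power: "x \<in> E \<Longrightarrow> x ^ n \<in> E"
proof -
  note * = assms[unfolded subfield_ambient_iff]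
  show "0 \<in> E" "1 \<in> E" "x \<in> E \<Longrightarrow> y \<in> E \<Longrightarrow> x + y \<in> E" "x \<in> E \<Longrightarrow> y \<in> E \<Longrightarrow> x * y \<in> E"
    "x \<in> E \<Longrightarrow> - x \<in> E" "x \<in> E \<Longrightarrow> inverse x \<in> E"
    using * by auto
  show "x \<in> E \<Longrightarrow> y \<in> E \<Longrightarrow> x - y \<in> E"
    using * by (metis diff_conv_add_uminus)
  show "x \<in> E \<Longrightarrow> y \<in> E \<Longrightarrow> x / y \<in> E"
    using * by (metis divide_inverse)
  show "x \<in> E \<Longrightarrow> x ^ n \<in> E"
    using * by (induction n) auto
qed

text \<open>A subring of the product ring. One notion covers subrings (the diagonal
  \<open>Id_on R\<close>), graphs of isomorphisms and their coefficientwise lifts to polynomials, so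
  sums, products and evaluations are treated once for all of them.\<close>

definition ring_rel :: "('a::comm_ring_1 \<times> 'b::comm_ring_1) set \<Rightarrow> bool"
  where "ring_rel G \<longleftrightarrow> (0, 0) \<in> G \<and> (1, 1) \<in> G \<and>
    (\<forall>(x, x')\<in>G. (- x, - x') \<in> G) \<and>
    (\<forall>(x, x')\<in>G. \<forall>(y, y')\<in>G. (x + y, x' + y') \<in> G \<and> (x * y, x' * y') \<in> G)"

text \<open>
  An isomorphism between subfields is represented by its graph, which is a subfield of the product;
  that the relation is functional and injective follows from the last condition.
\<close>

definition partial_iso :: "('f::field \<times> 'f) set \<Rightarrow> bool"
  where "partial_iso G \<longleftrightarrow> ring_rel G \<and> (\<forall>(x, x')\<in>G. (inverse x, inverse x') \<in> G) \<and>
    (\<forall>x'. (0, x') \<in> G \<longrightarrow> x' = 0)"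

definition poly_rel :: "('a::comm_ring_1 \<times> 'b::comm_ring_1) set \<Rightarrow> ('a poly \<times> 'b poly) set"
  where "poly_rel G = {(p, p'). \<forall>i. (coeff p i, coeff p' i) \<in> G}"

abbreviation polys_over :: "'a::comm_ring_1 set \<Rightarrow> 'a poly set"
  where "polys_over E \<equiv> {p. \<forall>i. coeff p i \<in> E}"

lemma ring_rel_closed:
  assumes "ring_rel G"
  shows ring_rel_0: "(0, 0) \<in> G" and ring_rel_1: "(1, 1) \<in> G"
    and ring_rel_uminus: "(x, x') \<in> G \<Longrightarrow> (- x, - x') \<in> G"
    and ring_rel_add: "(x, x') \<in> G \<Longrightarrow> (y, y') \<in> G \<Longrightarrow> (x + y, x' + y') \<in> G"
    and ring_rel_diff: "(x, x') \<in> G \<Longrightarrow> (y, y') \<in> G \<Longrightarrow> (x - y, x' - y') \<in> G"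
    and ring_rel_mult: "(x, x') \<in> G \<Longrightarrow> (y, y') \<in> G \<Longrightarrow> (x * y, x' * y') \<in> G"
    and ring_rel_power: "(x, x') \<in> G \<Longrightarrow> (x ^ n, x' ^ n) \<in> G"
proof -
  note * = assms[unfolded ring_rel_def]
  show "(0, 0) \<in> G" "(1, 1) \<in> G" "(x, x') \<in> G \<Longrightarrow> (- x, - x') \<in> G"
    "(x, x') \<in> G \<Longrightarrow> (y, y') \<in> G \<Longrightarrow> (x + y, x' + y') \<in> G"
    "(x, x') \<in> G \<Longrightarrow> (y, y') \<in> G \<Longrightarrow> (x * y, x' * y') \<in> G"
    using * by fast+
  show "(x, x') \<in> G \<Longrightarrow> (y, y') \<in> G \<Longrightarrow> (x - y, x' - y') \<in> G"
    using * unfolding diff_conv_add_uminus by fast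
  show "(x, x') \<in> G \<Longrightarrow> (x ^ n, x' ^ n) \<in> G"
    using * by (induction n) (simp, simp, fast)
qed

lemma ring_rel_sum:
  assumes "ring_rel G" and "\<And>i. i \<in> A \<Longrightarrow> (f i, f' i) \<in> G"
  shows "(sum f A, sum f' A) \<in> G"
  using assms(2)
  by (induction A rule: infinite_finite_induct) (auto intro: ring_rel_closed[OF assms(1)])

lemma ring_rel_prod:
  assumes "ring_rel G" and "\<And>i. i \<in> A \<Longrightarrow> (f i, f' i) \<in> G"
  shows "(prod f A, prod f' A) \<in> G"
  using assms(2)
  by (induction A rule: infinite_finite_induct) (auto intro: ring_rel_closed[OF assms(1)])

lemma ring_rel_poly_rel:
  assumes "ring_rel G"
  shows "ring_rel (poly_rel G)"
  unfolding ring_rel_def poly_rel_def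
  by (auto simp: coeff_mult split: nat.split
      intro!: ring_rel_closed[OF assms] ring_rel_sum[OF assms])

lemma poly_rel_pCons:
  assumes "(a, a') \<in> G" and "(p, p') \<in> poly_rel G"
  shows "(pCons a p, pCons a' p') \<in> poly_rel G"
  using assms by (auto simp: poly_rel_def coeff_pCons split: nat.split)

lemma poly_rel_monom:
  assumes "ring_rel G" and "(a, a') \<in> G"
  shows "(monom a n, monom a' n) \<in> poly_rel G"
  using assms by (auto simp: poly_rel_def intro: ring_rel_closed)

lemma poly_rel_poly:
  assumes "ring_rel G" and "(p, p') \<in> poly_rel G" and "(x, x') \<in> G"
  shows "(poly p x, poly p' x') \<in> G"
proof -
  define n where "n = max (degree p) (degree p')"
  have "poly p x = (\<Sum>i\<le>n. coeff p i * x ^ i)" "poly p' x' = (\<Sum>i\<le>n. coeff p' i * x' ^ i)"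
    unfolding poly_altdef n_def
    by (rule sum.mono_neutral_left; auto simp: coeff_eq_0)+
  thus ?thesis
    using assms by (auto simp: poly_rel_def intro!: ring_rel_sum ring_rel_closed)
qed

lemma poly_rel_Id_on: "poly_rel (Id_on E) = Id_on (polys_over E)"
  by (auto simp: poly_rel_def Id_on_def poly_eq_iff)

lemma partial_iso_ring_rel: "partial_iso G \<Longrightarrow> ring_rel G"
  by (simp add: partial_iso_def)

lemma partial_iso_inverse: "partial_iso G \<Longrightarrow> (x, x') \<in> G \<Longrightarrow> (inverse x, inverse x') \<in> G"
  by (auto simp: partial_iso_def)

lemma partial_iso_divide:
  "partial_iso G \<Longrightarrow> (x, x') \<in> G \<Longrightarrow> (y, y') \<in> G \<Longrightarrow> (x / y, x' / y') \<in> G"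
  unfolding divide_inverse
  by (intro ring_rel_mult partial_iso_ring_rel partial_iso_inverse)

lemma partial_iso_0_iff:
  assumes "partial_iso G" and "(x, x') \<in> G"
  shows "x' = 0 \<longleftrightarrow> x = 0"
proof
  assume "x' = 0"
  show "x = 0"
  proof (rule ccontr)
    assume "x \<noteq> 0"
    \<comment> \<open>Dividing the pair by itself: \<open>x / x = 1\<close>, whereas
      \<open>0 / 0 = 0\<close> by convention.\<close>
    hence "(1, 0) \<in> G"
      using partial_iso_divide[OF assms(1) assms(2) assms(2)] \<open>x' = 0\<close> by simp
    hence "(1 - 1, 1 - 0) \<in> G"
      by (intro ring_rel_closed partial_iso_ring_rel assms)
    thus False
      using assms(1) by (auto simp: partial_iso_def)
  qed
qed (use assms in \<open>auto simp: partial_iso_def\<close>)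

lemma partial_iso_unique:
  assumes "partial_iso G" and "(x, x') \<in> G" and "(y, y') \<in> G"
  shows "x = y \<longleftrightarrow> x' = y'"
  using partial_iso_0_iff[OF assms(1) ring_rel_diff[OF partial_iso_ring_rel[OF assms(1)] assms(2,3)]]
  by simp

lemma poly_rel_0_iff:
  assumes "partial_iso G" and "(p, p') \<in> poly_rel G"
  shows "p' = 0 \<longleftrightarrow> p = 0"
  using assms partial_iso_0_iff[OF assms(1)] by (auto simp: poly_rel_def poly_eq_iff)

lemma poly_rel_degree:
  assumes "partial_iso G" and "(p, p') \<in> poly_rel G"
  shows "degree p' = degree p"
proof -
  have "coeff p' i = 0 \<longleftrightarrow> coeff p i = 0" for i
    using assms partial_iso_0_iff[OF assms(1)] by (auto simp: poly_rel_def)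
  thus ?thesis
    by (simp add: degree_def)
qed

lemma subfield_Domain:
  assumes "partial_iso G"
  shows "subfield (Domain G) \<Omega>"
  unfolding subfield_ambient_iff
  by (intro conjI ballI; (elim DomainE)?)
     (auto intro!: DomainI intro: partial_iso_inverse[OF assms]
        ring_rel_closed[OF partial_iso_ring_rel[OF assms]])

lemma partial_iso_Id_on:
  "partial_iso (Id_on E) \<longleftrightarrow> subfield E (\<Omega> :: 'f::field ring)"
  unfolding subfield_ambient_iff partial_iso_def ring_rel_def by (auto simp: Id_on_iff Ball_def)

lemma poly_rel_left_total:
  assumes "partial_iso G" and "p \<in> polys_over (Domain G)"
  obtains p' where "(p, p') \<in> poly_rel G"
proof -
  have "\<exists>f. \<forall>i. (coeff p i, f i) \<in> G"
    using assms(2) by (intro choice) auto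
  then obtain f where f: "(coeff p i, f i) \<in> G" for i
    by blast
  have "f i = 0" if "i > degree p" for i
    using partial_iso_0_iff[OF assms(1) f[of i]] that by (simp add: coeff_eq_0)
  hence "coeff (Abs_poly f) = f"
    by (intro coeff_Abs_poly)
  hence "(p, Abs_poly f) \<in> poly_rel G"
    using f by (simp add: poly_rel_def)
  thus ?thesis
    by (rule that)
qed

text \<open>Degrees and vanishing of coefficients agree along \<open>G\<close>, so the two Euclidean
  divisions run through the same steps. On the diagonal \<open>Id_on E\<close> this is ordinary
  division with remainder over the subfield \<open>E\<close>.\<close>

lemma poly_rel_division:
  assumes G: "partial_iso G" and m: "(m, m') \<in> poly_rel G" "m \<noteq> 0" and "(p, p') \<in> poly_rel G"
  shows "\<exists>q q' r r'. (q, q') \<in> poly_rel G \<and> (r, r') \<in> poly_rel G \<and>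
    p = m * q + r \<and> p' = m' * q' + r' \<and> (r = 0 \<or> degree r < degree m)"
  using assms(4)
\<comment> \<open>The measure places the zero polynomial strictly below the nonzero constants, which
  have the same degree 0.\<close>
proof (induction "if p = 0 then 0 else Suc (degree p)" arbitrary: p p' rule: less_induct)
  case less
  note R = partial_iso_ring_rel[OF G]
  note PR = ring_rel_poly_rel[OF R]
  show ?case
  proof (cases "p = 0 \<or> degree p < degree m")
    case True
    have "p = m * 0 + p" "p' = m' * 0 + p'"
      by auto
    thus ?thesis
      using True less.prems ring_rel_0[OF PR] by blast
  next
    case False
    define d where "d = degree p - degree m"
    define c where "c = coeff p (degree p) / coeff m (degree m)"
    define c' where "c' = coeff p' (degree p) / coeff m' (degree m)"
    define t where "t = monom c d"
    define t' where "t' = monom c' d"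
    have "(c, c') \<in> G"
      unfolding c_def c'_def using less.prems m by (intro partial_iso_divide G) (auto simp: poly_rel_def)
    hence t: "(t, t') \<in> poly_rel G"
      unfolding t_def t'_def by (rule poly_rel_monom[OF R])
    have "c \<noteq> 0"
      using False m by (simp add: c_def)
    have deg: "degree (m * t) = degree p"
      using False m \<open>c \<noteq> 0\<close> by (simp add: degree_mult_eq t_def degree_monom_eq d_def)
    have "coeff (m * t) (degree p) = coeff m (degree m) * c"
      using False by (simp add: t_def mult.commute[of m] d_def coeff_monom_mult)
    hence lc: "coeff (p - m * t) (degree p) = 0"
      using m by (simp add: c_def)
    have "p - m * t = 0 \<or> degree (p - m * t) < degree p"
    proof (rule ccontr)
      assume *: "\<not> (p - m * t = 0 \<or> degree (p - m * t) < degree p)"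
      moreover have "degree (p - m * t) \<le> degree p"
        using deg by (intro degree_diff_le) auto
      ultimately have "degree (p - m * t) = degree p"
        by simp
      thus False
        using * lc by (metis leading_coeff_0_iff)
    qed
    moreover have "(p - m * t, p' - m' * t') \<in> poly_rel G"
      by (intro ring_rel_closed[OF PR] less.prems m t)
    moreover have "(if p - m * t = 0 then 0 else Suc (degree (p - m * t))) <
        (if p = 0 then 0 else Suc (degree p))"
      using calculation False by auto
    ultimately obtain q q' r r' where q: "(q, q') \<in> poly_rel G" "(r, r') \<in> poly_rel G"
      "p - m * t = m * q + r" "p' - m' * t' = m' * q' + r'" "r = 0 \<or> degree r < degree m"
      using less.hyps by blast
    have "p = m * (q + t) + r" "p' = m' * (q' + t') + r'"
      using q(3,4) by (simp_all add: algebra_simps)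
    moreover have "(q + t, q' + t') \<in> poly_rel G"
      by (intro ring_rel_closed[OF PR] q t)
    ultimately show ?thesis
      using q by blast
  qed
qed

definition minimal_poly :: "'f::field set \<Rightarrow> 'f \<Rightarrow> 'f poly \<Rightarrow> bool"
  where "minimal_poly E z m \<longleftrightarrow> m \<in> polys_over E \<and> m \<noteq> 0 \<and> poly m z = 0 \<and>
    (\<forall>p\<in>polys_over E. p \<noteq> 0 \<and> poly p z = 0 \<longrightarrow> degree m \<le> degree p)"

lemma minimal_poly_exists:
  assumes "p \<in> polys_over E" and "p \<noteq> 0" and "poly p z = 0"
  obtains m where "minimal_poly E z m" and "degree m \<le> degree p"
proof -
  let ?P = "\<lambda>q. q \<in> polys_over E \<and> q \<noteq> 0 \<and> poly q z = 0"
  define m where "m = arg_min degree ?P"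
  have "?P m" "\<And>q. ?P q \<Longrightarrow> degree m \<le> degree q"
    using arg_min_nat_lemma[of ?P p degree] assms unfolding m_def by blast+
  thus ?thesis
    using assms by (intro that[of m]) (auto simp: minimal_poly_def)
qed

text \<open>\<open>E[z]\<close> is a field. Descent on the degree of \<open>p\<close>: dividing
  \<open>m\<close> by \<open>p\<close> gives \<open>p(z) q(z) = - r(z)\<close> with \<open>r\<close>
  of smaller degree, so an inverse of \<open>r(z)\<close> yields one of \<open>p(z)\<close>. Here
  \<open>r(z)\<close> is nonzero, since otherwise \<open>r = 0\<close> by minimality and
  \<open>q\<close> would annihilate \<open>z\<close> in degree below that of
  \<open>m\<close>.\<close>

lemma minimal_poly_inverse:
  assumes E: "subfield E \<Omega>" and m: "minimal_poly E z m" and "p \<in> polys_over E" and "poly p z \<noteq> 0"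
  shows "\<exists>s\<in>polys_over E. poly p z * poly s z = 1"
proof -
  define G where "G = Id_on E"
  have G: "partial_iso G"
    using E by (simp add: G_def partial_iso_Id_on)
  have PG: "poly_rel G = Id_on (polys_over E)"
    unfolding G_def by (rule poly_rel_Id_on)
  note PR = ring_rel_closed[OF ring_rel_poly_rel[OF partial_iso_ring_rel[OF G]], unfolded PG Id_on_iff]
  have "\<exists>s\<in>polys_over E. poly p z * poly s z = 1"
    if "p \<in> polys_over E" "poly p z \<noteq> 0" "degree p < degree m" for p
    using that
  proof (induction "degree p" arbitrary: p rule: less_induct)
    case less
    show ?case
    proof (cases "degree p = 0")
      case True
      then obtain c where c: "p = [:c:]"
        by (rule degree_eq_zeroE)
      have "c \<in> E"
        using less.prems(1) c by (auto dest: spec[of _ 0])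
      hence "[:inverse c:] \<in> polys_over E"
        using subfield_closed[OF E] by (auto simp: coeff_pCons split: nat.split)
      thus ?thesis
        using less.prems c by (intro bexI[of _ "[:inverse c:]"]) auto
    next
      case False
      have "(p, p) \<in> poly_rel G" "(m, m) \<in> poly_rel G" "p \<noteq> 0"
        using less.prems m by (auto simp: PG minimal_poly_def)
      from poly_rel_division[OF G this(1,3,2)] obtain q r where
        qr: "q \<in> polys_over E" "r \<in> polys_over E" "m = p * q + r" "r = 0 \<or> degree r < degree p"
        unfolding PG Id_on_iff by blast
      have "m \<noteq> 0" "poly m z = 0"
        using m by (auto simp: minimal_poly_def)
      have r: "poly r z \<noteq> 0"
      proof
        assume "poly r z = 0"
        hence "r = 0"
          using m qr less.prems(3) unfolding minimal_poly_def by fastforce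
        hence "m = p * q" "q \<noteq> 0"
          using qr \<open>m \<noteq> 0\<close> by auto
        moreover have "poly q z = 0"
          using \<open>m = p * q\<close> \<open>poly m z = 0\<close> less.prems by auto
        ultimately have "degree m \<le> degree q"
          using m qr unfolding minimal_poly_def by blast
        thus False
          using \<open>m = p * q\<close> \<open>q \<noteq> 0\<close> \<open>p \<noteq> 0\<close> False by (simp add: degree_mult_eq)
      qed
      hence "degree r < degree p"
        using qr by auto
      then obtain s where s: "s \<in> polys_over E" "poly r z * poly s z = 1"
        using less.hyps[of r] qr(2) r less.prems(3) by auto
      have "poly p z * poly q z + poly r z = 0"
        using arg_cong[OF qr(3), of "\<lambda>p. poly p z"] \<open>poly m z = 0\<close> by simp
      hence "poly r z = - (poly p z * poly q z)"
        by (simp add: eq_neg_iff_add_eq_0 add.commute)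
      hence "poly p z * poly (- (q * s)) z = 1"
        using s by (simp add: algebra_simps)
      moreover have "- (q * s) \<in> polys_over E"
        using PR(3)[OF PR(6)] qr s by blast
      ultimately show ?thesis
        by blast
    qed
  qed
  \<comment> \<open>A polynomial of arbitrary degree is first reduced modulo \<open>m\<close>, which
    does not change its value at \<open>z\<close>.\<close>
  moreover have "(p, p) \<in> poly_rel G" "(m, m) \<in> poly_rel G" "m \<noteq> 0" "poly m z = 0"
    using assms by (auto simp: PG minimal_poly_def)
  with poly_rel_division[OF G this(2,3,1)] obtain q r where
    qr: "q \<in> polys_over E" "r \<in> polys_over E" "p = m * q + r" "r = 0 \<or> degree r < degree m"
    unfolding PG Id_on_iff by blast
  moreover from qr \<open>poly m z = 0\<close> have "poly p z = poly r z"
    by simp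
  ultimately show ?thesis
    using assms(4) by fastforce
qed

text \<open>If \<open>p(z) = 0\<close>, then \<open>m\<close> divides \<open>p\<close>, and the
  parallel division makes \<open>p'\<close> a multiple of \<open>m'\<close>. If \<open>p(z)\<close>
  is nonzero with inverse \<open>s(z)\<close>, the first direction applied to
  \<open>p * s - 1\<close> shows that \<open>p'(z')\<close> is invertible as well.\<close>

lemma minimal_poly_root_iff:
  assumes G: "partial_iso G" and m: "minimal_poly (Domain G) z m"
    and m': "(m, m') \<in> poly_rel G" "poly m' z' = 0" and p: "(p, p') \<in> poly_rel G"
  shows "poly p z = 0 \<longleftrightarrow> poly p' z' = 0"
proof
  have *: "poly p' z' = 0" if p: "(p, p') \<in> poly_rel G" "poly p z = 0" for p p'
  proof -
    have "m \<noteq> 0" "poly m z = 0"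
      using m by (auto simp: minimal_poly_def)
    from poly_rel_division[OF G m'(1) this(1) p(1)] obtain q q' r r' where
      qr: "(q, q') \<in> poly_rel G" "(r, r') \<in> poly_rel G" "p = m * q + r" "p' = m' * q' + r'"
      "r = 0 \<or> degree r < degree m"
      by blast
    have "poly r z = 0"
      using qr(3) p(2) \<open>poly m z = 0\<close> by simp
    moreover have "r \<in> polys_over (Domain G)"
      using qr(2) by (auto simp: poly_rel_def)
    ultimately have "r = 0"
      using m qr(5) unfolding minimal_poly_def by fastforce
    thus ?thesis
      using qr m' poly_rel_0_iff[OF G qr(2)] by simp
  qed
  show "poly p' z' = 0" if "poly p z = 0"
    using *[OF p that] .
  show "poly p z = 0" if "poly p' z' = 0"
  proof (rule ccontr)
    assume "poly p z \<noteq> 0"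
    moreover have "p \<in> polys_over (Domain G)"
      using p by (auto simp: poly_rel_def)
    ultimately obtain s where s: "s \<in> polys_over (Domain G)" "poly p z * poly s z = 1"
      using minimal_poly_inverse[OF subfield_Domain[OF G] m] by blast
    obtain s' where "(s, s') \<in> poly_rel G"
      using poly_rel_left_total[OF G s(1)] .
    hence "(p * s - 1, p' * s' - 1) \<in> poly_rel G"
      by (intro ring_rel_diff ring_rel_mult ring_rel_1 ring_rel_poly_rel partial_iso_ring_rel G p)
    from *[OF this] s(2) that show False
      by simp
  qed
qed

section \<open>Simple extensions and their isomorphisms\<close>

lemma subfield_adjoin: "subfield (adjoin E z) \<Omega>"
proof -
  interpret field "\<Omega> :: 'a ring"
    by rule
  show ?thesis
    unfolding adjoin_def by (rule generate_field_is_subfield) (simp add: ring_of_type_algebra_def)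
qed

lemma adjoin_incl: "E \<subseteq> adjoin E z" "z \<in> adjoin E z"
  by (auto simp: adjoin_def intro: generate_field.incl)

lemma adjoin_least: "subfield F \<Omega> \<Longrightarrow> E \<subseteq> F \<Longrightarrow> z \<in> F \<Longrightarrow> adjoin E z \<subseteq> F"
proof -
  assume *: "subfield F \<Omega>" "E \<subseteq> F" "z \<in> F"
  interpret field "\<Omega> :: 'a ring"
    by rule
  show ?thesis
    unfolding adjoin_def
    by (rule generate_field_min_subfield1) (use * in \<open>auto simp: ring_of_type_algebra_def\<close>)
qed

text \<open>Graph of the candidate extension of \<open>G\<close> sending \<open>z\<close> to
  \<open>z'\<close>. Only the first denominator is required not to vanish; that the second does not
  either follows from the vanishing condition under which this relation is a partial
  isomorphism.\<close>

definition adjoin_rel :: "('f::field \<times> 'f) set \<Rightarrow> 'f \<Rightarrow> 'f \<Rightarrow> ('f \<times> 'f) set"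
  where "adjoin_rel G z z' = {(poly p z / poly q z, poly p' z' / poly q' z') | p p' q q'.
    (p, p') \<in> poly_rel G \<and> (q, q') \<in> poly_rel G \<and> poly q z \<noteq> 0}"

lemma adjoin_rel_incl:
  assumes "ring_rel G"
  shows "G \<subseteq> adjoin_rel G z z'" and "(z, z') \<in> adjoin_rel G z z'"
proof -
  have 1: "(1, 1) \<in> poly_rel G" "(0, 0) \<in> poly_rel G"
    using assms by (auto intro: ring_rel_0 ring_rel_1 ring_rel_poly_rel)
  show "G \<subseteq> adjoin_rel G z z'"
  proof (clarify)
    fix x x' assume "(x, x') \<in> G"
    hence "([:x:], [:x':]) \<in> poly_rel G"
      using 1 by (intro poly_rel_pCons)
    thus "(x, x') \<in> adjoin_rel G z z'"
      unfolding adjoin_rel_def using 1(1) by force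
  qed
  have "([:0, 1:], [:0, 1:]) \<in> poly_rel G"
    using 1 by (intro poly_rel_pCons ring_rel_0 ring_rel_1 assms ring_rel_poly_rel)
  thus "(z, z') \<in> adjoin_rel G z z'"
    unfolding adjoin_rel_def using 1(1) by force
qed

text \<open>The vanishing condition says that \<open>p(z) \<mapsto> p'(z')\<close> is well defined
  and injective on polynomial expressions, so it passes to fractions.\<close>

lemma partial_iso_adjoin_rel:
  assumes G: "partial_iso G"
    and z: "\<And>p p'. (p, p') \<in> poly_rel G \<Longrightarrow> poly p z = 0 \<longleftrightarrow> poly p' z' = 0"
  shows "partial_iso (adjoin_rel G z z')"
proof -
  note PR = ring_rel_closed[OF ring_rel_poly_rel[OF partial_iso_ring_rel[OF G]]]
  let ?A = "adjoin_rel G z z'"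
  have I: "(y, y') \<in> ?A" if "(p, p') \<in> poly_rel G" "(q, q') \<in> poly_rel G" "poly q z \<noteq> 0"
    "y = poly p z / poly q z" "y' = poly p' z' / poly q' z'" for y y' p p' q q'
    using that unfolding adjoin_rel_def by blast
  note incl = adjoin_rel_incl(1)[OF partial_iso_ring_rel[OF G], of z z']
  have ring: "ring_rel ?A"
    unfolding ring_rel_def
  proof (intro conjI)
    show "(0, 0) \<in> ?A" "(1, 1) \<in> ?A"
      using incl ring_rel_0[OF partial_iso_ring_rel[OF G]] ring_rel_1[OF partial_iso_ring_rel[OF G]]
      by blast+
    show "\<forall>(x, x')\<in>?A. (- x, - x') \<in> ?A"
    proof clarify
      fix x x' assume "(x, x') \<in> ?A"
      then obtain p p' q q' where pq: "(p, p') \<in> poly_rel G" "(q, q') \<in> poly_rel G" "poly q z \<noteq> 0"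
        "x = poly p z / poly q z" "x' = poly p' z' / poly q' z'"
        unfolding adjoin_rel_def by blast
      show "(- x, - x') \<in> ?A"
        by (rule I[OF PR(3)[OF pq(1)] pq(2,3)]) (simp_all add: pq)
    qed
    show "\<forall>(x, x')\<in>?A. \<forall>(y, y')\<in>?A. (x + y, x' + y') \<in> ?A \<and> (x * y, x' * y') \<in> ?A"
    proof (clarify, intro conjI)
      fix x x' y y' assume "(x, x') \<in> ?A" "(y, y') \<in> ?A"
      then obtain p p' q q' s s' t t' where
        pq: "(p, p') \<in> poly_rel G" "(q, q') \<in> poly_rel G" "poly q z \<noteq> 0"
        "x = poly p z / poly q z" "x' = poly p' z' / poly q' z'" and
        st: "(s, s') \<in> poly_rel G" "(t, t') \<in> poly_rel G" "poly t z \<noteq> 0"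
        "y = poly s z / poly t z" "y' = poly s' z' / poly t' z'"
        unfolding adjoin_rel_def by blast
      have nz: "poly q' z' \<noteq> 0" "poly t' z' \<noteq> 0"
        using z pq st by blast+
      show "(x + y, x' + y') \<in> ?A"
        by (rule I[OF PR(4)[OF PR(6)[OF pq(1) st(2)] PR(6)[OF st(1) pq(2)]] PR(6)[OF pq(2) st(2)]])
          (simp_all add: pq st nz add_frac_eq)
      show "(x * y, x' * y') \<in> ?A"
        by (rule I[OF PR(6)[OF pq(1) st(1)] PR(6)[OF pq(2) st(2)]]) (simp_all add: pq st)
    qed
  qed
  show ?thesis
    unfolding partial_iso_def
  proof (intro conjI ring)
    show "\<forall>(x, x')\<in>?A. (inverse x, inverse x') \<in> ?A"
    proof clarify
      fix x x' assume "(x, x') \<in> ?A"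
      then obtain p p' q q' where pq: "(p, p') \<in> poly_rel G" "(q, q') \<in> poly_rel G" "poly q z \<noteq> 0"
        "x = poly p z / poly q z" "x' = poly p' z' / poly q' z'"
        unfolding adjoin_rel_def by blast
      show "(inverse x, inverse x') \<in> ?A"
      proof (cases "poly p z = 0")
        case True
        thus ?thesis
          using pq z[OF pq(1)] ring_rel_0[OF ring] by simp
      next
        case False
        show ?thesis
          by (rule I[OF pq(2,1) False]) (simp_all add: pq)
      qed
    qed
    show "\<forall>x'. (0, x') \<in> ?A \<longrightarrow> x' = 0"
      unfolding adjoin_rel_def using z by force
  qed
qed

lemma Domain_adjoin_rel:
  assumes "partial_iso G"
    and z: "\<And>p p'. (p, p') \<in> poly_rel G \<Longrightarrow> poly p z = 0 \<longleftrightarrow> poly p' z' = 0"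
  shows "Domain (adjoin_rel G z z') = adjoin (Domain G) z"
proof
  have z': "z \<in> Domain (adjoin_rel G z z')"
    using adjoin_rel_incl[OF partial_iso_ring_rel[OF assms(1)]] by blast
  show "adjoin (Domain G) z \<subseteq> Domain (adjoin_rel G z z')"
    by (rule adjoin_least[OF subfield_Domain[OF partial_iso_adjoin_rel[OF assms]] _ z'])
      (use adjoin_rel_incl[OF partial_iso_ring_rel[OF assms(1)]] in blast)+
  note D = subfield_closed[OF subfield_adjoin[of "Domain G" z]]
  have "poly p z \<in> adjoin (Domain G) z" if "(p, p') \<in> poly_rel G" for p p'
  proof -
    have "(p, p) \<in> poly_rel (Id_on (adjoin (Domain G) z))"
      using that adjoin_incl(1)[where E = "Domain G" and z = z] by (fastforce simp: poly_rel_Id_on poly_rel_def)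
    moreover have "(z, z) \<in> Id_on (adjoin (Domain G) z)"
      using adjoin_incl by blast
    ultimately show ?thesis
      using poly_rel_poly partial_iso_ring_rel subfield_adjoin partial_iso_Id_on by blast
  qed
  thus "Domain (adjoin_rel G z z') \<subseteq> adjoin (Domain G) z"
    unfolding adjoin_rel_def using D(6) by blast
qed

lemma poly_mem_subfield:
  assumes "subfield E \<Omega>" and "p \<in> polys_over E" and "x \<in> E"
  shows "poly p x \<in> E"
  using poly_rel_poly[of "Id_on E" p p x x] assms
  by (auto simp: partial_iso_ring_rel partial_iso_Id_on poly_rel_Id_on)

lemma adjoin_eq_fractions:
  assumes "subfield E \<Omega>"
  shows "adjoin E z = {poly p z / poly q z | p q. p \<in> polys_over E \<and> q \<in> polys_over E \<and> poly q z \<noteq> 0}"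
proof -
  have "adjoin E z = Domain (adjoin_rel (Id_on E) z z)"
    using assms by (subst Domain_adjoin_rel) (auto simp: partial_iso_Id_on poly_rel_Id_on)
  thus ?thesis
    by (auto simp: adjoin_rel_def poly_rel_Id_on) blast+
qed

lemma root_imp_degree_pos:
  assumes "p \<noteq> 0" and "poly p z = 0"
  shows "degree p > 0"
proof (rule ccontr)
  assume "\<not> degree p > 0"
  then obtain c where "p = [:c:]"
    by (metis degree_eq_zeroE gr0I)
  thus False
    using assms by simp
qed

text \<open>The invariant \<open>R\<close> is carried along so that one maximality argument serves
  twice: with the trivial invariant for extending isomorphisms, and with \<open>u x' = u' x\<close>
  for conjugating valuations.\<close>

lemma partial_iso_Zorn:
  assumes F: "subfield F \<Omega>" and G0: "partial_iso G0" "G0 \<subseteq> F \<times> F" "\<forall>(x, x')\<in>G0. R x x'"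
    and step: "\<And>G z. partial_iso G \<Longrightarrow> G0 \<subseteq> G \<Longrightarrow> G \<subseteq> F \<times> F \<Longrightarrow> \<forall>(x, x')\<in>G. R x x' \<Longrightarrow> z \<in> F \<Longrightarrow>
      \<exists>z'\<in>F. (\<forall>(p, p')\<in>poly_rel G. poly p z = 0 \<longleftrightarrow> poly p' z' = 0) \<and>
        (\<forall>(y, y')\<in>adjoin_rel G z z'. R y y')"
  shows "\<exists>G. partial_iso G \<and> G0 \<subseteq> G \<and> G \<subseteq> F \<times> F \<and> (\<forall>(x, x')\<in>G. R x x') \<and> Domain G = F"
proof -
  define S where "S = {G. partial_iso G \<and> G0 \<subseteq> G \<and> G \<subseteq> F \<times> F \<and> (\<forall>(x, x')\<in>G. R x x')}"
  have "\<exists>M\<in>S. \<forall>N\<in>S. M \<subseteq> N \<longrightarrow> N = M"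
  proof (rule subset_Zorn_nonempty)
    show "S \<noteq> {}"
      using G0 unfolding S_def by blast
    fix C assume C: "C \<noteq> {}" "subset.chain S C"
    hence "C \<subseteq> S"
      by (simp add: subset_chain_def)
    hence sub: "G \<in> C \<Longrightarrow> partial_iso G \<and> G0 \<subseteq> G \<and> G \<subseteq> F \<times> F \<and> (\<forall>(x, x')\<in>G. R x x')" for G
      unfolding S_def by blast
    have two: "\<exists>G\<in>C. s \<in> G \<and> t \<in> G" if "s \<in> \<Union>C" "t \<in> \<Union>C" for s t
    proof -
      from that obtain G H where "G \<in> C" "H \<in> C" "s \<in> G" "t \<in> H"
        by blast
      moreover have "G \<subseteq> H \<or> H \<subseteq> G"
        using calculation C(2) by (simp add: subset_chain_def)
      ultimately show ?thesis
        by blast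
    qed
    obtain G1 where G1: "G1 \<in> C"
      using C by blast
    hence G1': "partial_iso G1" "G0 \<subseteq> G1"
      using sub by auto
    have "ring_rel (\<Union>C)"
      unfolding ring_rel_def
    proof (intro conjI)
      show "(0, 0) \<in> \<Union>C" "(1, 1) \<in> \<Union>C"
        using G1 ring_rel_0 ring_rel_1 partial_iso_ring_rel[OF G1'(1)] by blast+
      show "\<forall>(x, x')\<in>\<Union>C. (- x, - x') \<in> \<Union>C"
        using sub ring_rel_uminus partial_iso_ring_rel by blast
      show "\<forall>(x, x')\<in>\<Union>C. \<forall>(y, y')\<in>\<Union>C. (x + y, x' + y') \<in> \<Union>C \<and> (x * y, x' * y') \<in> \<Union>C"
      proof clarify
        fix x x' y y' G H assume "(x, x') \<in> G" "G \<in> C" "(y, y') \<in> H" "H \<in> C"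
        then obtain J where J: "J \<in> C" "(x, x') \<in> J" "(y, y') \<in> J"
          using two by blast
        hence "ring_rel J"
          using sub partial_iso_ring_rel by blast
        thus "(x + y, x' + y') \<in> \<Union>C \<and> (x * y, x' * y') \<in> \<Union>C"
          using J ring_rel_add ring_rel_mult by blast
      qed
    qed
    moreover have "\<forall>(x, x')\<in>\<Union>C. (inverse x, inverse x') \<in> \<Union>C"
      using sub partial_iso_inverse by blast
    moreover have "\<forall>x'. (0, x') \<in> \<Union>C \<longrightarrow> x' = 0"
      using sub by (auto simp: partial_iso_def)
    ultimately have "partial_iso (\<Union>C)"
      by (simp add: partial_iso_def)
    moreover have "G0 \<subseteq> \<Union>C" "\<Union>C \<subseteq> F \<times> F" "\<forall>(x, x')\<in>\<Union>C. R x x'"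
      using sub G1 G1' by blast+
    ultimately show "\<Union>C \<in> S"
      unfolding S_def by simp
  qed
  then obtain G where "G \<in> S" and max: "\<And>N. N \<in> S \<Longrightarrow> G \<subseteq> N \<Longrightarrow> N = G"
    by auto
  hence G: "partial_iso G" "G0 \<subseteq> G" "G \<subseteq> F \<times> F" "\<forall>(x, x')\<in>G. R x x'"
    unfolding S_def by auto
  have "z \<in> Domain G" if "z \<in> F" for z
  proof -
    obtain z' where z': "z' \<in> F" "\<forall>(p, p')\<in>poly_rel G. poly p z = 0 \<longleftrightarrow> poly p' z' = 0"
      "\<forall>(y, y')\<in>adjoin_rel G z z'. R y y'"
      using step[OF G \<open>z \<in> F\<close>] by blast
    note incl = adjoin_rel_incl[OF partial_iso_ring_rel[OF G(1)], of z z']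
    have coeffs: "p \<in> polys_over F" "p' \<in> polys_over F" if "(p, p') \<in> poly_rel G" for p p'
      using that G(3) by (auto simp: poly_rel_def)
    have "poly p z \<in> F" "poly p' z' \<in> F" if "(p, p') \<in> poly_rel G" for p p'
      using poly_mem_subfield[OF F] coeffs[OF that] \<open>z \<in> F\<close> z'(1) by blast+
    hence "adjoin_rel G z z' \<subseteq> F \<times> F"
      unfolding adjoin_rel_def using subfield_divide[OF F] by blast
    moreover have "partial_iso (adjoin_rel G z z')"
      by (rule partial_iso_adjoin_rel[OF G(1)]) (use z' in blast)
    ultimately have "adjoin_rel G z z' = G"
      using incl G z' by (intro max) (auto simp: S_def)
    thus ?thesis
      using incl by blast
  qed
  hence "Domain G = F"
    using G(3) by blast
  thus ?thesis
    using G by blast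
qed


section \<open>Automorphisms of an algebraic closure\<close>

text \<open>Roots exist because the ambient type is algebraically closed wherever they are needed;
  the last clause only has to put them into \<open>F\<close>.\<close>

definition alg_closure_of :: "'f::field set \<Rightarrow> 'f set \<Rightarrow> bool"
  where "alg_closure_of L F \<longleftrightarrow> subfield L \<Omega> \<and> subfield F \<Omega> \<and> L \<subseteq> F \<and>
    (\<forall>z\<in>F. \<exists>p\<in>polys_over L. p \<noteq> 0 \<and> poly p z = 0) \<and>
    (\<forall>p\<in>polys_over F. \<forall>z. p \<noteq> 0 \<and> poly p z = 0 \<longrightarrow> z \<in> F)"

lemma alg_closure_ofD:
  assumes "alg_closure_of L F"
  shows "subfield L \<Omega>" and "subfield F \<Omega>" and "L \<subseteq> F"
    and "z \<in> F \<Longrightarrow> \<exists>p\<in>polys_over L. p \<noteq> 0 \<and> poly p z = 0"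
    and "p \<in> polys_over F \<Longrightarrow> p \<noteq> 0 \<Longrightarrow> poly p z = 0 \<Longrightarrow> z \<in> F"
  using assms by (auto simp: alg_closure_of_def)

lemma alg_closure_of_mono:
  assumes "alg_closure_of L F" and "subfield E \<Omega>" and "L \<subseteq> E" and "E \<subseteq> F"
  shows "alg_closure_of E F"
  unfolding alg_closure_of_def using assms alg_closure_ofD[OF assms(1)] by blast

lemma mem_field_auts_iff:
  "\<sigma> \<in> field_auts F L \<longleftrightarrow> bij_betw \<sigma> F F \<and> \<sigma> 1 = 1 \<and> (\<forall>x\<in>L. \<sigma> x = x) \<and>
    (\<forall>x\<in>F. \<forall>y\<in>F. \<sigma> (x + y) = \<sigma> x + \<sigma> y \<and> \<sigma> (x * y) = \<sigma> x * \<sigma> y)"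
  by (auto simp: field_auts_def ring_iso_def ring_hom_def ring_of_type_algebra_def
      bij_betw_def)

lemma field_auts_mem: "\<sigma> \<in> field_auts F L \<Longrightarrow> x \<in> F \<Longrightarrow> \<sigma> x \<in> F"
  by (auto simp: mem_field_auts_iff bij_betw_def)

lemma field_auts_mono: "L \<subseteq> L' \<Longrightarrow> field_auts F L' \<subseteq> field_auts F L"
  by (auto simp: field_auts_def)

lemma field_auts_id: "(\<lambda>x. x) \<in> field_auts F L"
  by (auto simp: mem_field_auts_iff bij_betw_def)

lemma field_auts_comp:
  assumes "\<sigma> \<in> field_auts F L" and "\<tau> \<in> field_auts F L"
  shows "(\<lambda>x. \<sigma> (\<tau> x)) \<in> field_auts F L"
proof -
  have "bij_betw (\<sigma> \<circ> \<tau>) F F"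
    using assms by (intro bij_betw_trans) (auto simp: mem_field_auts_iff)
  thus ?thesis
    using assms field_auts_mem[OF assms(2)] by (auto simp: mem_field_auts_iff o_def)
qed

abbreviation graph_on :: "('a \<Rightarrow> 'b) \<Rightarrow> 'a set \<Rightarrow> ('a \<times> 'b) set"
  where "graph_on \<sigma> F \<equiv> (\<lambda>x. (x, \<sigma> x)) ` F"

lemma partial_iso_graph:
  assumes F: "subfield F \<Omega>" and "\<sigma> \<in> field_auts F L"
  shows "partial_iso (graph_on \<sigma> F)"
proof -
  note [simp] = subfield_closed[OF F]
  note \<sigma> = assms(2)[unfolded mem_field_auts_iff]
  have add: "\<sigma> (x + y) = \<sigma> x + \<sigma> y" and mult: "\<sigma> (x * y) = \<sigma> x * \<sigma> y" if "x \<in> F" "y \<in> F" for x y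
    using \<sigma> that by auto
  have 0: "\<sigma> 0 = 0"
    using add[of 0 0] by (metis add_cancel_right_right add_0 subfield_0[OF F])
  have uminus: "\<sigma> (- x) = - \<sigma> x" if "x \<in> F" for x
    using add[of x "- x"] that 0 by (simp add: add_eq_0_iff)
  have inv: "\<sigma> (inverse x) = inverse (\<sigma> x)" if "x \<in> F" for x
  proof (cases "x = 0")
    case False
    hence "\<sigma> x * \<sigma> (inverse x) = 1"
      using mult[of x "inverse x"] that \<sigma> by simp
    thus ?thesis
      by (metis inverse_unique)
  qed (simp add: 0)
  show ?thesis
    unfolding partial_iso_def ring_rel_def
    using \<sigma> by (auto simp: 0 add mult uminus inv image_iff)
qed

lemma field_auts_ring_hom:
  assumes F: "subfield F \<Omega>" and \<sigma>: "\<sigma> \<in> field_auts F L" and x: "x \<in> F"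
  shows field_auts_0_iff: "\<sigma> x = 0 \<longleftrightarrow> x = 0"
    and field_auts_add: "y \<in> F \<Longrightarrow> \<sigma> (x + y) = \<sigma> x + \<sigma> y"
    and field_auts_diff: "y \<in> F \<Longrightarrow> \<sigma> (x - y) = \<sigma> x - \<sigma> y"
    and field_auts_mult: "y \<in> F \<Longrightarrow> \<sigma> (x * y) = \<sigma> x * \<sigma> y"
    and field_auts_uminus: "\<sigma> (- x) = - \<sigma> x"
    and field_auts_inverse: "\<sigma> (inverse x) = inverse (\<sigma> x)"
proof -
  note G = partial_iso_graph[OF F \<sigma>]
  note R = partial_iso_ring_rel[OF G]
  have mem: "(x, \<sigma> x) \<in> graph_on \<sigma> F" if "x \<in> F" for x
    using that by blast
  show "\<sigma> x = 0 \<longleftrightarrow> x = 0"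
    using partial_iso_0_iff[OF G mem[OF x]] .
  show "\<sigma> (- x) = - \<sigma> x"
    using ring_rel_uminus[OF R mem[OF x]] by auto
  show "\<sigma> (inverse x) = inverse (\<sigma> x)"
    using partial_iso_inverse[OF G mem[OF x]] by auto
  show "\<sigma> (x + y) = \<sigma> x + \<sigma> y" "\<sigma> (x - y) = \<sigma> x - \<sigma> y" "\<sigma> (x * y) = \<sigma> x * \<sigma> y" if "y \<in> F"
    using ring_rel_add[OF R mem[OF x] mem[OF that]] ring_rel_diff[OF R mem[OF x] mem[OF that]]
      ring_rel_mult[OF R mem[OF x] mem[OF that]]
    by auto
qed

lemma poly_rel_graph_iff: "(p, p) \<in> poly_rel (graph_on \<sigma> F) \<longleftrightarrow> (\<forall>i. coeff p i \<in> F \<and> \<sigma> (coeff p i) = coeff p i)"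
  by (auto simp: poly_rel_def image_iff)

lemma field_auts_poly:
  assumes "subfield F \<Omega>" and "\<sigma> \<in> field_auts F L" and "p \<in> polys_over L" and "L \<subseteq> F" and "x \<in> F"
  shows "\<sigma> (poly p x) = poly p (\<sigma> x)"
proof -
  have "(p, p) \<in> poly_rel (graph_on \<sigma> F)"
    using assms by (auto simp: poly_rel_graph_iff mem_field_auts_iff)
  moreover have "(x, \<sigma> x) \<in> graph_on \<sigma> F"
    using assms by blast
  ultimately have "(poly p x, poly p (\<sigma> x)) \<in> graph_on \<sigma> F"
    using partial_iso_graph[OF assms(1,2)] by (intro poly_rel_poly partial_iso_ring_rel)
  thus ?thesis
    by auto
qed

text \<open>Only surjectivity is at stake. Each \<open>y\<close> in \<open>F\<close> is a root of
  some \<open>p\<close> over \<open>L\<close>, and the injection permutes the finite set of roots of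
  \<open>p\<close> in \<open>F\<close>.\<close>

lemma field_auts_of_partial_iso:
  assumes LF: "alg_closure_of L F" and G: "partial_iso G" "Id_on L \<subseteq> G" "G \<subseteq> F \<times> F" "Domain G = F"
  shows "\<exists>\<sigma>\<in>field_auts F L. \<forall>(x, x')\<in>G. \<sigma> x = x'"
proof -
  note R = partial_iso_ring_rel[OF G(1)]
  define \<sigma> where "\<sigma> x = (SOME x'. (x, x') \<in> G)" for x
  have mem: "(x, \<sigma> x) \<in> G" if "x \<in> F" for x
  proof -
    have "\<exists>x'. (x, x') \<in> G"
      using that G(4) by blast
    thus ?thesis
      unfolding \<sigma>_def by (rule someI_ex)
  qed
  have \<sigma>: "\<sigma> x = x'" if "(x, x') \<in> G" for x x'
    using partial_iso_unique[OF G(1) that mem[of x]] that G(3) by blast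
  have inj: "inj_on \<sigma> F"
    using partial_iso_unique[OF G(1) mem mem] by (auto simp: inj_on_def)
  have "F \<subseteq> \<sigma> ` F"
  proof
    fix y assume y: "y \<in> F"
    then obtain p where p: "p \<in> polys_over L" "p \<noteq> 0" "poly p y = 0"
      using alg_closure_ofD(4)[OF LF] by blast
    define S where "S = {x \<in> F. poly p x = 0}"
    have pp: "(p, p) \<in> poly_rel G"
      using p(1) G(2) by (auto simp: poly_rel_def)
    have "\<sigma> x \<in> S" if "x \<in> S" for x
    proof -
      have "(poly p x, poly p (\<sigma> x)) \<in> G"
        using that mem by (intro poly_rel_poly R pp) (auto simp: S_def)
      thus ?thesis
        using that partial_iso_0_iff[OF G(1)] mem[of x] G(3) by (auto simp: S_def)
    qed
    moreover have "finite S"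
      unfolding S_def using poly_roots_finite[OF p(2)] by simp
    moreover have "inj_on \<sigma> S"
      by (rule inj_on_subset[OF inj]) (auto simp: S_def)
    ultimately have "\<sigma> ` S = S"
      by (simp add: endo_inj_surj image_subsetI)
    moreover have "y \<in> S"
      using y p by (simp add: S_def)
    ultimately have "y \<in> \<sigma> ` S"
      by simp
    thus "y \<in> \<sigma> ` F"
      by (auto simp: S_def)
  qed
  moreover have "\<sigma> ` F \<subseteq> F"
    using mem G(3) by blast
  ultimately have bij: "bij_betw \<sigma> F F"
    using inj by (auto simp: bij_betw_def)
  have "\<sigma> \<in> field_auts F L"
    unfolding mem_field_auts_iff
  proof (intro conjI ballI bij)
    show "\<sigma> 1 = 1"
      using \<sigma>[OF ring_rel_1[OF R]] .
    show "\<sigma> x = x" if "x \<in> L" for x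
      using \<sigma> G(2) that by blast
    show "\<sigma> (x + y) = \<sigma> x + \<sigma> y" "\<sigma> (x * y) = \<sigma> x * \<sigma> y" if "x \<in> F" "y \<in> F" for x y
      using \<sigma>[OF ring_rel_add[OF R mem mem]] \<sigma>[OF ring_rel_mult[OF R mem mem]] that by auto
  qed
  thus ?thesis
    using \<sigma> by blast
qed

text \<open>To adjoin \<open>z\<close>, the minimal polynomial of \<open>z\<close> over the domain
  is transported along \<open>G\<close>; any root of the image can serve as the image of
  \<open>z\<close>.\<close>

lemma partial_iso_extends:
  fixes F :: "'f::alg_closed_field set"
  assumes LF: "alg_closure_of L F" and G0: "partial_iso G0" "Id_on L \<subseteq> G0" "G0 \<subseteq> F \<times> F"
  shows "\<exists>\<sigma>\<in>field_auts F L. \<forall>(x, x')\<in>G0. \<sigma> x = x'"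
proof -
  have "\<exists>G. partial_iso G \<and> G0 \<subseteq> G \<and> G \<subseteq> F \<times> F \<and> (\<forall>(x, x')\<in>G. True) \<and> Domain G = F"
  proof (rule partial_iso_Zorn[OF alg_closure_ofD(2)[OF LF] G0(1,3)])
    fix G z assume G: "partial_iso G" "G0 \<subseteq> G" "G \<subseteq> F \<times> F" and z: "z \<in> F"
    obtain p where p: "p \<in> polys_over L" "p \<noteq> 0" "poly p z = 0"
      using alg_closure_ofD(4)[OF LF z] by blast
    have "p \<in> polys_over (Domain G)"
      using p(1) G0(2) G(2) by blast
    then obtain m where m: "minimal_poly (Domain G) z m"
      using minimal_poly_exists p(2,3) by blast
    hence m0: "m \<in> polys_over (Domain G)" "m \<noteq> 0" "poly m z = 0"
      by (auto simp: minimal_poly_def)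
    obtain m' where m': "(m, m') \<in> poly_rel G"
      using poly_rel_left_total[OF G(1) m0(1)] .
    have "degree m > 0"
      using m0 by (intro root_imp_degree_pos)
    hence "degree m' > 0"
      using poly_rel_degree[OF G(1) m'] by simp
    then obtain z' where z': "poly m' z' = 0"
      using alg_closed_imp_poly_has_root by blast
    have "m' \<in> polys_over F" "m' \<noteq> 0"
      using m' G(3) poly_rel_0_iff[OF G(1) m'] m0 by (auto simp: poly_rel_def)
    hence "z' \<in> F"
      using alg_closure_ofD(5)[OF LF] z' by blast
    thus "\<exists>z'\<in>F. (\<forall>(p, p')\<in>poly_rel G. poly p z = 0 \<longleftrightarrow> poly p' z' = 0) \<and>
        (\<forall>(y, y')\<in>adjoin_rel G z z'. True)"
      using minimal_poly_root_iff[OF G(1) m m' z'] by (intro bexI[of _ z']) blast+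
  qed auto
  then obtain G where G: "partial_iso G" "G0 \<subseteq> G" "G \<subseteq> F \<times> F" "Domain G = F"
    by blast
  have "Id_on L \<subseteq> G"
    using G(2) G0(2) by order
  from field_auts_of_partial_iso[OF LF G(1) this G(3,4)]
  obtain \<sigma> where "\<sigma> \<in> field_auts F L" "\<forall>(x, x')\<in>G. \<sigma> x = x'"
    by (elim bexE)
  thus ?thesis
    using G(2) by (intro bexI[of _ \<sigma>]) auto
qed

lemma conjugate_if_same_vanishing:
  fixes F :: "'f::alg_closed_field set"
  assumes LF: "alg_closure_of L F" and "z \<in> F" and "z' \<in> F"
    and z: "\<And>p. p \<in> polys_over L \<Longrightarrow> poly p z = 0 \<longleftrightarrow> poly p z' = 0"
  shows "\<exists>\<sigma>\<in>field_auts F L. \<sigma> z = z'"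
proof -
  note F = alg_closure_ofD[OF LF]
  let ?A = "adjoin_rel (Id_on L) z z'"
  have G: "partial_iso (Id_on L)"
    using F(1) by (simp add: partial_iso_Id_on)
  note incl = adjoin_rel_incl[OF partial_iso_ring_rel[OF G], of z z']
  have "poly p z \<in> F" "poly p z' \<in> F" if "p \<in> polys_over L" for p
  proof -
    have "p \<in> polys_over F"
      using that F(3) by auto
    thus "poly p z \<in> F" "poly p z' \<in> F"
      by (auto intro: poly_mem_subfield[OF F(2)] assms)
  qed
  hence "?A \<subseteq> F \<times> F"
    unfolding adjoin_rel_def poly_rel_Id_on using subfield_divide[OF F(2)] by blast
  moreover have "partial_iso ?A"
    by (rule partial_iso_adjoin_rel[OF G]) (use z in \<open>auto simp: poly_rel_Id_on\<close>)
  ultimately show ?thesis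
    using partial_iso_extends[OF LF _ incl(1)] incl(2) by fast
qed

text \<open>
  With inseparable extensions, an element fixed by all automorphisms need not lie in the base
  field, but its minimal polynomial is a power of a linear one, whose constant term is a power of
  the element.
\<close>

lemma fixed_power_mem:
  fixes F :: "'f::alg_closed_field set"
  assumes LF: "alg_closure_of L F" and "z \<in> F" and fixed: "\<And>\<sigma>. \<sigma> \<in> field_auts F L \<Longrightarrow> \<sigma> z = z"
    and p: "p \<in> polys_over L" "p \<noteq> 0" "poly p z = 0"
  shows "z ^ fact (degree p) \<in> L"
proof -
  note F = alg_closure_ofD[OF LF]
  have G: "partial_iso (Id_on L)"
    using F(1) by (simp add: partial_iso_Id_on)
  obtain m where m: "minimal_poly L z m" "degree m \<le> degree p"
    using minimal_poly_exists[OF p] .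
  hence m0: "m \<in> polys_over L" "m \<noteq> 0" "poly m z = 0"
    by (auto simp: minimal_poly_def)
  have "z' = z" if z': "poly m z' = 0" for z'
  proof -
    have "z' \<in> F"
      using F(5)[OF _ m0(2) z'] m0(1) F(3) by blast
    moreover have "poly p z = 0 \<longleftrightarrow> poly p z' = 0" if "p \<in> polys_over L" for p
      by (rule minimal_poly_root_iff[OF G]) (use m(1) m0 z' that in \<open>simp_all add: poly_rel_Id_on Id_on_iff\<close>)
    ultimately obtain \<sigma> where "\<sigma> \<in> field_auts F L" "\<sigma> z = z'"
      using conjugate_if_same_vanishing[OF LF \<open>z \<in> F\<close>] by blast
    thus ?thesis
      using fixed by auto
  qed
  moreover obtain A where A: "size A = degree m" "m = smult (lead_coeff m) (\<Prod>x\<in>#A. [:- x, 1:])"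
    using alg_closed_imp_factorization[OF m0(2)] by metis
  have "x \<in># A \<Longrightarrow> poly m x = 0" for x
    by (subst A(2)) (auto simp: poly_prod_mset)
  ultimately have "set_mset A \<subseteq> {z}"
    by blast
  hence A': "A = replicate_mset (degree m) z"
    using A(1) by (metis set_mset_subset_singletonD)
  have "m = smult (lead_coeff m) ([:- z, 1:] ^ degree m)"
    using A(2) unfolding A' by simp
  hence "coeff m 0 = lead_coeff m * (- z) ^ degree m"
    by (metis coeff_smult coeff_0_power coeff_pCons_0)
  hence "(- z) ^ degree m = coeff m 0 / lead_coeff m"
    using m0(2) by simp
  moreover have "coeff m 0 / lead_coeff m \<in> L"
    using m0(1) by (intro subfield_divide[OF F(1)]) auto
  moreover have "z ^ degree m = (- 1) ^ degree m * (- z) ^ degree m"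
    by (simp flip: power_mult_distrib)
  ultimately have "z ^ degree m \<in> L"
    by (metis F(1) subfield_1 subfield_mult subfield_power subfield_uminus)
  moreover have "degree m > 0"
    using m0 by (intro root_imp_degree_pos)
  \<comment> \<open>The factorial gives an exponent depending on \<open>p\<close> alone. The same
    \<open>p\<close> can then be used over many base fields at once, although the degree of
    \<open>m\<close> varies with them.\<close>
  hence "degree m dvd fact (degree p)"
    using m(2) by (intro dvd_fact) auto
  ultimately show ?thesis
    by (metis F(1) subfield_power power_mult dvdE)
qed

section \<open>Valuations\<close>

lemma extended_add_strict_left_mono:
  fixes a b c :: "'g::linordered_ab_group_add extended"
  assumes "a < b" and "c \<noteq> Pinf" and "c \<noteq> Minf"
  shows "c + a < c + b"
  using assms by (cases a; cases b; cases c) auto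

lemma extended_add_less_le_mono:
  fixes a b c d :: "'g::linordered_ab_group_add extended"
  assumes "a < b" and "c \<le> d" and "c \<noteq> Pinf" and "c \<noteq> Minf"
  shows "a + c < b + d"
  using assms by (cases a; cases b; cases c; cases d) (auto intro: add_less_le_mono)

lemma extended_add_left_cancel:
  fixes a b c :: "'g::linordered_ab_group_add extended"
  assumes "c \<noteq> Pinf" and "c \<noteq> Minf" and "a \<noteq> Minf" and "b \<noteq> Minf"
  shows "c + a = c + b \<longleftrightarrow> a = b"
  using assms by (cases a; cases b; cases c) auto

lemma Fin_sum: "Fin (sum f A) = (\<Sum>i\<in>A. Fin (f i :: 'g::linordered_ab_group_add))"
  by (induction A rule: infinite_finite_induct) (auto simp: zero_extended_def simp flip: plus_extended.simps)

text \<open>Torsion-freeness of ordered groups, with multiples written as constant sums. It turns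
  equality of values at a power into equality at the element itself.\<close>

lemma sum_const_inject:
  fixes a b :: "'g::linordered_ab_group_add extended" and n :: nat
  assumes "(\<Sum>j<n. a) = (\<Sum>j<n. b)" and "n > 0" and "a \<noteq> Minf" and "b \<noteq> Minf"
  shows "a = b"
proof -
  have Pinf: "(\<Sum>j<n. Pinf :: 'g extended) = Pinf"
    using \<open>n > 0\<close> by (induction n rule: nat_induct_non_zero) auto
  have *: "(\<Sum>j<n. g) \<noteq> (\<Sum>j<n. h)" if "g < h" for g h :: 'g
    using sum_strict_mono[of "{..<n}" "\<lambda>_. g" "\<lambda>_. h"] that \<open>n > 0\<close>
    by (auto simp: lessThan_empty_iff)
  have "g = h" if "(\<Sum>j<n. g) = (\<Sum>j<n. h)" for g h :: 'g
    using *[of g h] *[of h g] that by (metis neqE)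
  thus ?thesis
    using assms Pinf by (cases a; cases b) (auto simp flip: Fin_sum)
qed

text \<open>Stated for subrings of a domain rather than for subfields, so that Gauss valuations on
  polynomial rings are covered by the same lemmas.\<close>

definition ring_valuation_on ::
    "'a::idom set \<Rightarrow> ('a \<Rightarrow> 'g::linordered_ab_group_add extended) \<Rightarrow> bool"
  where "ring_valuation_on R v \<longleftrightarrow> ring_rel (Id_on R) \<and>
    (\<forall>x\<in>R. v x \<noteq> Minf \<and> (v x = Pinf \<longleftrightarrow> x = 0)) \<and>
    (\<forall>x\<in>R. \<forall>y\<in>R. v (x * y) = v x + v y \<and> min (v x) (v y) \<le> v (x + y))"

lemma ring_valuation_on_subfield:
  assumes "subfield F \<Omega>" and "valuation_on F v"
  shows "ring_valuation_on F v"
  using assms(2) partial_iso_ring_rel[OF assms(1)[folded partial_iso_Id_on]]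
  by (auto simp: ring_valuation_on_def valuation_on_def)

lemma ring_valuation_closed:
  assumes "ring_valuation_on R v"
  shows ring_valuation_0_mem: "0 \<in> R" and ring_valuation_1_mem: "1 \<in> R"
    and ring_valuation_uminus_mem: "x \<in> R \<Longrightarrow> - x \<in> R"
    and ring_valuation_add_mem: "x \<in> R \<Longrightarrow> y \<in> R \<Longrightarrow> x + y \<in> R"
    and ring_valuation_diff_mem: "x \<in> R \<Longrightarrow> y \<in> R \<Longrightarrow> x - y \<in> R"
    and ring_valuation_mult_mem: "x \<in> R \<Longrightarrow> y \<in> R \<Longrightarrow> x * y \<in> R"
    and ring_valuation_power_mem: "x \<in> R \<Longrightarrow> x ^ n \<in> R"
    and ring_valuation_sum_mem: "(\<And>i. i \<in> A \<Longrightarrow> f i \<in> R) \<Longrightarrow> sum f A \<in> R"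
  using assms ring_rel_closed[of "Id_on R"] ring_rel_sum[of "Id_on R" A f f]
  by (simp_all add: ring_valuation_on_def Id_on_iff)

lemma ring_valuation:
  assumes v: "ring_valuation_on R v"
  shows ring_valuation_not_Minf: "x \<in> R \<Longrightarrow> v x \<noteq> Minf"
    and ring_valuation_Pinf_iff: "x \<in> R \<Longrightarrow> v x = Pinf \<longleftrightarrow> x = 0"
    and ring_valuation_mult: "x \<in> R \<Longrightarrow> y \<in> R \<Longrightarrow> v (x * y) = v x + v y"
    and ring_valuation_add: "x \<in> R \<Longrightarrow> y \<in> R \<Longrightarrow> min (v x) (v y) \<le> v (x + y)"
    and ring_valuation_0: "v 0 = Pinf"
    and ring_valuation_1: "v 1 = 0"
    and ring_valuation_uminus: "x \<in> R \<Longrightarrow> v (- x) = v x"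
proof -
  note mem = ring_valuation_closed[OF v]
  show *: "x \<in> R \<Longrightarrow> v x \<noteq> Minf" "x \<in> R \<Longrightarrow> v x = Pinf \<longleftrightarrow> x = 0"
    "x \<in> R \<Longrightarrow> y \<in> R \<Longrightarrow> v (x * y) = v x + v y"
    "x \<in> R \<Longrightarrow> y \<in> R \<Longrightarrow> min (v x) (v y) \<le> v (x + y)" for x y
    using v by (auto simp: ring_valuation_on_def)
  show "v 0 = Pinf"
    using *(2)[OF mem(1)] by simp
  show 1: "v 1 = 0"
    using *(1,2)[OF mem(2)] *(3)[OF mem(2) mem(2)]
    by (cases "v 1") (auto simp: zero_extended_def)
  have m1: "- 1 \<in> R"
    by (rule mem(3)[OF mem(2)])
  obtain g where g: "v (- 1) = Fin g"
    using *(1,2)[OF m1] by (cases "v (- 1)") auto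
  have "g + g = 0"
    using *(3)[OF m1 m1] 1 g by (simp add: zero_extended_def)
  hence "v (- 1) = 0"
    using g by (simp add: zero_extended_def)
  thus "x \<in> R \<Longrightarrow> v (- x) = v x"
    using *(3)[OF m1, of x] by simp
qed

lemma ring_valuation_diff:
  "ring_valuation_on R v \<Longrightarrow> x \<in> R \<Longrightarrow> y \<in> R \<Longrightarrow> min (v x) (v y) \<le> v (x - y)"
  using ring_valuation_add[of R v x "- y"] by (simp add: ring_valuation_uminus ring_valuation_uminus_mem)

lemma ring_valuation_power:
  assumes "ring_valuation_on R v" and "x \<in> R"
  shows "v (x ^ n) = (\<Sum>j<n. v x)"
proof (induction n)
  case (Suc n)
  thus ?case
    using ring_valuation_mult[OF assms(1,2) ring_valuation_power_mem[OF assms]]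
    by (simp add: add.commute)
qed (simp add: ring_valuation_1[OF assms(1)])

lemma ring_valuation_sum:
  assumes v: "ring_valuation_on R v" and "\<And>i. i \<in> A \<Longrightarrow> f i \<in> R" and "\<And>i. i \<in> A \<Longrightarrow> b \<le> v (f i)"
  shows "b \<le> v (sum f A)"
  using assms(2,3)
proof (induction A rule: infinite_finite_induct)
  case (insert i A)
  have "sum f A \<in> R"
    by (rule ring_valuation_sum_mem[OF v]) (use insert in auto)
  hence "min (v (f i)) (v (sum f A)) \<le> v (f i + sum f A)"
    using insert by (intro ring_valuation_add[OF v]) auto
  moreover have "b \<le> min (v (f i)) (v (sum f A))"
    using insert by simp
  ultimately show ?case
    unfolding sum.insert[OF insert.hyps] by order
qed (simp_all add: ring_valuation_0[OF v])

lemma ring_valuation_sum_strict: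
  assumes v: "ring_valuation_on R v" and "\<And>i. i \<in> A \<Longrightarrow> f i \<in> R" and "\<And>i. i \<in> A \<Longrightarrow> b < v (f i)"
    and "b \<noteq> Pinf"
  shows "b < v (sum f A)"
  using assms(2,3)
proof (induction A rule: infinite_finite_induct)
  case (insert i A)
  have "sum f A \<in> R"
    by (rule ring_valuation_sum_mem[OF v]) (use insert in auto)
  hence "min (v (f i)) (v (sum f A)) \<le> v (f i + sum f A)"
    using insert by (intro ring_valuation_add[OF v]) auto
  moreover have "b < min (v (f i)) (v (sum f A))"
    using insert by simp
  ultimately show ?case
    unfolding sum.insert[OF insert.hyps] by order
qed (use assms(4) in \<open>auto simp: ring_valuation_0[OF v] less_le\<close>)

lemma ring_valuation_add_strict:
  assumes v: "ring_valuation_on R v" and xy: "x \<in> R" "y \<in> R" and less: "v x < v y"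
  shows "v (x + y) = v x"
proof (rule antisym)
  show "v x \<le> v (x + y)"
    using ring_valuation_add[OF v xy] less by simp
  have "min (v (x + y)) (v y) \<le> v x"
    using ring_valuation_diff[OF v ring_valuation_add_mem[OF v xy] xy(2)] by simp
  thus "v (x + y) \<le> v x"
    using less by (auto simp: min_def split: if_splits)
qed

lemma ring_valuation_finite:
  assumes "ring_valuation_on R v" and "x \<in> R" and "x \<noteq> 0"
  obtains g where "v x = Fin g"
  using ring_valuation_not_Minf[OF assms(1,2)] ring_valuation_Pinf_iff[OF assms(1,2)] assms(3)
  by (cases "v x") auto

lemma ring_valuation_mult_cancel:
  assumes v: "ring_valuation_on R v" and "x \<in> R" "y \<in> R" "z \<in> R" and "z \<noteq> 0"
  shows "v (z * x) = v (z * y) \<longleftrightarrow> v x = v y"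
  using assms ring_valuation_not_Minf[OF v] ring_valuation_Pinf_iff[OF v]
  by (simp add: ring_valuation_mult extended_add_left_cancel)

lemma valuation_divide_cong:
  assumes "subfield F \<Omega>" and u: "valuation_on F u" and u': "valuation_on F u'"
    and mem: "a \<in> F" "b \<in> F" "a' \<in> F" "b' \<in> F"
    and b: "b \<noteq> 0" "b' \<noteq> 0" and eq: "u' a' = u a" "u' b' = u b"
  shows "u' (a' / b') = u (a / b)"
proof -
  note v = ring_valuation_on_subfield[OF assms(1) u] and v' = ring_valuation_on_subfield[OF assms(1) u']
  have d: "a / b \<in> F" "a' / b' \<in> F"
    using mem by (auto intro: subfield_divide[OF assms(1)])
  have "u b + u (a / b) = u a" "u' b' + u' (a' / b') = u' a'"
    using ring_valuation_mult[OF v mem(2) d(1)] ring_valuation_mult[OF v' mem(4) d(2)] b by simp_all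
  hence "u b + u' (a' / b') = u b + u (a / b)"
    using eq by simp
  moreover have "u b \<noteq> Pinf" "u b \<noteq> Minf" "u' (a' / b') \<noteq> Minf" "u (a / b) \<noteq> Minf"
    using ring_valuation_Pinf_iff[OF v mem(2)] ring_valuation_not_Minf[OF v] ring_valuation_not_Minf[OF v']
      b mem d by auto
  ultimately show ?thesis
    by (simp add: extended_add_left_cancel)
qed

section \<open>The Gauss valuation on polynomials\<close>

lemma gauss_value_le:
  fixes v :: "'a::field \<Rightarrow> 'g::linordered_ab_group_add extended"
  assumes "v 0 = Pinf"
  shows "gauss_value v \<gamma> p \<le> v (coeff p i) + Fin (\<Sum>j<i. \<gamma>)"
  using assms by (cases "i \<le> degree p") (auto simp: gauss_value_def coeff_eq_0)

lemma gauss_value_ge: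
  assumes "\<And>i. i \<le> degree p \<Longrightarrow> b \<le> v (coeff p i) + Fin (\<Sum>j<i. \<gamma>)"
  shows "b \<le> gauss_value v \<gamma> p"
  using assms by (auto simp: gauss_value_def)

lemma gauss_value_attained:
  obtains i where "i \<le> degree p" and "gauss_value v \<gamma> p = v (coeff p i) + Fin (\<Sum>j<i. \<gamma>)"
proof -
  have "gauss_value v \<gamma> p \<in> (\<lambda>i. v (coeff p i) + Fin (\<Sum>j<i. \<gamma>)) ` {..degree p}"
    unfolding gauss_value_def by (rule Min_in) auto
  thus ?thesis
    using that by auto
qed

lemma gauss_value_not_Minf:
  assumes v: "ring_valuation_on R v" and "p \<in> polys_over R"
  shows "gauss_value v \<gamma> p \<noteq> Minf"
proof -
  obtain i where "gauss_value v \<gamma> p = v (coeff p i) + Fin (\<Sum>j<i. \<gamma>)"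
    by (rule gauss_value_attained)
  moreover have "v (coeff p i) \<noteq> Minf"
    using ring_valuation_not_Minf[OF v] assms(2) by auto
  ultimately show ?thesis
    by (cases "v (coeff p i)") auto
qed

lemma gauss_value_Pinf_iff:
  assumes v: "ring_valuation_on R v" and p: "p \<in> polys_over R"
  shows "gauss_value v \<gamma> p = Pinf \<longleftrightarrow> p = 0"
proof
  assume *: "gauss_value v \<gamma> p = Pinf"
  have "v (coeff p i) = Pinf" for i
    using gauss_value_le[of v \<gamma> p i] * ring_valuation_0[OF v] ring_valuation_not_Minf[OF v, of "coeff p i"] p
    by (cases "v (coeff p i)") auto
  hence "coeff p i = 0" for i
    using ring_valuation_Pinf_iff[OF v] p by auto
  thus "p = 0"
    by (simp add: poly_eq_iff)
next
  assume "p = 0"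
  thus "gauss_value v \<gamma> p = Pinf"
    by (simp add: gauss_value_def ring_valuation_0[OF v])
qed

lemma sum_const_add:
  fixes m n :: nat
  shows "(\<Sum>j<m + n. \<gamma>) = (\<Sum>j<m. \<gamma>) + (\<Sum>j<n. \<gamma> :: 'g::comm_monoid_add)"
  by (induction n) (auto simp: add_ac)

text \<open>Gauss's lemma. Let \<open>i0\<close> and \<open>j0\<close> be the least indices at which
  the two minima are attained. In the coefficient of index \<open>i0 + j0\<close>, the term from
  \<open>i0\<close> and \<open>j0\<close> has exactly the expected value, and in every other term
  one index lies below \<open>i0\<close> or below \<open>j0\<close>, which makes the value strictly
  larger.\<close>

lemma gauss_value_mult:
  assumes v: "ring_valuation_on R v" and p: "p \<in> polys_over R" and q: "q \<in> polys_over R"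
  shows "gauss_value v \<gamma> (p * q) = gauss_value v \<gamma> p + gauss_value v \<gamma> q"
proof (cases "p = 0 \<or> q = 0")
  case True
  have "gauss_value v \<gamma> 0 = Pinf"
    by (simp add: gauss_value_def ring_valuation_0[OF v])
  thus ?thesis
    using True gauss_value_not_Minf[OF v p, of \<gamma>] gauss_value_not_Minf[OF v q, of \<gamma>]
    by (cases "gauss_value v \<gamma> p"; cases "gauss_value v \<gamma> q") auto
next
  case False
  define t where "t p i = v (coeff p i) + Fin (\<Sum>j<i. \<gamma>)" for p and i :: nat
  define A where "A = gauss_value v \<gamma> p"
  define B where "B = gauss_value v \<gamma> q"
  have fin: "A \<noteq> Pinf" "A \<noteq> Minf" "B \<noteq> Pinf" "B \<noteq> Minf"
    using False gauss_value_Pinf_iff[OF v] gauss_value_not_Minf[OF v] p q by (auto simp: A_def B_def)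
  have le: "A \<le> t p i" "B \<le> t q i" for i
    unfolding A_def B_def t_def using gauss_value_le ring_valuation_0[OF v] by blast+
  have mem: "coeff p i \<in> R" "coeff q i \<in> R" "coeff p i * coeff q k \<in> R" for i k
    using p q by (auto intro: ring_valuation_mult_mem[OF v])
  have mult: "v (coeff p i * coeff q k) + Fin (\<Sum>j<i + k. \<gamma>) = t p i + t q k" for i k
    unfolding t_def sum_const_add ring_valuation_mult[OF v mem(1,2)]
    by (simp add: add_ac flip: plus_extended.simps(1))
  \<comment> \<open>Moving the finite summand to the other side makes the bounds for sums
    applicable, which concern bare values of \<open>v\<close>.\<close>
  have shift: "b \<le> y + Fin g \<longleftrightarrow> b + Fin (- g) \<le> y" "b < y + Fin g \<longleftrightarrow> b + Fin (- g) < y"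
    for b y :: "'b extended" and g
    by (cases b; cases y; simp add: algebra_simps)+
  show ?thesis
    unfolding A_def[symmetric] B_def[symmetric]
  proof (rule antisym)
    show "A + B \<le> gauss_value v \<gamma> (p * q)"
    proof (rule gauss_value_ge)
      fix k
      have "A + B + Fin (- (\<Sum>j<k. \<gamma>)) \<le> v (\<Sum>i\<le>k. coeff p i * coeff q (k - i))"
      proof (rule ring_valuation_sum[OF v mem(3)])
        fix i assume "i \<in> {..k}"
        hence "v (coeff p i * coeff q (k - i)) + Fin (\<Sum>j<k. \<gamma>) = t p i + t q (k - i)"
          using mult[of i "k - i"] by simp
        hence "A + B \<le> v (coeff p i * coeff q (k - i)) + Fin (\<Sum>j<k. \<gamma>)"
          using le by (simp add: add_mono)
        thus "A + B + Fin (- (\<Sum>j<k. \<gamma>)) \<le> v (coeff p i * coeff q (k - i))"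
          by (simp add: shift)
      qed
      thus "A + B \<le> v (coeff (p * q) k) + Fin (\<Sum>j<k. \<gamma>)"
        by (simp add: coeff_mult shift)
    qed
    define i0 where "i0 = (LEAST i. t p i = A)"
    define j0 where "j0 = (LEAST i. t q i = B)"
    have "\<exists>i. t p i = A" "\<exists>i. t q i = B"
      unfolding A_def B_def t_def using gauss_value_attained by metis+
    from LeastI_ex[OF this(1)] LeastI_ex[OF this(2)] have i0: "t p i0 = A" and j0: "t q j0 = B"
      unfolding i0_def j0_def .
    have i0_less: "A < t p i" if "i < i0" for i
      using le(1)[of i] not_less_Least[OF that[unfolded i0_def]] by (simp add: less_le)
    have j0_less: "B < t q i" if "i < j0" for i
      using le(2)[of i] not_less_Least[OF that[unfolded j0_def]] by (simp add: less_le)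
    define k where "k = i0 + j0"
    define r where "r = (\<Sum>i\<in>{..k} - {i0}. coeff p i * coeff q (k - i))"
    have coeff: "coeff (p * q) k = coeff p i0 * coeff q j0 + r"
      unfolding coeff_mult r_def by (subst sum.remove[of _ i0]) (auto simp: k_def)
    have val: "v (coeff p i0 * coeff q j0) + Fin (\<Sum>j<k. \<gamma>) = A + B"
      using mult[of i0 j0] i0 j0 by (simp add: k_def)
    have "A + B + Fin (- (\<Sum>j<k. \<gamma>)) < v r"
      unfolding r_def
    proof (rule ring_valuation_sum_strict[OF v mem(3)])
      fix i assume i: "i \<in> {..k} - {i0}"
      hence *: "v (coeff p i * coeff q (k - i)) + Fin (\<Sum>j<k. \<gamma>) = t p i + t q (k - i)"
        using mult[of i "k - i"] by simp
      have "A + B < t p i + t q (k - i)"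
      proof (cases "i < i0")
        case True
        thus ?thesis
          using i0_less le fin by (intro extended_add_less_le_mono)
      next
        case False
        hence "k - i < j0"
          using i by (auto simp: k_def)
        hence "B + A < t q (k - i) + t p i"
          using j0_less le fin by (intro extended_add_less_le_mono)
        thus ?thesis
          by (simp add: add.commute)
      qed
      thus "A + B + Fin (- (\<Sum>j<k. \<gamma>)) < v (coeff p i * coeff q (k - i))"
        unfolding *[symmetric] by (simp add: shift)
    next
      show "A + B + Fin (- (\<Sum>j<k. \<gamma>)) \<noteq> Pinf"
        using fin by (cases A; cases B) auto
    qed
    moreover have "v (coeff p i0 * coeff q j0) = A + B + Fin (- (\<Sum>j<k. \<gamma>))"
      unfolding val[symmetric] by (cases "v (coeff p i0 * coeff q j0)") auto
    moreover have "r \<in> R"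
      unfolding r_def by (intro ring_valuation_sum_mem[OF v] mem)
    ultimately have "v (coeff (p * q) k) = v (coeff p i0 * coeff q j0)"
      unfolding coeff by (intro ring_valuation_add_strict[OF v] mem) auto
    hence "v (coeff (p * q) k) + Fin (\<Sum>j<k. \<gamma>) = A + B"
      using val by simp
    thus "gauss_value v \<gamma> (p * q) \<le> A + B"
      using gauss_value_le[of v \<gamma> "p * q" k] ring_valuation_0[OF v] by simp
  qed
qed

text \<open>Used with the given radius for monomial valuations, and with radius 0 as a minimum over
  finitely many elements in the proof of conjugacy.\<close>

lemma ring_valuation_gauss_value:
  assumes v: "ring_valuation_on R v"
  shows "ring_valuation_on (polys_over R) (gauss_value v \<gamma>)"
  unfolding ring_valuation_on_def
proof (intro conjI ballI)
  show "ring_rel (Id_on (polys_over R))"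
    using v ring_rel_poly_rel[of "Id_on R"] by (simp add: ring_valuation_on_def poly_rel_Id_on)
next
  fix p q :: "'a poly" assume p: "p \<in> polys_over R" and q: "q \<in> polys_over R"
  show "gauss_value v \<gamma> p \<noteq> Minf" "gauss_value v \<gamma> p = Pinf \<longleftrightarrow> p = 0"
    "gauss_value v \<gamma> (p * q) = gauss_value v \<gamma> p + gauss_value v \<gamma> q"
    using gauss_value_not_Minf gauss_value_Pinf_iff gauss_value_mult v p q by blast+
  show "min (gauss_value v \<gamma> p) (gauss_value v \<gamma> q) \<le> gauss_value v \<gamma> (p + q)"
  proof (rule gauss_value_ge)
    fix i :: nat
    let ?g = "Fin (\<Sum>j<i. \<gamma>)"
    have distr: "min a b + Fin g = min (a + Fin g) (b + Fin g)" for a b :: "'b extended" and g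
      by (cases a; cases b) (auto simp: min_def)
    have "min (gauss_value v \<gamma> p) (gauss_value v \<gamma> q) \<le> min (v (coeff p i) + ?g) (v (coeff q i) + ?g)"
      using gauss_value_le[of v \<gamma>, OF ring_valuation_0[OF v]] by (intro min.mono)
    also have "\<dots> = min (v (coeff p i)) (v (coeff q i)) + ?g"
      by (simp add: distr)
    also have "\<dots> \<le> v (coeff (p + q) i) + ?g"
      using ring_valuation_add[OF v, of "coeff p i" "coeff q i"] p q by (intro add_right_mono) auto
    finally show "min (gauss_value v \<gamma> p) (gauss_value v \<gamma> q) \<le> v (coeff (p + q) i) + ?g" .
  qed
qed

section \<open>Conjugacy of valuations\<close>

text \<open>In the vanishing sum \<open>p(a)\<close> the least value must occur at two terms, of
  indices \<open>i < j\<close> say; comparing them expresses the value of \<open>a ^ (j - i)\<close>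
  by a quotient of coefficients. Thus the value group of an algebraic extension is torsion over that
  of the base.\<close>

lemma valuation_torsion:
  assumes E: "subfield E \<Omega>" "E \<subseteq> F" and v: "ring_valuation_on F v"
    and a: "a \<in> F" "a \<noteq> 0" and p: "p \<in> polys_over E" "p \<noteq> 0" "poly p a = 0"
  shows "\<exists>n>0. \<exists>c\<in>E. c \<noteq> 0 \<and> v (a ^ n) = v c"
proof -
  define S where "S = {i. coeff p i \<noteq> 0}"
  define t where "t i = coeff p i * a ^ i" for i
  have S: "S \<subseteq> {..degree p}"
    by (auto simp: S_def le_degree)
  hence "finite S"
    using finite_subset by blast
  have cF: "coeff p i \<in> F" for i
    using p(1) E(2) by auto
  have tF: "t i \<in> F" for i
    unfolding t_def by (intro ring_valuation_mult_mem[OF v] ring_valuation_power_mem[OF v] cF a)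
  have "S \<noteq> {}"
    using p(2) by (auto simp: S_def poly_eq_iff)
  define b where "b = Min ((\<lambda>i. v (t i)) ` S)"
  have "b \<in> (\<lambda>i. v (t i)) ` S"
    unfolding b_def using \<open>finite S\<close> \<open>S \<noteq> {}\<close> by (intro Min_in) auto
  then obtain i where i: "i \<in> S" "v (t i) = b"
    by auto
  have min: "b \<le> v (t j)" if "j \<in> S" for j
    unfolding b_def using \<open>finite S\<close> that by simp
  have ti: "t i \<noteq> 0"
    using i a by (simp add: t_def S_def)
  hence b: "b \<noteq> Pinf"
    using ring_valuation_Pinf_iff[OF v tF] i(2) by auto
  have "\<exists>j\<in>S - {i}. v (t j) = b"
  proof (rule ccontr)
    assume *: "\<not> (\<exists>j\<in>S - {i}. v (t j) = b)"
    have "b < v (t j)" if "j \<in> S - {i}" for j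
      using * min[of j] that by (auto simp: less_le)
    hence "b < v (\<Sum>j\<in>S - {i}. t j)"
      using b by (intro ring_valuation_sum_strict[OF v tF])
    hence "v (t i + (\<Sum>j\<in>S - {i}. t j)) = v (t i)"
      using i(2) by (intro ring_valuation_add_strict[OF v] tF ring_valuation_sum_mem[OF v]) auto
    moreover have "t i + (\<Sum>j\<in>S - {i}. t j) = (\<Sum>j\<in>S. t j)"
      using i(1) \<open>finite S\<close> by (simp add: sum.remove)
    moreover have "(\<Sum>j\<in>S. t j) = poly p a"
      unfolding poly_altdef t_def using S by (intro sum.mono_neutral_left) (auto simp: S_def)
    ultimately show False
      using p(3) b i(2) ring_valuation_0[OF v] by simp
  qed
  then obtain j where j: "j \<in> S" "j \<noteq> i" "v (t j) = v (t i)"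
    using i by auto
  have *: "\<exists>n>0. \<exists>c\<in>E. c \<noteq> 0 \<and> v (a ^ n) = v c"
    if "i \<in> S" "j \<in> S" "i < j" "v (t j) = v (t i)" for i j
  proof -
    define c where "c = coeff p i / coeff p j"
    have c: "c \<in> E" "c \<noteq> 0"
      using that p(1) subfield_divide[OF E(1)] by (auto simp: c_def S_def)
    have pow: "a ^ j = a ^ i * a ^ (j - i)"
      using that(3) by (simp flip: power_add)
    have "t j = coeff p j * a ^ i * a ^ (j - i)" "t i = coeff p j * a ^ i * c"
      using that(2) pow by (simp_all add: t_def c_def S_def)
    hence "v (coeff p j * a ^ i * a ^ (j - i)) = v (coeff p j * a ^ i * c)"
      using that(4) by simp
    hence "v (a ^ (j - i)) = v c"
      by (subst (asm) ring_valuation_mult_cancel[OF v])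
        (use that(2) a c E(2) cF in \<open>auto simp: S_def
          intro!: ring_valuation_power_mem[OF v] ring_valuation_mult_mem[OF v]\<close>)
    thus ?thesis
      using that(3) c by (intro exI[of _ "j - i"]) auto
  qed
  show ?thesis
    using *[of i j] *[of j i] i(1) j by (cases "i < j") auto
qed

lemma extended_add_eq_0_neg:
  fixes a b :: "'g::linordered_ab_group_add extended"
  assumes "a + b = 0" and "0 < a"
  shows "b < 0"
  using assms by (cases a; cases b) (simp_all add: zero_extended_def add_eq_0_iff)

text \<open>
  If all roots of a polynomial have negative value, then its constant coefficient has strictly
  smaller value than all others; so for a valuation agreeing on the coefficients, no root can have
  nonnegative value.
\<close>

lemma valuation_roots_negative:
  fixes f :: "'z \<Rightarrow> 'a::idom" and v v' :: "'a \<Rightarrow> 'g::linordered_ab_group_add extended"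
  assumes v: "ring_valuation_on R v" and v': "ring_valuation_on R v'" and "finite Z"
    and f: "\<And>z. z \<in> Z \<Longrightarrow> f z \<in> R" "\<And>z. z \<in> Z \<Longrightarrow> v (f z) < 0"
    and eq: "\<And>k. v (coeff (\<Prod>z\<in>Z. [:- f z, 1:]) k) = v' (coeff (\<Prod>z\<in>Z. [:- f z, 1:]) k)"
    and "z0 \<in> Z"
  shows "v' (f z0) < 0"
proof (rule ccontr)
  assume nonneg: "\<not> v' (f z0) < 0"
  have *: "(\<forall>k. coeff (\<Prod>z\<in>A. [:- f z, 1:]) k \<in> R) \<and> coeff (\<Prod>z\<in>A. [:- f z, 1:]) 0 \<noteq> 0 \<and>
      (\<forall>k. v (coeff (\<Prod>z\<in>A. [:- f z, 1:]) 0) < v (coeff (\<Prod>z\<in>A. [:- f z, 1:]) (Suc k)))"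
    if "finite A" "A \<subseteq> Z" for A
    using that
  proof (induction A rule: finite_induct)
    case empty
    have "(0 :: 'g extended) < Pinf"
      by (simp add: zero_extended_def)
    thus ?case
      using ring_valuation_0_mem[OF v] ring_valuation_1_mem[OF v]
      by (simp add: ring_valuation_0[OF v] ring_valuation_1[OF v])
  next
    case (insert y A)
    define P where "P = (\<Prod>z\<in>A. [:- f z, 1:])"
    have P: "coeff P k \<in> R" "coeff P 0 \<noteq> 0" "v (coeff P 0) < v (coeff P (Suc k))" for k
      using insert by (auto simp: P_def)
    have "f y \<in> R" "v (f y) < 0"
      using insert f by auto
    moreover have fy0: "f y \<noteq> 0"
      using \<open>v (f y) < 0\<close> ring_valuation_0[OF v] by (auto simp: zero_extended_def)
    have fy: "v (f y) \<noteq> Pinf" "v (f y) \<noteq> Minf"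
      using ring_valuation_Pinf_iff[OF v] ring_valuation_not_Minf[OF v] \<open>f y \<in> R\<close> fy0 by auto
    have P0: "v (coeff P 0) \<noteq> Pinf" "v (coeff P 0) \<noteq> Minf"
      using ring_valuation_Pinf_iff[OF v P(1)] ring_valuation_not_Minf[OF v P(1)] P(2) by auto
    have prod: "(\<Prod>z\<in>insert y A. [:- f z, 1:]) = [:- f y, 1:] * P"
      using insert by (simp add: P_def)
    have c0: "coeff ([:- f y, 1:] * P) 0 = - (f y * coeff P 0)"
      by (simp add: coeff_mult)
    have cS: "coeff ([:- f y, 1:] * P) (Suc k) = coeff P k - f y * coeff P (Suc k)" for k
      by simp
    have v0: "v (coeff ([:- f y, 1:] * P) 0) = v (f y) + v (coeff P 0)"
      unfolding c0 using \<open>f y \<in> R\<close> P(1)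
      by (simp add: ring_valuation_uminus[OF v] ring_valuation_mult[OF v] ring_valuation_mult_mem[OF v])
    show ?case
      unfolding prod
    proof (intro conjI allI)
      show "coeff ([:- f y, 1:] * P) k \<in> R" for k
        using ring_valuation_closed[OF v] P(1) \<open>f y \<in> R\<close>
        by (cases k) (simp_all add: cS c0 del: mult_pCons_left)
      show "coeff ([:- f y, 1:] * P) 0 \<noteq> 0"
        unfolding c0 using fy0 P(2) by simp
      fix k
      have "v (coeff P 0) \<le> v (coeff P k)"
        using P(3) by (cases k) (auto intro: less_imp_le)
      hence "v (f y) + v (coeff P 0) < 0 + v (coeff P k)"
        using P0 \<open>v (f y) < 0\<close> by (intro extended_add_less_le_mono)
      moreover have "v (f y) + v (coeff P 0) < v (f y) + v (coeff P (Suc k))"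
        using fy P(3) by (intro extended_add_strict_left_mono)
      moreover have "v (f y * coeff P (Suc k)) = v (f y) + v (coeff P (Suc k))"
        using P(1) \<open>f y \<in> R\<close> by (intro ring_valuation_mult[OF v])
      ultimately have "v (f y) + v (coeff P 0) < min (v (coeff P k)) (v (f y * coeff P (Suc k)))"
        by simp
      also have "\<dots> \<le> v (coeff P k - f y * coeff P (Suc k))"
        using P(1) \<open>f y \<in> R\<close> by (intro ring_valuation_diff[OF v] ring_valuation_mult_mem[OF v])
      finally show "v (coeff ([:- f y, 1:] * P) 0) < v (coeff ([:- f y, 1:] * P) (Suc k))"
        unfolding v0 cS .
    qed
  qed
  define P where "P = (\<Prod>z\<in>Z. [:- f z, 1:])"
  have P: "coeff P k \<in> R" "coeff P 0 \<noteq> 0" "v (coeff P 0) < v (coeff P (Suc k))"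
    "v (coeff P k) = v' (coeff P k)" for k
    using *[OF \<open>finite Z\<close>] eq by (auto simp: P_def)
  have z0: "f z0 \<in> R" "0 \<le> v' (f z0)"
    using f \<open>z0 \<in> Z\<close> nonneg by auto
  have "poly P (f z0) = 0"
    using \<open>finite Z\<close> \<open>z0 \<in> Z\<close> by (simp add: P_def poly_prod) (metis add.right_inverse)
  \<comment> \<open>Under \<open>v'\<close>, every coefficient here exceeds the constant one, and
    powers of \<open>f z0\<close> have nonnegative value. So \<open>r\<close> cannot cancel the
    constant coefficient, although \<open>P\<close> vanishes at \<open>f z0\<close>.\<close>
  define r where "r = (\<Sum>k\<in>{..degree P} - {0}. coeff P k * f z0 ^ k)"
  have "poly P (f z0) = coeff P 0 + r"
    unfolding poly_altdef r_def by (subst sum.remove[of _ 0]) auto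
  have nonneg_sum: "0 \<le> (\<Sum>j<k. v' (f z0))" for k :: nat
    using z0(2) add_mono[of 0 _ 0 "v' (f z0)"] by (induction k) auto
  have pow: "f z0 ^ k \<in> R" "0 \<le> v' (f z0 ^ k)" for k
    using z0 nonneg_sum by (auto simp: ring_valuation_power[OF v'] intro: ring_valuation_power_mem[OF v])
  have rR: "r \<in> R"
    unfolding r_def by (intro ring_valuation_sum_mem[OF v] ring_valuation_mult_mem[OF v] P pow)
  have P0: "v' (coeff P 0) \<noteq> Pinf" "v' (coeff P 0) \<noteq> Minf"
    using ring_valuation_Pinf_iff[OF v' P(1)] ring_valuation_not_Minf[OF v' P(1)] P(2) by auto
  have "v' (coeff P 0) < v' r"
    unfolding r_def
  proof (rule ring_valuation_sum_strict[OF v'])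
    fix k assume "k \<in> {..degree P} - {0}"
    then obtain l where k: "k = Suc l"
      by (cases k) auto
    show "coeff P k * f z0 ^ k \<in> R"
      by (intro ring_valuation_mult_mem[OF v] P pow)
    have "v' (coeff P 0) < v' (coeff P k)"
      using P(3,4) by (simp add: k)
    hence "v' (coeff P 0) + 0 < v' (coeff P k) + v' (f z0 ^ k)"
      using pow by (intro extended_add_less_le_mono) (auto simp: zero_extended_def)
    thus "v' (coeff P 0) < v' (coeff P k * f z0 ^ k)"
      using P(1) pow by (simp add: ring_valuation_mult[OF v'])
  qed (use P0 in simp)
  hence "v' (coeff P 0 + r) = v' (coeff P 0)"
    by (intro ring_valuation_add_strict[OF v'] P rR)
  thus False
    using \<open>poly P (f z0) = 0\<close> \<open>poly P (f z0) = coeff P 0 + r\<close> P0 ring_valuation_0[OF v'] by simp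
qed

lemma valuation_on_comp_field_aut:
  assumes "subfield F \<Omega>" and "valuation_on F u" and \<sigma>: "\<sigma> \<in> field_auts F L"
  shows "valuation_on F (\<lambda>x. u (\<sigma> x))"
  using assms(2) field_auts_ring_hom[OF assms(1) \<sigma>] field_auts_mem[OF \<sigma>]
  by (simp add: valuation_on_def)

text \<open>A power of \<open>c\<close> lies in \<open>E\<close>, and values at \<open>c\<close> can
  be recovered from those at the power by torsion-freeness.\<close>

lemma valuations_eq_on_fixed:
  fixes F :: "'f::alg_closed_field set"
  assumes EF: "alg_closure_of E F" and u: "ring_valuation_on F u" "ring_valuation_on F u'"
    and eq: "\<And>x. x \<in> E \<Longrightarrow> u' x = u x"
    and c: "c \<in> F" "\<And>\<sigma>. \<sigma> \<in> field_auts F E \<Longrightarrow> \<sigma> c = c"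
  shows "u' c = u c"
proof -
  obtain p where p: "p \<in> polys_over E" "p \<noteq> 0" "poly p c = 0"
    using alg_closure_ofD(4)[OF EF c(1)] by blast
  have "c ^ fact (degree p) \<in> E"
    by (rule fixed_power_mem[OF EF c(1) _ p]) (rule c(2))
  hence "u' (c ^ fact (degree p)) = u (c ^ fact (degree p))"
    by (rule eq)
  hence "(\<Sum>j<fact (degree p) :: nat. u' c) = (\<Sum>j<fact (degree p) :: nat. u c)"
    by (simp only: ring_valuation_power[OF u(1) c(1)] ring_valuation_power[OF u(2) c(1)])
  thus ?thesis
    by (rule sum_const_inject) (simp_all add: ring_valuation_not_Minf[OF u(1) c(1)]
      ring_valuation_not_Minf[OF u(2) c(1)])
qed

lemma polys_over_closed:
  assumes "subfield E (\<Omega> :: 'f::field ring)"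
  shows "1 \<in> polys_over E" and "p \<in> polys_over E \<Longrightarrow> q \<in> polys_over E \<Longrightarrow> p - q \<in> polys_over E"
    and "p \<in> polys_over E \<Longrightarrow> q \<in> polys_over E \<Longrightarrow> p * q \<in> polys_over E"
    and "p \<in> polys_over E \<Longrightarrow> p ^ n \<in> polys_over E"
proof -
  have "ring_rel (Id_on (polys_over E))"
    using ring_rel_poly_rel[OF partial_iso_ring_rel[OF assms[folded partial_iso_Id_on]]]
    by (simp add: poly_rel_Id_on)
  note * = ring_rel_closed[OF this]
  show "1 \<in> polys_over E" "p \<in> polys_over E \<Longrightarrow> q \<in> polys_over E \<Longrightarrow> p - q \<in> polys_over E"
    "p \<in> polys_over E \<Longrightarrow> q \<in> polys_over E \<Longrightarrow> p * q \<in> polys_over E"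
    "p \<in> polys_over E \<Longrightarrow> p ^ n \<in> polys_over E"
    using *(2) *(5)[of p p q q] *(6)[of p p q q] *(7)[of p p n] unfolding Id_on_iff by blast+
qed

text \<open>By contradiction: if every conjugate \<open>y\<close> of \<open>z\<close> fails, each
  has a witness \<open>h y\<close> over \<open>E\<close> of \<open>u'\<close>-value 0 at
  \<open>z\<close> and negative \<open>u\<close>-value at \<open>y\<close>. Packing all witnesses
  into one polynomial \<open>f y\<close> makes every \<open>f y\<close> negative for the Gauss
  valuation of \<open>u\<close>, while \<open>f z\<close> is nonnegative for that of
  \<open>u'\<close>. The product of the \<open>T - f y\<close> has invariant coefficients, on which
  both valuations agree, and this is incompatible with the two signs.\<close>

lemma valuations_conjugate_on_adjoin:
  fixes F :: "'f::alg_closed_field set"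
  assumes EF: "alg_closure_of E F" and val: "valuation_on F u" "valuation_on F u'"
    and eq: "\<And>x. x \<in> E \<Longrightarrow> u' x = u x" and "z \<in> F"
  shows "\<exists>z'\<in>F. \<forall>p\<in>polys_over E. (poly p z = 0 \<longleftrightarrow> poly p z' = 0) \<and> u (poly p z') = u' (poly p z)"
proof (rule ccontr)
  assume none: "\<not> (\<exists>z'\<in>F. \<forall>p\<in>polys_over E. (poly p z = 0 \<longleftrightarrow> poly p z' = 0) \<and>
    u (poly p z') = u' (poly p z))"
  note E = alg_closure_ofD(1,2,3)[OF EF]
  note u = ring_valuation_on_subfield[OF E(2) val(1)] and u' = ring_valuation_on_subfield[OF E(2) val(2)]
  have G: "partial_iso (Id_on E)"
    using E(1) by (simp add: partial_iso_Id_on)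
  note PR = polys_over_closed[OF E(1)]
  obtain p0 where p0: "p0 \<in> polys_over E" "p0 \<noteq> 0" "poly p0 z = 0"
    using alg_closure_ofD(4)[OF EF \<open>z \<in> F\<close>] by blast
  obtain m where m: "minimal_poly E z m"
    using minimal_poly_exists[OF p0] .
  hence m0: "m \<in> polys_over E" "m \<noteq> 0" "poly m z = 0"
    by (auto simp: minimal_poly_def)
  define Z where "Z = {y. poly m y = 0}"
  have "finite Z"
    unfolding Z_def by (rule poly_roots_finite[OF m0(2)])
  have "z \<in> Z"
    using m0 by (simp add: Z_def)
  have ZF: "y \<in> F" if "y \<in> Z" for y
    using alg_closure_ofD(5)[OF EF _ m0(2)] that m0(1) E(3) unfolding Z_def by blast
  have vanish: "poly p z = 0 \<longleftrightarrow> poly p y = 0" if "y \<in> Z" "p \<in> polys_over E" for p y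
    by (rule minimal_poly_root_iff[OF G]) (use m m0 that in \<open>simp_all add: poly_rel_Id_on Z_def Id_on_iff\<close>)
  have polyF: "poly p y \<in> F" if "p \<in> polys_over E" "y \<in> F" for p y
    using that E(3) by (intro poly_mem_subfield[OF E(2)]) auto
  have "\<exists>h\<in>polys_over E. u' (poly h z) = 0 \<and> u (poly h y) < 0" if y: "y \<in> Z" for y
  proof -
    obtain p where p: "p \<in> polys_over E" "u (poly p y) \<noteq> u' (poly p z)"
      using none ZF[OF y] vanish[OF y] by blast
    define a where "a = poly p z"
    define b where "b = poly p y"
    have ab: "a \<in> F" "b \<in> F"
      unfolding a_def b_def using polyF p(1) ZF[OF y] \<open>z \<in> F\<close> by auto
    have "a = 0 \<longleftrightarrow> b = 0"
      unfolding a_def b_def by (rule vanish[OF y p(1)])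
    hence nz: "a \<noteq> 0" "b \<noteq> 0"
      using p(2) ring_valuation_0[OF u] ring_valuation_0[OF u'] unfolding a_def b_def by metis+
    obtain q where q: "q \<in> polys_over E" "q \<noteq> 0" "poly q a = 0"
      using alg_closure_ofD(4)[OF EF ab(1)] by blast
    \<comment> \<open>Normalisation: a power of \<open>p\<close>, divided by an element of
      \<open>E\<close> of the same value, has value 0 at \<open>z\<close>, while its value at
      \<open>y\<close> stays different from 0.\<close>
    obtain n c where n: "n > 0" "c \<in> E" "c \<noteq> 0" "u' (a ^ n) = u' c"
      using valuation_torsion[OF E(1,3) u' ab(1) nz(1) q] by blast
    have cF: "c \<in> F"
      using n(2) E(3) by blast
    define g where "g = smult (inverse c) (p ^ n)"
    have "p ^ n \<in> polys_over E"
      by (rule PR(4)[OF p(1)])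
    hence g: "g \<in> polys_over E"
      using n(2) unfolding g_def by (auto intro!: subfield_mult[OF E(1)] subfield_inverse[OF E(1)])
    have gz: "poly g z = a ^ n / c" and gy: "poly g y = b ^ n / c"
      unfolding g_def a_def b_def by (simp_all add: field_simps)
    have powF: "a ^ n \<in> F" "b ^ n \<in> F"
      using ab by (auto intro: subfield_power[OF E(2)])
    have "u' (a ^ n / c) = u' (c / c)"
      by (rule valuation_divide_cong[OF E(2) val(2,2)]) (use powF cF n in auto)
    hence gz': "u' (poly g z) = 0"
      using gz n(3) ring_valuation_1[OF u'] by simp
    have gyF: "poly g y \<in> F" "poly g z \<in> F"
      using polyF[OF g] ZF[OF y] \<open>z \<in> F\<close> by auto
    have "u (b ^ n) \<noteq> u c"
    proof
      assume "u (b ^ n) = u c"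
      hence "u (b ^ n) = u' (a ^ n)"
        using n(4) eq[OF n(2)] by simp
      hence "u b = u' a"
        using n(1) ring_valuation_not_Minf[OF u ab(2)] ring_valuation_not_Minf[OF u' ab(1)]
        by (simp only: ring_valuation_power[OF u ab(2)] ring_valuation_power[OF u' ab(1)])
          (rule sum_const_inject)
      thus False
        using p(2) by (simp add: a_def b_def)
    qed
    moreover have "u c + u (poly g y) = u (b ^ n)"
      using ring_valuation_mult[OF u cF gyF(1)] gy n(3) by simp
    ultimately have gy0: "u (poly g y) \<noteq> 0"
      by auto
    show ?thesis
    proof (cases "u (poly g y) < 0")
      case True
      thus ?thesis
        using g gz' by blast
    next
      \<comment> \<open>If the value at \<open>y\<close> is positive instead, the polynomial
        representing the inverse of \<open>g(z)\<close> is the witness; it also represents the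
        inverse of \<open>g(y)\<close>.\<close>
      case False
      have "poly g z \<noteq> 0"
        using gz nz n(3) by simp
      then obtain s where s: "s \<in> polys_over E" "poly g z * poly s z = 1"
        using minimal_poly_inverse[OF E(1) m g] by blast
      have "g * s - 1 \<in> polys_over E"
        by (rule PR(2)[OF PR(3)[OF g s(1)] PR(1)])
      from vanish[OF y this] s(2) have sy: "poly g y * poly s y = 1"
        by simp
      have sF: "poly s y \<in> F" "poly s z \<in> F"
        using polyF[OF s(1)] ZF[OF y] \<open>z \<in> F\<close> by auto
      have "u' (poly g z) + u' (poly s z) = 0" "u (poly g y) + u (poly s y) = 0"
        using ring_valuation_mult[OF u' gyF(2) sF(2)] ring_valuation_mult[OF u gyF(1) sF(1)] s(2) sy
          ring_valuation_1[OF u] ring_valuation_1[OF u'] by simp_all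
      moreover have "0 < u (poly g y)"
        using False gy0 by simp
      ultimately have "u' (poly s z) = 0" "u (poly s y) < 0"
        using gz' extended_add_eq_0_neg by auto
      thus ?thesis
        using s(1) by blast
    qed
  qed
  then obtain h where h: "\<And>y. y \<in> Z \<Longrightarrow> h y \<in> polys_over E" "\<And>y. y \<in> Z \<Longrightarrow> u' (poly (h y) z) = 0"
    "\<And>y. y \<in> Z \<Longrightarrow> u (poly (h y) y) < 0"
    by metis
  define n where "n = card Z"
  obtain e where e: "bij_betw e {0..<n} Z"
    using ex_bij_betw_nat_finite[OF \<open>finite Z\<close>] unfolding n_def by blast
  hence eZ: "e j \<in> Z" if "j < n" for j
    using that by (auto simp: bij_betw_def)
  \<comment> \<open>Every \<open>f y\<close> carries the witnesses of all conjugates as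
    coefficients, evaluated at \<open>y\<close>. The coefficient belonging to \<open>y\<close>
    itself is the negative one, and all coefficients of \<open>f z\<close> have
    \<open>u'\<close>-value 0 or vanish.\<close>
  define f where "f y = (\<Sum>j<n. monom (poly (h (e j)) y) j)" for y
  have coeff_f: "coeff (f y) j = (if j < n then poly (h (e j)) y else 0)" for y j
    by (simp add: f_def coeff_sum)
  have fF: "f y \<in> polys_over F" if "y \<in> F" for y
    using that polyF[OF h(1)[OF eZ]] subfield_0[OF E(2)] by (simp add: coeff_f)
  let ?P = "\<Prod>y\<in>Z. [:- f y, 1:]"
  have gauss: "ring_valuation_on (polys_over F) (gauss_value u 0)"
    "ring_valuation_on (polys_over F) (gauss_value u' 0)"
    using ring_valuation_gauss_value u u' by blast+
  have "gauss_value u' 0 (f z) < 0"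
  proof (rule valuation_roots_negative[OF gauss \<open>finite Z\<close> _ _ _ \<open>z \<in> Z\<close>])
    show "f y \<in> polys_over F" if "y \<in> Z" for y
      using fF ZF that by blast
    show "gauss_value u 0 (f y) < 0" if "y \<in> Z" for y
    proof -
      have "y \<in> e ` {0..<n}"
        using e that by (simp add: bij_betw_def)
      then obtain j where j: "j < n" "y = e j"
        by auto
      have "gauss_value u 0 (f y) \<le> u (coeff (f y) j) + Fin (\<Sum>i<j. 0)"
        by (rule gauss_value_le) (rule ring_valuation_0[OF u])
      also have "\<dots> = u (poly (h y) y)"
        using j by (simp add: coeff_f flip: zero_extended_def)
      finally show ?thesis
        using h(3)[OF that] by simp
    qed
    fix k
    \<comment> \<open>An automorphism over \<open>E\<close> permutes the roots of \<open>m\<close>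
      and sends \<open>f y\<close> to \<open>f (\<sigma> y)\<close>, because the witnesses are
      polynomials over \<open>E\<close>. Hence it permutes the factors of the product.\<close>
    have "u (coeff (coeff ?P k) i) = u' (coeff (coeff ?P k) i)" for i
    proof -
      have fixed: "coeff (coeff ?P k) i \<in> F \<and> \<sigma> (coeff (coeff ?P k) i) = coeff (coeff ?P k) i"
        if \<sigma>: "\<sigma> \<in> field_auts F E" for \<sigma>
      proof -
        let ?G = "graph_on \<sigma> F"
        note R = partial_iso_ring_rel[OF partial_iso_graph[OF E(2) \<sigma>]]
        note R1 = ring_rel_poly_rel[OF R]
        note R2 = ring_rel_poly_rel[OF R1]
        have "\<sigma> y \<in> Z" if "y \<in> Z" for y
          using field_auts_poly[OF E(2) \<sigma> m0(1) E(3) ZF[OF that]] that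
            field_auts_0_iff[OF E(2) \<sigma> subfield_0[OF E(2)]]
          by (simp add: Z_def)
        moreover have "inj_on \<sigma> Z"
          using \<sigma> ZF by (auto simp: mem_field_auts_iff bij_betw_def intro: inj_on_subset)
        ultimately have bij: "bij_betw \<sigma> Z Z"
          using \<open>finite Z\<close> by (simp add: bij_betw_def endo_inj_surj image_subsetI)
        have "(f y, f (\<sigma> y)) \<in> poly_rel ?G" if "y \<in> Z" for y
          using field_auts_poly[OF E(2) \<sigma> h(1)[OF eZ] E(3) ZF[OF that]]
            polyF[OF h(1)[OF eZ] ZF[OF that]] field_auts_0_iff[OF E(2) \<sigma> subfield_0[OF E(2)]]
            subfield_0[OF E(2)]
          by (auto simp: poly_rel_def coeff_f image_iff)
        hence "([:- f y, 1:], [:- f (\<sigma> y), 1:]) \<in> poly_rel (poly_rel ?G)" if "y \<in> Z" for y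
          using that by (intro poly_rel_pCons ring_rel_0[OF R2] ring_rel_1[OF R1] ring_rel_uminus[OF R1])
        hence "(?P, \<Prod>y\<in>Z. [:- f (\<sigma> y), 1:]) \<in> poly_rel (poly_rel ?G)"
          by (rule ring_rel_prod[OF R2])
        moreover have "(\<Prod>y\<in>Z. [:- f (\<sigma> y), 1:]) = ?P"
          by (rule prod.reindex_bij_betw[OF bij])
        ultimately have "(?P, ?P) \<in> poly_rel (poly_rel ?G)"
          by simp
        hence "(coeff (coeff ?P k) i, coeff (coeff ?P k) i) \<in> ?G"
          by (simp add: poly_rel_def)
        thus ?thesis
          by auto
      qed
      have "u' (coeff (coeff ?P k) i) = u (coeff (coeff ?P k) i)"
        using fixed field_auts_id by (intro valuations_eq_on_fixed[OF EF u u' eq]) blast+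
      thus ?thesis
        by simp
    qed
    thus "gauss_value u 0 (coeff ?P k) = gauss_value u' 0 (coeff ?P k)"
      by (simp add: gauss_value_def)
  qed
  moreover have "0 \<le> gauss_value u' 0 (f z)"
    using h(2)[OF eZ] by (intro gauss_value_ge)
      (simp add: coeff_f ring_valuation_0[OF u'] flip: zero_extended_def)
  ultimately show False
    by simp
qed

text \<open>In the Zorn step, \<open>G\<close> is first extended to an automorphism
  \<open>\<rho>\<close> of \<open>F\<close>. Then \<open>u'\<close> and
  \<open>u \<circ> \<rho>\<close> agree on the domain of \<open>G\<close>, so the case of one
  element yields a conjugate \<open>z1\<close> of \<open>z\<close> over that domain, and
  \<open>\<rho> z1\<close> is the required image.\<close>

theorem valuations_conjugate:
  fixes F :: "'f::alg_closed_field set"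
  assumes LF: "alg_closure_of L F" and u: "valuation_on F u" "valuation_on F u'"
    and eq: "\<And>x. x \<in> L \<Longrightarrow> u' x = u x"
  shows "\<exists>\<tau>\<in>field_auts F L. \<forall>x\<in>F. u' x = u (\<tau> x)"
proof -
  note L = alg_closure_ofD(1,2,3)[OF LF]
  have "\<exists>G. partial_iso G \<and> Id_on L \<subseteq> G \<and> G \<subseteq> F \<times> F \<and> (\<forall>(x, x')\<in>G. u x' = u' x) \<and> Domain G = F"
  proof (rule partial_iso_Zorn[OF L(2)])
    show "partial_iso (Id_on L)"
      using L(1) by (simp add: partial_iso_Id_on)
    show "Id_on L \<subseteq> F \<times> F" "\<forall>(x, x')\<in>Id_on L. u x' = u' x"
      using L(3) eq by auto
    fix G z assume G: "partial_iso G" "Id_on L \<subseteq> G" "G \<subseteq> F \<times> F" "\<forall>(x, x')\<in>G. u x' = u' x"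
      and z: "z \<in> F"
    obtain \<rho> where \<rho>: "\<rho> \<in> field_auts F L" and \<rho>G: "\<forall>(x, x')\<in>G. \<rho> x = x'"
      using partial_iso_extends[OF LF G(1-3)] by blast
    have dom: "L \<subseteq> Domain G" "Domain G \<subseteq> F"
      using G by blast+
    have EF: "alg_closure_of (Domain G) F"
      by (rule alg_closure_of_mono[OF LF subfield_Domain[OF G(1)] dom])
    have val: "valuation_on F (\<lambda>x. u (\<rho> x))"
      by (rule valuation_on_comp_field_aut[OF L(2) u(1) \<rho>])
    have "u' x = u (\<rho> x)" if "x \<in> Domain G" for x
      using that G(4) \<rho>G by force
    from valuations_conjugate_on_adjoin[OF EF val u(2) this z] obtain z1 where
      z1: "z1 \<in> F" "\<And>p. p \<in> polys_over (Domain G) \<Longrightarrow> poly p z = 0 \<longleftrightarrow> poly p z1 = 0"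
      "\<And>p. p \<in> polys_over (Domain G) \<Longrightarrow> u (\<rho> (poly p z1)) = u' (poly p z)"
      by blast
    note R = partial_iso_ring_rel[OF partial_iso_graph[OF L(2) \<rho>]]
    have poly: "p \<in> polys_over (Domain G) \<and> poly p z \<in> F \<and> poly p' (\<rho> z1) \<in> F \<and>
        poly p z1 \<in> F \<and> poly p' (\<rho> z1) = \<rho> (poly p z1)" if "(p, p') \<in> poly_rel G" for p p'
    proof -
      have *: "(coeff p i, coeff p' i) \<in> G" for i
        using that by (simp add: poly_rel_def)
      hence 1: "p \<in> polys_over (Domain G)"
        by blast
      hence "p \<in> polys_over F"
        using dom by blast
      hence 2: "poly p z \<in> F" "poly p z1 \<in> F"
        by (auto intro: poly_mem_subfield[OF L(2)] z z1(1))
      have "(p, p') \<in> poly_rel (graph_on \<rho> F)"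
        using * G(3) \<rho>G by (force simp: poly_rel_def image_iff)
      hence "(poly p z1, poly p' (\<rho> z1)) \<in> graph_on \<rho> F"
        by (rule poly_rel_poly[OF R]) (use z1(1) in blast)
      thus ?thesis
        using 1 2 field_auts_mem[OF \<rho>] by auto
    qed
    show "\<exists>z'\<in>F. (\<forall>(p, p')\<in>poly_rel G. poly p z = 0 \<longleftrightarrow> poly p' z' = 0) \<and>
        (\<forall>(y, y')\<in>adjoin_rel G z z'. u y' = u' y)"
    proof (intro bexI[of _ "\<rho> z1"] conjI)
      show "\<rho> z1 \<in> F"
        by (rule field_auts_mem[OF \<rho> z1(1)])
      show *: "\<forall>(p, p')\<in>poly_rel G. poly p z = 0 \<longleftrightarrow> poly p' (\<rho> z1) = 0"
      proof clarify
        fix p p' assume "(p, p') \<in> poly_rel G"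
        thus "poly p z = 0 \<longleftrightarrow> poly p' (\<rho> z1) = 0"
          using poly[of p p'] z1(2)[of p] field_auts_0_iff[OF L(2) \<rho>, of "poly p z1"] by simp
      qed
      show "\<forall>(y, y')\<in>adjoin_rel G z (\<rho> z1). u y' = u' y"
      proof clarify
        fix y y' assume "(y, y') \<in> adjoin_rel G z (\<rho> z1)"
        then obtain p p' q q' where pq: "(p, p') \<in> poly_rel G" "(q, q') \<in> poly_rel G" "poly q z \<noteq> 0"
          "y = poly p z / poly q z" "y' = poly p' (\<rho> z1) / poly q' (\<rho> z1)"
          unfolding adjoin_rel_def by blast
        have "poly q' (\<rho> z1) \<noteq> 0"
          using * pq by blast
        thus "u y' = u' y"
          unfolding pq(4,5) using poly[OF pq(1)] poly[OF pq(2)] pq(3) z1(3)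
          by (intro valuation_divide_cong[OF L(2) u(2,1)]) auto
      qed
    qed
  qed
  then obtain G where G: "partial_iso G" "Id_on L \<subseteq> G" "G \<subseteq> F \<times> F" "Domain G = F"
    and uG: "\<forall>(x, x')\<in>G. u x' = u' x"
    by blast
  obtain \<tau> where "\<tau> \<in> field_auts F L" "\<forall>(x, x')\<in>G. \<tau> x = x'"
    using field_auts_of_partial_iso[OF LF G] by blast
  moreover have "u' x = u (\<tau> x)" if "x \<in> F" for x
    using that G(4) uG calculation(2) by force
  ultimately show ?thesis
    by blast
qed

section \<open>Henselizations\<close>

definition decomposition_group :: "'f::field set \<Rightarrow> ('f \<Rightarrow> 'g::linordered_ab_group_add extended) \<Rightarrow>
    'f set \<Rightarrow> ('f \<Rightarrow> 'f) set"
  where "decomposition_group F u L = {\<sigma> \<in> field_auts F L. \<forall>x\<in>F. u (\<sigma> x) = u x}"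

text \<open>Taken in the full algebraic closure, this fixed field may exceed the henselization by
  purely inseparable elements; therefore only one inclusion between the two is used.\<close>

definition decomposition_field :: "'f::field set \<Rightarrow> ('f \<Rightarrow> 'g::linordered_ab_group_add extended) \<Rightarrow>
    'f set \<Rightarrow> 'f set"
  where "decomposition_field F u L = {z \<in> F. \<forall>\<sigma>\<in>decomposition_group F u L. \<sigma> z = z}"

lemma decomposition_group_comp:
  assumes "\<sigma> \<in> decomposition_group F u L" and "\<tau> \<in> decomposition_group F u L"
  shows "(\<lambda>x. \<sigma> (\<tau> x)) \<in> decomposition_group F u L"
proof -
  have \<tau>: "\<tau> \<in> field_auts F L" and "\<sigma> \<in> field_auts F L"
    using assms by (simp_all add: decomposition_group_def)
  thus ?thesis
    using assms field_auts_mem[OF \<tau>] by (simp add: decomposition_group_def field_auts_comp)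
qed

lemma subfield_decomposition_field:
  assumes LF: "alg_closure_of L F"
  shows "subfield (decomposition_field F u L) \<Omega>" and "L \<subseteq> decomposition_field F u L"
    and "decomposition_field F u L \<subseteq> F"
proof -
  note F = alg_closure_ofD(2)[OF LF]
  show "subfield (decomposition_field F u L) \<Omega>"
    unfolding subfield_ambient_iff decomposition_field_def decomposition_group_def
    using subfield_closed[OF F]
    by (auto simp: field_auts_add[OF F] field_auts_mult[OF F] field_auts_inverse[OF F]
        field_auts_uminus[OF F] field_auts_0_iff[OF F] mem_field_auts_iff[THEN iffD1])
  show "L \<subseteq> decomposition_field F u L"
    using alg_closure_ofD(3)[OF LF]
    by (auto simp: decomposition_field_def decomposition_group_def mem_field_auts_iff)
  show "decomposition_field F u L \<subseteq> F"
    by (auto simp: decomposition_field_def)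
qed

text \<open>A competing valuation is \<open>u \<circ> \<tau>\<close> with \<open>\<tau>\<close>
  fixing the decomposition field. No topology on the automorphism group is involved: the orbit of
  \<open>z\<close> under the decomposition group is finite, its root polynomial \<open>q\<close> has
  coefficients in the fixed field, so \<open>\<tau> z\<close> lies in the orbit and has the same
  value as \<open>z\<close>.\<close>

lemma henselian_decomposition_field:
  fixes F :: "'f::alg_closed_field set"
  assumes LF: "alg_closure_of L F" and u: "valuation_on F u"
  shows "henselian_in F u (decomposition_field F u L)"
  unfolding henselian_in_def
proof (intro allI impI ballI)
  fix u' z assume u': "valuation_on F u' \<and> extends_on (decomposition_field F u L) u u'" and z: "z \<in> F"
  let ?D = "decomposition_group F u L" and ?M = "decomposition_field F u L"
  note L = alg_closure_ofD(1,2,3)[OF LF]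
  note M = subfield_decomposition_field[OF LF, of u]
  have MF: "alg_closure_of ?M F"
    by (rule alg_closure_of_mono[OF LF M])
  have "u' x = u x" if "x \<in> ?M" for x
    using u' that by (simp add: extends_on_def)
  then obtain \<tau> where \<tau>: "\<tau> \<in> field_auts F ?M" "\<And>x. x \<in> F \<Longrightarrow> u' x = u (\<tau> x)"
    using valuations_conjugate[OF MF u] u' by blast
  define orbit where "orbit = (\<lambda>\<sigma>. \<sigma> z) ` ?D"
  obtain p where p: "p \<in> polys_over L" "p \<noteq> 0" "poly p z = 0"
    using alg_closure_ofD(4)[OF LF z] by blast
  have "y \<in> F \<and> poly p y = 0" if "y \<in> orbit" for y
  proof -
    from that obtain \<sigma> where "\<sigma> \<in> field_auts F L" "y = \<sigma> z"
      by (auto simp: orbit_def decomposition_group_def)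
    thus ?thesis
      using field_auts_poly[OF L(2) _ p(1) L(3) z] p(3) field_auts_mem[OF _ z]
        field_auts_0_iff[OF L(2) _ subfield_0[OF L(2)]] by metis
  qed
  hence orbitF: "orbit \<subseteq> F" and "orbit \<subseteq> {y. poly p y = 0}"
    by auto
  hence "finite orbit"
    using poly_roots_finite[OF p(2)] finite_subset by blast
  have id: "(\<lambda>x. x) \<in> ?D"
    by (simp add: decomposition_group_def field_auts_id)
  have "z \<in> orbit"
    unfolding orbit_def using id by (rule image_eqI[rotated]) simp
  have comp: "(\<lambda>x. \<sigma> (\<tau> x)) \<in> ?D" if "\<sigma> \<in> ?D" "\<tau> \<in> ?D" for \<sigma> \<tau>
    using that by (rule decomposition_group_comp)
  define q where "q = (\<Prod>y\<in>orbit. [:- y, 1:])"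
  have "q \<in> polys_over ?M"
  proof -
    have "coeff q i \<in> F \<and> \<sigma> (coeff q i) = coeff q i" if \<sigma>: "\<sigma> \<in> ?D" for \<sigma> i
    proof -
      have \<sigma>': "\<sigma> \<in> field_auts F L"
        using \<sigma> by (simp add: decomposition_group_def)
      note R = partial_iso_ring_rel[OF partial_iso_graph[OF L(2) \<sigma>']]
      note R1 = ring_rel_poly_rel[OF R]
      have "\<sigma> y \<in> orbit" if "y \<in> orbit" for y
        using that comp[OF \<sigma>] by (auto simp: orbit_def)
      moreover have "inj_on \<sigma> orbit"
        using \<sigma>' orbitF by (auto simp: mem_field_auts_iff bij_betw_def intro: inj_on_subset)
      ultimately have bij: "bij_betw \<sigma> orbit orbit"
        using \<open>finite orbit\<close> by (simp add: bij_betw_def endo_inj_surj image_subsetI)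
      have "([:- y, 1:], [:- \<sigma> y, 1:]) \<in> poly_rel (graph_on \<sigma> F)" if "y \<in> orbit" for y
        using that orbitF
        by (intro poly_rel_pCons ring_rel_uminus[OF R] ring_rel_1[OF R] ring_rel_0[OF R1]) auto
      hence "(q, \<Prod>y\<in>orbit. [:- \<sigma> y, 1:]) \<in> poly_rel (graph_on \<sigma> F)"
        unfolding q_def by (rule ring_rel_prod[OF R1])
      moreover have "(\<Prod>y\<in>orbit. [:- \<sigma> y, 1:]) = q"
        unfolding q_def by (rule prod.reindex_bij_betw[OF bij])
      ultimately show ?thesis
        by (simp add: poly_rel_graph_iff)
    qed
    thus ?thesis
      using id by (auto simp: decomposition_field_def)
  qed
  have root: "poly q y = 0 \<longleftrightarrow> y \<in> orbit" for y
    using \<open>finite orbit\<close> by (auto simp: q_def poly_prod)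
  have "poly q (\<tau> z) = \<tau> (poly q z)"
    using field_auts_poly[OF L(2) \<tau>(1) \<open>q \<in> polys_over ?M\<close> M(3) z] by simp
  hence "\<tau> z \<in> orbit"
    using root \<open>z \<in> orbit\<close> field_auts_0_iff[OF L(2) \<tau>(1) subfield_0[OF L(2)]] by metis
  then obtain \<sigma> where "\<sigma> \<in> ?D" "\<tau> z = \<sigma> z"
    by (auto simp: orbit_def)
  thus "u' z = u z"
    using \<tau>(2)[OF z] z by (simp add: decomposition_group_def)
qed

lemma subfield_Inter:
  "(\<And>E. E \<in> S \<Longrightarrow> subfield E (\<Omega> :: 'f::field ring)) \<Longrightarrow> subfield (\<Inter>S) \<Omega>"
  unfolding subfield_ambient_iff by blast

lemma henselization_bounds:
  assumes LF: "alg_closure_of L F"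
  shows "subfield (henselization F u L) \<Omega>" and "L \<subseteq> henselization F u L" and "henselization F u L \<subseteq> F"
proof -
  \<comment> \<open>\<open>F\<close> itself belongs to the family being intersected; for an empty
    family the intersection would be the whole type.\<close>
  have "henselian_in F u F"
    by (simp add: henselian_in_def extends_on_def)
  thus "henselization F u L \<subseteq> F"
    using alg_closure_ofD(2,3)[OF LF] by (auto simp: henselization_def)
  show "subfield (henselization F u L) \<Omega>"
    unfolding henselization_def by (rule subfield_Inter) blast
  show "L \<subseteq> henselization F u L"
    unfolding henselization_def by blast
qed

text \<open>The decomposition field is one of the henselian fields being intersected.\<close>

lemma decomposition_group_fixes_henselization:
  fixes F :: "'f::alg_closed_field set"
  assumes LF: "alg_closure_of L F" and u: "valuation_on F u"
    and "\<sigma> \<in> decomposition_group F u L" and "x \<in> henselization F u L"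
  shows "\<sigma> x = x"
proof -
  have "henselization F u L \<subseteq> decomposition_field F u L"
    unfolding henselization_def
    using subfield_decomposition_field[OF LF, of u] henselian_decomposition_field[OF LF u]
    by (intro Inter_lower) simp
  thus ?thesis
    using assms(3,4) by (auto simp: decomposition_field_def)
qed

text \<open>
  Every element \<open>z\<close> of the decomposition field is fixed by the automorphisms over any henselian
  intermediate field \<open>E\<close>, so a power of \<open>z\<close>, with an exponent that does not depend on \<open>E\<close>, lies in
  \<open>E\<close>. Hence a valuation agreeing with \<open>u\<close> on the intersection of all \<open>E\<close> agrees with \<open>u\<close> at \<open>z\<close>.
\<close>

lemma henselian_henselization:
  fixes F :: "'f::alg_closed_field set"
  assumes LF: "alg_closure_of L F" and u: "valuation_on F u"
  shows "henselian_in F u (henselization F u L)"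
  unfolding henselian_in_def
proof (intro allI impI)
  fix u' assume "valuation_on F u' \<and> extends_on (henselization F u L) u u'"
  hence u': "valuation_on F u'" "\<And>x. x \<in> henselization F u L \<Longrightarrow> u' x = u x"
    unfolding extends_on_def by blast+
  let ?M = "decomposition_field F u L"
  note L = alg_closure_ofD(1,2,3)[OF LF]
  note M = subfield_decomposition_field[OF LF, of u]
  note v = ring_valuation_on_subfield[OF L(2) u] and v' = ring_valuation_on_subfield[OF L(2) u'(1)]
  have "u' z = u z" if z: "z \<in> ?M" for z
  proof -
    have "z \<in> F"
      using z M(3) by blast
    then obtain p where p: "p \<in> polys_over L" "p \<noteq> 0" "poly p z = 0"
      using alg_closure_ofD(4)[OF LF] by blast
    have "z ^ fact (degree p) \<in> E"
      if E: "subfield E \<Omega>" "L \<subseteq> E" "E \<subseteq> F" "henselian_in F u E" for E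
    proof (rule fixed_power_mem[OF alg_closure_of_mono[OF LF E(1-3)] \<open>z \<in> F\<close>])
      show "p \<in> polys_over E" "p \<noteq> 0" "poly p z = 0"
        using p E(2) by auto
      fix \<sigma> assume \<sigma>: "\<sigma> \<in> field_auts F E"
      have "valuation_on F (\<lambda>x. u (\<sigma> x))"
        by (rule valuation_on_comp_field_aut[OF L(2) u \<sigma>])
      moreover have "extends_on E u (\<lambda>x. u (\<sigma> x))"
        using \<sigma> by (simp add: extends_on_def mem_field_auts_iff)
      ultimately have "\<forall>x\<in>F. u (\<sigma> x) = u x"
        using E(4) unfolding henselian_in_def by (elim allE[of _ "\<lambda>x. u (\<sigma> x)"]) blast
      hence "\<sigma> \<in> decomposition_group F u L"
        using \<sigma> field_auts_mono[OF E(2)] by (auto simp: decomposition_group_def)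
      thus "\<sigma> z = z"
        using z by (simp add: decomposition_field_def)
    qed
    hence "z ^ fact (degree p) \<in> henselization F u L"
      by (auto simp: henselization_def)
    hence "u' (z ^ fact (degree p)) = u (z ^ fact (degree p))"
      by (rule u'(2))
    hence "(\<Sum>j<fact (degree p) :: nat. u' z) = (\<Sum>j<fact (degree p) :: nat. u z)"
      by (simp only: ring_valuation_power[OF v \<open>z \<in> F\<close>] ring_valuation_power[OF v' \<open>z \<in> F\<close>])
    thus ?thesis
      by (rule sum_const_inject) (simp_all add: ring_valuation_not_Minf[OF v \<open>z \<in> F\<close>]
        ring_valuation_not_Minf[OF v' \<open>z \<in> F\<close>])
  qed
  hence "extends_on ?M u u'"
    by (simp add: extends_on_def)
  thus "\<forall>x\<in>F. u' x = u x"
    using henselian_decomposition_field[OF LF u] u'(1) by (auto simp: henselian_in_def)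
qed

text \<open>For \<open>\<sigma>\<close> over the henselization, \<open>u \<circ> \<sigma>\<close>
  extends the same valuation as \<open>u\<close>, so the two coincide by henselianity.\<close>

lemma field_auts_henselization:
  fixes F :: "'f::alg_closed_field set"
  assumes LF: "alg_closure_of L F" and u: "valuation_on F u"
  shows "field_auts F (henselization F u L) = decomposition_group F u L"
proof (intro equalityI subsetI)
  fix \<sigma> assume \<sigma>: "\<sigma> \<in> field_auts F (henselization F u L)"
  have "valuation_on F (\<lambda>x. u (\<sigma> x))"
    by (rule valuation_on_comp_field_aut[OF alg_closure_ofD(2)[OF LF] u \<sigma>])
  moreover have "extends_on (henselization F u L) u (\<lambda>x. u (\<sigma> x))"
    using \<sigma> by (simp add: extends_on_def mem_field_auts_iff)
  ultimately have "\<forall>x\<in>F. u (\<sigma> x) = u x"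
    using henselian_henselization[OF LF u] unfolding henselian_in_def
    by (elim allE[of _ "\<lambda>x. u (\<sigma> x)"]) blast
  thus "\<sigma> \<in> decomposition_group F u L"
    using \<sigma> field_auts_mono[OF henselization_bounds(2)[OF LF, of u]]
    by (auto simp: decomposition_group_def)
next
  fix \<sigma> assume \<sigma>: "\<sigma> \<in> decomposition_group F u L"
  hence "\<sigma> x = x" if "x \<in> henselization F u L" for x
    using decomposition_group_fixes_henselization[OF LF u] that by blast
  thus "\<sigma> \<in> field_auts F (henselization F u L)"
    using \<sigma> by (auto simp: decomposition_group_def field_auts_def)
qed

section \<open>Polynomials as coefficient lists\<close>

lemma ambient_simps [simp]:
  "carrier \<Omega> = UNIV" "ring.zero \<Omega> = (0 :: 'f::field)" "one \<Omega> = (1 :: 'f)"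
  "monoid.mult \<Omega> x y = (x * y :: 'f)" "add \<Omega> x y = (x + y :: 'f)"
  by (simp_all add: ring_of_type_algebra_def)

lemma nat_pow_ambient: "x [^]\<^bsub>(\<Omega>\<lparr>carrier := F\<rparr>)\<^esub> (n::nat) = (x::'f::field) ^ n"
  by (induction n) (auto simp: nat_pow_def ring_of_type_algebra_def)

text \<open>Coefficient lists in HOL-Algebra start with the leading coefficient, those of
  \<open>Poly\<close> with the constant one; hence the reversal.\<close>

lemma eval_ambient:
  assumes "ring (\<Omega>\<lparr>carrier := F\<rparr>)"
  shows "ring.eval (\<Omega>\<lparr>carrier := F\<rparr>) p x = poly (Poly (rev p)) (x :: 'f::field)"
proof (induction p)
  case Nil
  thus ?case
    by (simp add: ring.eval.simps[OF assms])
next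
  case (Cons a p)
  thus ?case
    by (simp add: ring.eval.simps[OF assms] nat_pow_ambient Poly_append poly_monom)
qed

lemma ambient_UNIV: "(\<Omega>\<lparr>carrier := UNIV\<rparr>) = (\<Omega> :: 'f::field ring)"
  by (simp add: ring_of_type_algebra_def)

text \<open>The degree formula includes the zero polynomial: for the empty list, truncated
  subtraction gives 0.\<close>

lemma univ_poly_ambientE:
  assumes "p \<in> carrier (K[X]\<^bsub>\<Omega>\<lparr>carrier := F\<rparr>\<^esub>)" and "subfield K (\<Omega> :: 'f::field ring)"
  shows "Poly (rev p) \<in> polys_over K" and "p \<noteq> [] \<Longrightarrow> Poly (rev p) \<noteq> 0"
    and "degree (Poly (rev p)) = length p - 1"
proof -
  have p: "p = [] \<or> set p \<subseteq> K \<and> hd p \<noteq> 0"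
    using assms(1) unfolding univ_poly_carrier[symmetric] polynomial_def
    by simp
  show "Poly (rev p) \<in> polys_over K"
    using p subfield_0[OF assms(2)] nth_mem[of _ "rev p"] by (auto simp: nth_default_def)
  have *: "coeffs (Poly (rev p)) = rev p"
    using p by (cases p) (auto simp: no_trailing_unfold)
  show "Poly (rev p) \<noteq> 0" if "p \<noteq> []"
    using * that by (metis coeffs_eq_Nil rev_is_Nil_conv)
  show "degree (Poly (rev p)) = length p - 1"
    using * by (simp add: degree_eq_length_coeffs)
qed

lemma rev_coeffs_univ_poly:
  assumes "p \<in> polys_over K"
  shows "rev (coeffs p) \<in> carrier (K[X]\<^bsub>\<Omega>\<lparr>carrier := F\<rparr>\<^esub>)"
proof -
  have "set (coeffs p) \<subseteq> K"
    using assms by (auto simp: coeffs_def)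
  moreover have "hd (rev (coeffs p)) \<noteq> 0" if "p \<noteq> 0"
    using that by (simp add: hd_rev last_coeffs_eq_coeff_degree)
  ultimately show ?thesis
    unfolding univ_poly_carrier[symmetric] polynomial_def
    by (cases "p = 0") auto
qed

lemma algebraic_ambientE:
  assumes "subfield K (\<Omega> :: 'f::field ring)" and "(ring.algebraic \<Omega> over K) (z :: 'f)"
  shows "\<exists>p\<in>polys_over K. p \<noteq> 0 \<and> poly p z = 0"
proof -
  interpret field "\<Omega> :: 'f ring"
    by rule
  obtain p where p: "p \<in> carrier (K[X]\<^bsub>\<Omega>\<^esub>)" "p \<noteq> []" "eval p z = \<zero>\<^bsub>\<Omega>\<^esub>"
    using algebraicE[OF subfieldE(1)[OF assms(1)] _ assms(2)] by auto
  note p' = univ_poly_ambientE[where F = UNIV, unfolded ambient_UNIV, OF p(1) assms(1)]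
  have "poly (Poly (rev p)) z = 0"
    using p(3) eval_ambient[where F = UNIV, unfolded ambient_UNIV, OF ring_axioms, of p z]
    by simp
  thus ?thesis
    using p' p(2) by blast
qed

lemma algebraic_ambientI:
  assumes "p \<in> polys_over K" and "p \<noteq> 0" and "poly p (z :: 'f::field) = 0"
  shows "(ring.algebraic \<Omega> over K) z"
proof -
  interpret field "\<Omega> :: 'f ring"
    by rule
  have "eval (rev (coeffs p)) z = \<zero>\<^bsub>\<Omega>\<^esub>"
    using assms(3) eval_ambient[where F = UNIV, unfolded ambient_UNIV, OF ring_axioms, of "rev (coeffs p)" z]
    by simp
  thus ?thesis
    using rev_coeffs_univ_poly[where F = UNIV, unfolded ambient_UNIV, OF assms(1)] assms(2)
    by (intro algebraicI[of "rev (coeffs p)"]) auto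
qed

lemma transcendental_ambientD:
  assumes "(ring.transcendental \<Omega> over K) (z :: 'f::field)" and "p \<in> polys_over K" and "poly p z = 0"
  shows "p = 0"
  using algebraic_ambientI[OF assms(2) _ assms(3)] assms(1) by (auto simp: over_def)

text \<open>The library notion gives roots inside \<open>F\<close>, whereas here every root in the
  ambient type has to lie in \<open>F\<close>. If \<open>z\<close> were outside, its minimal
  polynomial over \<open>F\<close> would have a root \<open>y\<close> in \<open>F\<close>, and
  splitting off \<open>y\<close> would leave an annihilating polynomial of smaller degree.\<close>

lemma alg_closure_of_algebraic_closure:
  assumes "subfield L \<Omega>" and "L \<subseteq> F" and "algebraic_closure (\<Omega>\<lparr>carrier := F\<rparr>) (L :: 'f::field set)"
  shows "alg_closure_of L F"
proof -
  interpret A: field "\<Omega> :: 'f ring"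
    by rule
  interpret algebraic_closure "\<Omega>\<lparr>carrier := F\<rparr>" L
    by (rule assms(3))
  have F: "subfield F \<Omega>"
    by (rule A.subfield_iff(1)) (use field_axioms in auto)
  have alg: "\<exists>p\<in>polys_over L. p \<noteq> 0 \<and> poly p z = 0" if "z \<in> F" for z
    using algebraic_extension[of z] that
    by (intro algebraic_ambientE assms(1)) (simp add: A.algebraic_consistent[OF subfieldE(1)[OF F]])
  have root: "\<exists>y\<in>F. poly p y = 0" if "p \<in> polys_over F" "degree p > 0" for p
  proof -
    define q where "q = rev (coeffs p)"
    have q: "q \<in> carrier (F[X]\<^bsub>\<Omega>\<lparr>carrier := F\<rparr>\<^esub>)"
      unfolding q_def by (rule rev_coeffs_univ_poly[OF that(1)])
    hence "splitted q"
      using roots_over_carrier[of q] by simp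
    moreover have "length q - 1 > 0"
      using that(2) by (simp add: q_def degree_eq_length_coeffs)
    ultimately have "size (roots q) > 0"
      by (simp add: splitted_def)
    then obtain y where "y \<in># roots q"
      by (metis multiset_nonemptyE nonempty_has_size)
    hence "is_root q y"
      using roots_mem_iff_is_root[of q] q by auto
    hence "y \<in> F" "poly p y = 0"
      using eval_ambient[OF ring_axioms, of q y] by (auto simp: is_root_def q_def)
    thus ?thesis
      by blast
  qed
  have "z \<in> F" if p: "p \<in> polys_over F" "p \<noteq> 0" "poly p z = 0" for p z
  proof (rule ccontr)
    assume "z \<notin> F"
    obtain m where m: "minimal_poly F z m"
      using minimal_poly_exists[OF p] .
    hence m0: "m \<in> polys_over F" "m \<noteq> 0" "poly m z = 0"
      by (auto simp: minimal_poly_def)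
    obtain y where y: "y \<in> F" "poly m y = 0"
      using root[OF m0(1)] root_imp_degree_pos[OF m0(2,3)] by blast
    define l where "l = [:- y, 1:]"
    have l: "l \<in> polys_over F"
      using y(1) subfield_closed[OF F] by (auto simp: l_def coeff_pCons split: nat.split)
    have "partial_iso (Id_on F)" "(l, l) \<in> poly_rel (Id_on F)" "(m, m) \<in> poly_rel (Id_on F)" "l \<noteq> 0"
      using F l m0(1) by (auto simp: partial_iso_Id_on poly_rel_Id_on l_def)
    from poly_rel_division[OF this(1,2,4,3)] obtain q r where
      qr: "q \<in> polys_over F" "m = l * q + r" "r = 0 \<or> degree r < degree l"
      unfolding poly_rel_Id_on Id_on_iff by blast
    have "degree r = 0"
      using qr(3) by (auto simp: l_def)
    then obtain c where "r = [:c:]"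
      by (rule degree_eq_zeroE)
    hence m_eq: "m = l * q"
      using qr(2) y(2) by (simp add: l_def)
    hence "q \<noteq> 0" "poly q z = 0"
      using m0 \<open>z \<notin> F\<close> y(1) by (auto simp: l_def)
    hence "degree m \<le> degree q"
      using m qr(1) by (auto simp: minimal_poly_def)
    moreover have "degree m = degree l + degree q"
      unfolding m_eq using \<open>q \<noteq> 0\<close> \<open>l \<noteq> 0\<close> by (rule degree_mult_eq[rotated])
    ultimately show False
      by (simp add: l_def)
  qed
  thus ?thesis
    using assms(1,2) F alg by (auto simp: alg_closure_of_def)
qed

text \<open>The vector space dimension is known for the library polynomial \<open>Irr K z\<close>.
  This divides \<open>m\<close>, and minimality of \<open>m\<close> gives the reverse inequality of
  degrees.\<close>

lemma ext_degree_eq_degree: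
  assumes K: "subfield K (\<Omega> :: 'f::field ring)" and m: "minimal_poly K z m"
  shows "ext_degree K z = degree m"
proof -
  interpret field "\<Omega> :: 'f ring"
    by rule
  have m0: "m \<in> polys_over K" "m \<noteq> 0" "poly m z = 0"
    using m by (auto simp: minimal_poly_def)
  have alg: "(algebraic over K) z"
    by (rule algebraic_ambientI[OF m0])
  have z: "z \<in> carrier \<Omega>"
    by simp
  note ring_axioms' = eval_ambient[where F = UNIV, unfolded ambient_UNIV, OF ring_axioms]
  note Irr = IrrE(1,4)[OF K z alg]
  note Irr' = univ_poly_ambientE[where F = UNIV, unfolded ambient_UNIV, OF Irr(1) K]
  have "simple_extension K z = adjoin K z"
  proof
    show "simple_extension K z \<subseteq> adjoin K z"
      using adjoin_incl by (intro simple_extension_subring_incl subfieldE(1) subfield_adjoin) auto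
    show "adjoin K z \<subseteq> simple_extension K z"
      using simple_extension_is_subfield[OF K z] alg simple_extension_incl[OF subfieldE(3)[OF K] z]
        simple_extension_mem[OF subfieldE(1)[OF K] z]
      by (intro adjoin_least) auto
  qed
  hence "ext_degree K z = length (Irr K z) - 1"
    using dimI[OF K dimension_simple_extension[OF K z alg]] by (simp add: ext_degree_def over_def)
  moreover have "length (Irr K z) - 1 = degree m"
  proof (rule antisym)
    have "rev (coeffs m) \<in> carrier (K[X]\<^bsub>\<Omega>\<^esub>)"
      using rev_coeffs_univ_poly[where F = UNIV, unfolded ambient_UNIV, OF m0(1)] .
    moreover from this have "Irr K z pdivides\<^bsub>\<Omega>\<^esub> rev (coeffs m)"
      by (rule Irr_minimal[OF K z alg])
        (use m0(3) ring_axioms' in simp)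
    ultimately have "length (Irr K z) - 1 \<le> length (rev (coeffs m)) - 1"
      using m0(2) by (intro pdivides_imp_degree_le[OF subfieldE(1)[OF K] Irr(1)]) auto
    thus "length (Irr K z) - 1 \<le> degree m"
      by (simp add: degree_eq_length_coeffs)
    have "Irr K z \<noteq> []"
    proof
      assume "Irr K z = []"
      thus False
        using IrrE(2)[OF K z alg] pirreducibleE(1)[OF subfieldE(1)[OF K]] Irr(1) by blast
    qed
    moreover have "poly (Poly (rev (Irr K z))) z = 0"
      using Irr(2) ring_axioms' by simp
    ultimately show "degree m \<le> length (Irr K z) - 1"
      using m Irr'(1,2) unfolding Irr'(3)[symmetric] minimal_poly_def by blast
  qed
  ultimately show ?thesis
    by simp
qed

section \<open>Monomial valuations\<close>

lemma ring_valuation_prod_mset_cong: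
  assumes v: "ring_valuation_on R v" and v': "ring_valuation_on R' v'"
    and "\<And>y. y \<in># A \<Longrightarrow> f y \<in> R \<and> f' y \<in> R' \<and> v' (f' y) = v (f y)"
  shows "(\<Prod>y\<in>#A. f y) \<in> R \<and> (\<Prod>y\<in>#A. f' y) \<in> R' \<and> v' (\<Prod>y\<in>#A. f' y) = v (\<Prod>y\<in>#A. f y)"
  using assms(3)
proof (induction A)
  case (add y A)
  thus ?case
    by (simp add: ring_valuation_mult[OF v] ring_valuation_mult[OF v'] ring_valuation_mult_mem[OF v]
        ring_valuation_mult_mem[OF v'])
qed (simp add: ring_valuation_1[OF v] ring_valuation_1[OF v'] ring_valuation_1_mem[OF v]
    ring_valuation_1_mem[OF v'])

lemma poly_eq_prod_roots:
  fixes F :: "'f::alg_closed_field set"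
  assumes LF: "alg_closure_of L F" and p: "p \<in> polys_over F" "p \<noteq> 0"
  obtains c A where "c \<in> F" "c \<noteq> 0" "\<And>x. poly p x = c * (\<Prod>y\<in>#A. x - y)"
    "\<And>y. y \<in># A \<Longrightarrow> y \<in> F \<and> poly p y = 0"
proof -
  obtain A where A: "p = smult (lead_coeff p) (\<Prod>y\<in>#A. [:- y, 1:])"
    using alg_closed_imp_factorization[OF p(2)] by metis
  have poly: "poly p x = lead_coeff p * (\<Prod>y\<in>#A. x - y)" for x
    by (subst A) (simp add: poly_prod_mset image_mset.compositionality o_def)
  have "poly p y = 0" if "y \<in># A" for y
    using that unfolding poly by (auto intro!: image_eqI[of _ _ y])
  thus ?thesis
    using p alg_closure_ofD(5)[OF LF p] by (intro that[of "lead_coeff p" A] poly) auto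
qed

lemma adjoin_diff:
  assumes "subfield F \<Omega>" and "a \<in> F"
  shows "adjoin F (x - a) = adjoin F x"
proof -
  have "x - a \<in> adjoin F x"
    using adjoin_incl(1)[where E = F and z = x] adjoin_incl(2)[where E = F and z = x] assms(2)
    by (intro subfield_diff[OF subfield_adjoin]) auto
  moreover have "x \<in> adjoin F (x - a)"
    using adjoin_incl(1)[where E = F and z = "x - a"] adjoin_incl(2)[where E = F and z = "x - a"] assms(2)
      subfield_add[OF subfield_adjoin[of F "x - a"], of "x - a" a] by auto
  ultimately show ?thesis
    by (intro equalityI adjoin_least subfield_adjoin adjoin_incl)
qed

lemma pcompose_linear_over:
  assumes "subfield F \<Omega>" and "a \<in> F" and "p \<in> polys_over F"
  shows "pcompose p [:a, 1:] \<in> polys_over F"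
proof -
  have R: "ring_rel (Id_on (polys_over F))"
    using ring_rel_poly_rel[OF partial_iso_ring_rel[OF assms(1)[folded partial_iso_Id_on]]]
    by (simp add: poly_rel_Id_on)
  have const: "[:c:] \<in> polys_over F" if "c \<in> F" for c
    using that subfield_0[OF assms(1)] by (auto simp: coeff_pCons split: nat.split)
  have lin: "[:a, 1:] \<in> polys_over F"
    using assms(2) subfield_0[OF assms(1)] subfield_1[OF assms(1)]
    by (auto simp: coeff_pCons split: nat.split)
  have add: "p + q \<in> polys_over F" if "p \<in> polys_over F" "q \<in> polys_over F" for p q
    using ring_rel_add[OF R, of p p q q] that unfolding Id_on_iff by blast
  show ?thesis
    using assms(3)
  proof (induction p)
    case (pCons c p)
    have "coeff (pCons c p) 0 \<in> F" "coeff (pCons c p) (Suc i) \<in> F" for i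
      using pCons.prems by blast+
    hence "c \<in> F" "p \<in> polys_over F"
      by simp_all
    thus ?case
      unfolding pcompose_pCons
      by (intro add const polys_over_closed(3)[OF assms(1)] lin pCons.IH)
  qed (simp add: subfield_0[OF assms(1)])
qed

lemma gauss_value_linear:
  "gauss_value v \<gamma> [:c, 1:] = min (v c) (v 1 + Fin \<gamma>)"
proof -
  have "gauss_value v \<gamma> [:c, 1:] = Min {v c + Fin 0, v 1 + Fin \<gamma>}"
    by (simp add: gauss_value_def atMost_Suc insert_commute)
  also have "v c + Fin 0 = v c"
    by (cases "v c") auto
  finally show ?thesis
    by simp
qed

lemma gauss_value_const: "gauss_value v \<gamma> [:c:] = v c"
  unfolding gauss_value_def by (cases "v c") auto

text \<open>Well-definedness of the definite description: \<open>x - a\<close> is transcendental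
  over \<open>F\<close>, so equal fractions give a polynomial identity after cross-multiplication,
  to which multiplicativity of the Gauss value applies.\<close>

lemma monomial_val_fraction:
  assumes F: "subfield F \<Omega>" and v: "valuation_on F v" and "a \<in> F"
    and x: "\<forall>p\<in>polys_over F. poly p x = 0 \<longrightarrow> p = 0"
    and p: "p \<in> polys_over F" and q: "q \<in> polys_over F" "q \<noteq> 0"
  shows "monomial_val F v x a \<gamma> (poly p (x - a) / poly q (x - a)) =
    gauss_value v \<gamma> p - gauss_value v \<gamma> q"
proof -
  note G = ring_valuation_gauss_value[OF ring_valuation_on_subfield[OF F v], of \<gamma>]
  have coeffs: "set (coeffs p) \<subseteq> F \<longleftrightarrow> p \<in> polys_over F" for p
  proof -
    have "set (coeffs p) \<subseteq> F \<longleftrightarrow> range (coeff p) \<subseteq> F"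
      using subfield_0[OF F] by (simp add: range_coeff)
    thus ?thesis
      by (simp add: image_subset_iff)
  qed
  have x': "p = 0" if "p \<in> polys_over F" "poly p (x - a) = 0" for p
  proof -
    have "pcompose p [:- a, 1:] \<in> polys_over F"
      using pcompose_linear_over[OF F _ that(1)] subfield_uminus[OF F \<open>a \<in> F\<close>] by blast
    moreover have "poly (pcompose p [:- a, 1:]) x = 0"
      using that(2) by (simp add: poly_pcompose)
    ultimately have "pcompose p [:- a, 1:] = 0"
      using x by blast
    thus ?thesis
      by (rule pcompose_eq_0) simp
  qed
  show ?thesis
    unfolding monomial_val_def
  proof (rule the_equality)
    show "\<exists>p' q'. set (coeffs p') \<subseteq> F \<and> set (coeffs q') \<subseteq> F \<and> q' \<noteq> 0 \<and>
        poly p (x - a) / poly q (x - a) = poly p' (x - a) / poly q' (x - a) \<and>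
        gauss_value v \<gamma> p - gauss_value v \<gamma> q = gauss_value v \<gamma> p' - gauss_value v \<gamma> q'"
      using p q unfolding coeffs by blast
  next
    fix y assume "\<exists>p' q'. set (coeffs p') \<subseteq> F \<and> set (coeffs q') \<subseteq> F \<and> q' \<noteq> 0 \<and>
        poly p (x - a) / poly q (x - a) = poly p' (x - a) / poly q' (x - a) \<and>
        y = gauss_value v \<gamma> p' - gauss_value v \<gamma> q'"
    then obtain p' q' where p': "p' \<in> polys_over F" and q': "q' \<in> polys_over F" "q' \<noteq> 0"
      and eq: "poly p (x - a) / poly q (x - a) = poly p' (x - a) / poly q' (x - a)"
      and y: "y = gauss_value v \<gamma> p' - gauss_value v \<gamma> q'"
      unfolding coeffs by blast
    have "poly q (x - a) \<noteq> 0" "poly q' (x - a) \<noteq> 0"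
      using x' q q' by blast+
    hence "poly (p * q' - p' * q) (x - a) = 0"
      using eq by (simp add: field_simps)
    moreover have "p * q' - p' * q \<in> polys_over F"
      by (intro polys_over_closed(2,3)[OF F] p q p' q')
    ultimately have "p * q' - p' * q = 0"
      using x' by blast
    hence "gauss_value v \<gamma> (p * q') = gauss_value v \<gamma> (p' * q)"
      by simp
    hence "gauss_value v \<gamma> p + gauss_value v \<gamma> q' = gauss_value v \<gamma> p' + gauss_value v \<gamma> q"
      by (simp only: ring_valuation_mult[OF G p q'(1)] ring_valuation_mult[OF G p' q(1)])
    moreover obtain g g' where "gauss_value v \<gamma> q = Fin g" "gauss_value v \<gamma> q' = Fin g'"
      using ring_valuation_finite[OF G q] ring_valuation_finite[OF G q'] by metis
    ultimately show "y = gauss_value v \<gamma> p - gauss_value v \<gamma> q"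
      unfolding y by (cases "gauss_value v \<gamma> p"; cases "gauss_value v \<gamma> p'") (auto simp: algebra_simps)
  qed
qed

lemma monomial_val:
  assumes F: "subfield F \<Omega>" and v: "valuation_on F v" and a: "a \<in> F"
    and x: "\<forall>p\<in>polys_over F. poly p x = 0 \<longrightarrow> p = 0"
  shows valuation_on_monomial_val: "valuation_on (adjoin F x) (monomial_val F v x a \<gamma>)"
    and monomial_val_const: "c \<in> F \<Longrightarrow> monomial_val F v x a \<gamma> c = v c"
    and monomial_val_diff: "z \<in> F \<Longrightarrow> monomial_val F v x a \<gamma> (x - z) = min (v (a - z)) (Fin \<gamma>)"
    and monomial_val_le: "p \<in> polys_over F \<Longrightarrow> monomial_val F v x a \<gamma> (poly p x) \<le> v (poly p a)"
proof -
  note u = ring_valuation_on_subfield[OF F v]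
  note G = ring_valuation_gauss_value[OF u, of \<gamma>]
  note frac = monomial_val_fraction[OF F v a x]
  note over = polys_over_closed[OF F]
  let ?V = "monomial_val F v x a \<gamma>" and ?G = "gauss_value v \<gamma>"
  have G1: "?G 1 = 0"
    by (rule ring_valuation_1[OF G])
  have minus_0: "y - 0 = y" for y :: "'b extended"
    by (cases y) (auto simp: zero_extended_def)
  have poly: "?V (poly p (x - a)) = ?G p" if "p \<in> polys_over F" for p
    using frac[OF that over(1), of \<gamma>] by (simp add: G1 minus_0)
  show "?V c = v c" if "c \<in> F"
  proof -
    have "[:c:] \<in> polys_over F"
      using that subfield_0[OF F] by (auto simp: coeff_pCons split: nat.split)
    from poly[OF this] show ?thesis
      by (simp add: gauss_value_const)
  qed
  show "?V (x - z) = min (v (a - z)) (Fin \<gamma>)" if "z \<in> F"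
  proof -
    have "[:a - z, 1:] \<in> polys_over F"
      using that a subfield_closed[OF F] by (auto simp: coeff_pCons split: nat.split)
    from poly[OF this] show ?thesis
      by (simp add: gauss_value_linear ring_valuation_1[OF u] zero_extended_def)
  qed
  show "?V (poly p x) \<le> v (poly p a)" if p: "p \<in> polys_over F"
  proof -
    \<comment> \<open>The Taylor expansion of \<open>p\<close> around \<open>a\<close>. Its constant
      coefficient is \<open>p(a)\<close>, which bounds the minimum from above.\<close>
    define q where "q = pcompose p [:a, 1:]"
    have "q \<in> polys_over F"
      unfolding q_def by (rule pcompose_linear_over[OF F a p])
    moreover have "poly q (x - a) = poly p x" "coeff q 0 = poly p a"
      by (simp_all add: q_def poly_pcompose flip: poly_0_coeff_0)
    ultimately have "?V (poly p x) = ?G q"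
      using poly by metis
    also have "\<dots> \<le> v (coeff q 0) + Fin (\<Sum>j<(0::nat). \<gamma>)"
      by (rule gauss_value_le) (rule ring_valuation_0[OF u])
    also have "\<dots> = v (poly p a)"
      using \<open>coeff q 0 = poly p a\<close> by (simp flip: zero_extended_def)
    finally show ?thesis .
  qed
  have frac_ex: "\<exists>p q. p \<in> polys_over F \<and> q \<in> polys_over F \<and> q \<noteq> 0 \<and> poly q (x - a) \<noteq> 0 \<and>
      y = poly p (x - a) / poly q (x - a)" if y: "y \<in> adjoin F x" for y
  proof -
    have "y \<in> adjoin F (x - a)"
      using y by (simp add: adjoin_diff[OF F a])
    then obtain p q where pq: "p \<in> polys_over F" "q \<in> polys_over F" "poly q (x - a) \<noteq> 0"
      "y = poly p (x - a) / poly q (x - a)"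
      unfolding adjoin_eq_fractions[OF F] by blast
    have "q \<noteq> 0"
      using pq(3) by auto
    thus ?thesis
      using pq by blast
  qed
  show "valuation_on (adjoin F x) ?V"
    unfolding valuation_on_def
  proof (intro conjI ballI)
    fix y assume "y \<in> adjoin F x"
    then obtain p q where pq: "p \<in> polys_over F" "q \<in> polys_over F" "q \<noteq> 0" "poly q (x - a) \<noteq> 0"
      "y = poly p (x - a) / poly q (x - a)"
      using frac_ex by blast
    have Vy: "?V y = ?G p - ?G q"
      unfolding pq(5) by (rule frac[OF pq(1-3)])
    obtain g where g: "?G q = Fin g"
      using ring_valuation_finite[OF G pq(2,3)] .
    have p_Minf: "?G p \<noteq> Minf"
      by (rule ring_valuation_not_Minf[OF G pq(1)])
    thus "?V y \<noteq> Minf"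
      unfolding Vy g by (cases "?G p") auto
    have "?V y = Pinf \<longleftrightarrow> ?G p = Pinf"
      unfolding Vy g by (cases "?G p") auto
    also have "\<dots> \<longleftrightarrow> p = 0"
      by (rule ring_valuation_Pinf_iff[OF G pq(1)])
    also have "\<dots> \<longleftrightarrow> y = 0"
    proof
      assume "y = 0"
      hence "?V (poly p (x - a)) = ?V (poly 0 (x - a))"
        using pq by simp
      hence "?G p = ?G 0"
        using poly[OF pq(1)] poly[OF ring_valuation_0_mem[OF G]] by simp
      thus "p = 0"
        using ring_valuation_0[OF G] ring_valuation_Pinf_iff[OF G pq(1)] by simp
    qed (simp add: pq(5))
    finally show "?V y = Pinf \<longleftrightarrow> y = 0" .
    fix z assume "z \<in> adjoin F x"
    then obtain s t where st: "s \<in> polys_over F" "t \<in> polys_over F" "t \<noteq> 0" "poly t (x - a) \<noteq> 0"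
      "z = poly s (x - a) / poly t (x - a)"
      using frac_ex by blast
    have Vz: "?V z = ?G s - ?G t"
      unfolding st(5) by (rule frac[OF st(1-3)])
    obtain h where h: "?G t = Fin h"
      using ring_valuation_finite[OF G st(2,3)] .
    have s_Minf: "?G s \<noteq> Minf"
      by (rule ring_valuation_not_Minf[OF G st(1)])
    have qt: "q * t \<in> polys_over F" "q * t \<noteq> 0" "?G (q * t) = Fin (g + h)"
      using over(3)[OF pq(2) st(2)] pq(3) st(3) ring_valuation_mult[OF G pq(2) st(2)] g h by simp_all
    have "y * z = poly (p * s) (x - a) / poly (q * t) (x - a)"
      by (simp add: pq(5) st(5))
    hence "?V (y * z) = ?G (p * s) - ?G (q * t)"
      using frac[OF over(3)[OF pq(1) st(1)] qt(1,2)] by simp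
    also have "\<dots> = (?G p + ?G s) - Fin (g + h)"
      by (simp only: ring_valuation_mult[OF G pq(1) st(1)] qt(3))
    also have "\<dots> = ?V y + ?V z"
      unfolding Vy Vz g h using p_Minf s_Minf
      by (cases "?G p"; cases "?G s") (auto simp: algebra_simps)
    finally show "?V (y * z) = ?V y + ?V z" .
    have num: "p * t + s * q \<in> polys_over F"
      by (intro ring_valuation_add_mem[OF G] over pq st)
    have "y + z = poly (p * t + s * q) (x - a) / poly (q * t) (x - a)"
      using pq(4) st(4) by (simp add: pq(5) st(5) add_frac_eq)
    hence V: "?V (y + z) = ?G (p * t + s * q) - Fin (g + h)"
      using frac[OF num qt(1,2)] qt(3) by simp
    have "min (?G (p * t)) (?G (s * q)) \<le> ?G (p * t + s * q)"
      by (intro ring_valuation_add[OF G] over pq st)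
    hence "min (?G p + Fin h) (?G s + Fin g) \<le> ?G (p * t + s * q)"
      by (simp only: ring_valuation_mult[OF G pq(1) st(2)] ring_valuation_mult[OF G st(1) pq(2)] g h)
    moreover have "?G (p * t + s * q) \<noteq> Minf"
      by (rule ring_valuation_not_Minf[OF G num])
    ultimately show "min (?V y) (?V z) \<le> ?V (y + z)"
      unfolding V Vy Vz g h using p_Minf s_Minf
      by (cases "?G p"; cases "?G s"; cases "?G (p * t + s * q)")
        (auto simp: algebra_simps min_add_distrib_right min_le_iff_disj)
  qed
qed

text \<open>Polynomials over \<open>F\<close> split into linear factors over \<open>F\<close>, so a
  valuation on \<open>F(x)\<close> is determined by its values at constants and at the elements
  \<open>x - z\<close>.\<close>

lemma valuations_eq_on_adjoin:
  fixes F :: "'f::alg_closed_field set"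
  assumes LF: "alg_closure_of L F" and u: "valuation_on (adjoin F x) u" "valuation_on (adjoin F x) u'"
    and const: "\<And>c. c \<in> F \<Longrightarrow> u' c = u c" and diff: "\<And>z. z \<in> F \<Longrightarrow> u' (x - z) = u (x - z)"
    and "y \<in> adjoin F x"
  shows "u' y = u y"
proof -
  note F = alg_closure_ofD(2)[OF LF]
  note A = subfield_adjoin[of F x]
  note v = ring_valuation_on_subfield[OF A u(1)] and v' = ring_valuation_on_subfield[OF A u(2)]
  have mem: "x - z \<in> adjoin F x" if "z \<in> F" for z
    using that adjoin_incl by (intro subfield_diff[OF A]) auto
  have poly: "poly p x \<in> adjoin F x \<and> u' (poly p x) = u (poly p x)" if p: "p \<in> polys_over F" for p
  proof (cases "p = 0")
    case True
    thus ?thesis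
      using ring_valuation_0[OF v] ring_valuation_0[OF v'] subfield_0[OF A] by simp
  next
    case False
    from poly_eq_prod_roots[OF LF p False] obtain c B where
      B: "c \<in> F" "\<And>x. poly p x = c * (\<Prod>y\<in>#B. x - y)" "\<And>y. y \<in># B \<Longrightarrow> y \<in> F"
      by metis
    have prod: "(\<Prod>y\<in>#B. x - y) \<in> adjoin F x" "u' (\<Prod>y\<in>#B. x - y) = u (\<Prod>y\<in>#B. x - y)"
      using ring_valuation_prod_mset_cong[OF v v', of B "\<lambda>y. x - y" "\<lambda>y. x - y"] diff mem B(3) by auto
    have c: "c \<in> adjoin F x" "u' c = u c"
      using B(1) adjoin_incl const by auto
    show ?thesis
      unfolding B(2) ring_valuation_mult[OF v c(1) prod(1)] ring_valuation_mult[OF v' c(1) prod(1)]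
      using c prod subfield_mult[OF A] by simp
  qed
  obtain p q where pq: "p \<in> polys_over F" "q \<in> polys_over F" "poly q x \<noteq> 0" "y = poly p x / poly q x"
    using \<open>y \<in> adjoin F x\<close> unfolding adjoin_eq_fractions[OF F] by blast
  show ?thesis
    unfolding pq(4) using poly[OF pq(1)] poly[OF pq(2)] pq(3)
    by (intro valuation_divide_cong[OF A u]) auto
qed

text \<open>Factor by factor: a root \<open>y\<close> outside the ball contributes
  \<open>min (v (a - y)) (Fin \<gamma>)\<close>, which is the value of \<open>a - y\<close>.\<close>

lemma monomial_val_eq_at_root:
  fixes F :: "'f::alg_closed_field set"
  assumes LF: "alg_closure_of L F" and v: "valuation_on F v" and a: "a \<in> F"
    and x: "\<forall>p\<in>polys_over F. poly p x = 0 \<longrightarrow> p = 0"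
    and p: "p \<in> polys_over F" and small: "\<And>c. c \<in> F \<Longrightarrow> p \<noteq> 0 \<Longrightarrow> poly p c = 0 \<Longrightarrow> v (a - c) < Fin \<gamma>"
  shows "monomial_val F v x a \<gamma> (poly p x) = v (poly p a)"
proof -
  note F = alg_closure_ofD(2)[OF LF]
  note A = subfield_adjoin[of F x]
  let ?V = "monomial_val F v x a \<gamma>"
  note u = ring_valuation_on_subfield[OF F v]
    and V = ring_valuation_on_subfield[OF A valuation_on_monomial_val[OF F v a x]]
  show ?thesis
  proof (cases "p = 0")
    case True
    thus ?thesis
      using monomial_val_const[OF F v a x subfield_0[OF F]] by simp
  next
    case False
    from poly_eq_prod_roots[OF LF p False] obtain c B where
      B: "c \<in> F" "\<And>x. poly p x = c * (\<Prod>y\<in>#B. x - y)" "\<And>y. y \<in># B \<Longrightarrow> y \<in> F \<and> poly p y = 0"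
      by metis
    have "a - y \<in> F \<and> x - y \<in> adjoin F x \<and> ?V (x - y) = v (a - y)" if "y \<in># B" for y
    proof (intro conjI)
      have y: "y \<in> F" "v (a - y) < Fin \<gamma>"
        using B(3)[OF that] small False by blast+
      show "a - y \<in> F" "x - y \<in> adjoin F x"
        using y(1) a adjoin_incl(1)[where E = F and z = x] adjoin_incl(2)[where E = F and z = x]
        by (auto intro: subfield_diff[OF F] subfield_diff[OF A])
      show "?V (x - y) = v (a - y)"
        using monomial_val_diff[OF F v a x y(1), of \<gamma>] y(2) by simp
    qed
    hence prod: "(\<Prod>y\<in>#B. a - y) \<in> F" "(\<Prod>y\<in>#B. x - y) \<in> adjoin F x"
      "?V (\<Prod>y\<in>#B. x - y) = v (\<Prod>y\<in>#B. a - y)"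
      using ring_valuation_prod_mset_cong[OF u V, of B "\<lambda>y. a - y" "\<lambda>y. x - y"] by auto
    have c: "c \<in> adjoin F x" "?V c = v c"
      using B(1) adjoin_incl monomial_val_const[OF F v a x B(1)] by auto
    show ?thesis
      unfolding B(2) ring_valuation_mult[OF u B(1) prod(1)] ring_valuation_mult[OF V c(1) prod(2)]
      using c prod by simp
  qed
qed

section \<open>Minimal pairs and conjugates\<close>

text \<open>The hypotheses make \<open>\<sigma>\<close> preserve values on \<open>K(a)\<close> only.
  Conjugacy over \<open>K(a)\<close> supplies \<open>\<kappa>\<close> fixing \<open>a\<close> such
  that \<open>\<sigma> \<circ> \<kappa>\<close> preserves values on all of \<open>F\<close> and
  still sends \<open>a\<close> to \<open>\<sigma> a\<close>.\<close>

lemma decomposition_group_conjugate: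
  fixes F :: "'f::alg_closed_field set"
  assumes KF: "alg_closure_of K F" and v: "valuation_on F v" and \<sigma>: "\<sigma> \<in> field_auts F K"
    and a: "a \<in> F" and m: "minimal_poly K a m"
    and le: "\<And>p. p \<in> polys_over K \<Longrightarrow> p = 0 \<or> degree p < degree m \<Longrightarrow> v (poly p a) \<le> v (poly p (\<sigma> a))"
  shows "\<exists>\<tau>\<in>decomposition_group F v K. \<tau> a = \<sigma> a"
proof -
  note K = alg_closure_ofD(1,2,3)[OF KF]
  note u = ring_valuation_on_subfield[OF K(2) v]
  let ?E = "adjoin K a"
  have E: "?E \<subseteq> F" "K \<subseteq> ?E" "a \<in> ?E"
    using adjoin_least[OF K(2,3) a] adjoin_incl by auto
  have m0: "m \<in> polys_over K" "m \<noteq> 0" "poly m a = 0"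
    using m by (auto simp: minimal_poly_def)
  have *: "v y \<le> v (\<sigma> y)" if y: "y \<in> ?E" for y
  proof -
    obtain p q where pq: "p \<in> polys_over K" "q \<in> polys_over K" "poly q a \<noteq> 0" "y = poly p a / poly q a"
      using y unfolding adjoin_eq_fractions[OF K(1)] by blast
    \<comment> \<open>Since \<open>K(a) = K[a]\<close>, the denominator can be removed; reduction
      modulo \<open>m\<close> then reaches the degrees covered by \<open>le\<close>.\<close>
    obtain s where s: "s \<in> polys_over K" "poly q a * poly s a = 1"
      using minimal_poly_inverse[OF K(1) m pq(2,3)] by blast
    have "p * s \<in> polys_over K"
      by (rule polys_over_closed(3)[OF K(1) pq(1) s(1)])
    hence "partial_iso (Id_on K)" "(m, m) \<in> poly_rel (Id_on K)" "(p * s, p * s) \<in> poly_rel (Id_on K)"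
      using K(1) m0(1) by (simp_all only: partial_iso_Id_on poly_rel_Id_on Id_on_iff simp_thms)
    from poly_rel_division[OF this(1,2) m0(2) this(3)] obtain q' r where
      r: "r \<in> polys_over K" "p * s = m * q' + r" "r = 0 \<or> degree r < degree m"
      unfolding poly_rel_Id_on Id_on_iff by blast
    have "poly p a * poly s a = poly r a"
      using arg_cong[OF r(2), of "\<lambda>p. poly p a"] m0(3) by simp
    moreover have "y = poly p a * poly s a"
      using pq(3) s(2) unfolding pq(4) by (simp add: field_simps)
    ultimately have "y = poly r a"
      by simp
    thus ?thesis
      using le[OF r(1,3)] field_auts_poly[OF K(2) \<sigma> r(1) K(3) a] by simp
  qed
  have "v y = v (\<sigma> y)" if y: "y \<in> ?E" for y
  proof (cases "y = 0")
    case True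
    thus ?thesis
      using field_auts_0_iff[OF K(2) \<sigma>, of 0] subfield_0[OF K(2)] by simp
  next
    case False
    have yF: "y \<in> F" "inverse y \<in> F" "\<sigma> y \<in> F" "\<sigma> (inverse y) \<in> F"
      using y E(1) subfield_inverse[OF K(2)] field_auts_mem[OF \<sigma>] by auto
    have y1: "\<sigma> y * \<sigma> (inverse y) = 1"
      using field_auts_inverse[OF K(2) \<sigma> yF(1)] field_auts_0_iff[OF K(2) \<sigma> yF(1)] False by simp
    have sum: "v y + v (inverse y) = 0" "v (\<sigma> y) + v (\<sigma> (inverse y)) = 0"
      using ring_valuation_mult[OF u yF(1,2)] ring_valuation_mult[OF u yF(3,4)] y1 False
        ring_valuation_1[OF u] by simp_all
    have "v y \<le> v (\<sigma> y)" "v (inverse y) \<le> v (\<sigma> (inverse y))"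
      using * y subfield_inverse[OF subfield_adjoin y] by blast+
    with sum show ?thesis
      by (cases "v y"; cases "v (inverse y)"; cases "v (\<sigma> y)"; cases "v (\<sigma> (inverse y))")
        (auto simp: zero_extended_def add_eq_0_iff2)
  qed
  moreover have "alg_closure_of ?E F"
    by (rule alg_closure_of_mono[OF KF subfield_adjoin E(2,1)])
  ultimately obtain \<kappa> where \<kappa>: "\<kappa> \<in> field_auts F ?E" "\<And>x. x \<in> F \<Longrightarrow> v x = v (\<sigma> (\<kappa> x))"
    using valuations_conjugate[OF _ valuation_on_comp_field_aut[OF K(2) v \<sigma>] v, of ?E] by blast
  have "(\<lambda>x. \<sigma> (\<kappa> x)) \<in> field_auts F K"
    using \<kappa>(1) field_auts_mono[OF E(2)] by (intro field_auts_comp[OF \<sigma>]) blast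
  hence "(\<lambda>x. \<sigma> (\<kappa> x)) \<in> decomposition_group F v K"
    using \<kappa>(2) by (simp add: decomposition_group_def)
  moreover have "\<kappa> a = a"
    using \<kappa>(1) E(3) by (simp add: mem_field_auts_iff)
  ultimately show ?thesis
    by (intro bexI[of _ "\<lambda>x. \<sigma> (\<kappa> x)"]) auto
qed

text \<open>\<open>\<tau>\<close> is applied to the coefficients while \<open>x\<close> stays fixed.
  The vanishing condition is automatic, as only the zero polynomial over \<open>F\<close> vanishes
  at \<open>x\<close>.\<close>

lemma field_aut_extends_to_function_field:
  fixes F :: "'f::alg_closed_field set"
  assumes KF: "alg_closure_of K F" and KX: "alg_closure_of (adjoin K x) UNIV"
    and x: "\<forall>p\<in>polys_over F. poly p x = 0 \<longrightarrow> p = 0" and \<tau>: "\<tau> \<in> field_auts F K"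
  shows "\<exists>\<rho>\<in>field_auts UNIV (adjoin K x). (\<forall>y\<in>F. \<rho> y = \<tau> y) \<and> \<rho> ` adjoin F x \<subseteq> adjoin F x"
proof -
  note K = alg_closure_ofD(1,2,3)[OF KF]
  let ?G = "graph_on \<tau> F"
  let ?A = "adjoin_rel ?G x x"
  note G = partial_iso_graph[OF K(2) \<tau>]
  have over: "p \<in> polys_over F \<and> p' \<in> polys_over F" if "(p, p') \<in> poly_rel ?G" for p p'
  proof -
    have "coeff p i \<in> F \<and> coeff p' i = \<tau> (coeff p i)" for i
      using that by (auto simp: poly_rel_def image_iff)
    thus ?thesis
      using field_auts_mem[OF \<tau>] by simp
  qed
  have vanish: "poly p x = 0 \<longleftrightarrow> poly p' x = 0" if "(p, p') \<in> poly_rel ?G" for p p'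
    using x over[OF that] poly_rel_0_iff[OF G that] by (metis poly_0)
  have "Id_on (adjoin K x) \<subseteq> ?A"
  proof
    fix z assume "z \<in> Id_on (adjoin K x)"
    then obtain p q where pq: "p \<in> polys_over K" "q \<in> polys_over K" "poly q x \<noteq> 0"
      "z = (poly p x / poly q x, poly p x / poly q x)"
      unfolding adjoin_eq_fractions[OF K(1)] by blast
    have "(r, r) \<in> poly_rel ?G" if "r \<in> polys_over K" for r
      using that K(3) \<tau> by (auto simp: poly_rel_graph_iff mem_field_auts_iff)
    thus "z \<in> ?A"
      unfolding adjoin_rel_def using pq by blast
  qed
  moreover have "partial_iso ?A"
    by (rule partial_iso_adjoin_rel[OF G vanish])
  ultimately obtain \<rho> where \<rho>: "\<rho> \<in> field_auts UNIV (adjoin K x)" "\<forall>(y, y')\<in>?A. \<rho> y = y'"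
    using partial_iso_extends[OF KX, of ?A] by auto
  have "\<rho> y = \<tau> y" if "y \<in> F" for y
  proof -
    have "(y, \<tau> y) \<in> ?A"
      by (rule subsetD[OF adjoin_rel_incl(1)[OF partial_iso_ring_rel[OF G]]]) (simp add: that)
    thus ?thesis
      using \<rho>(2) by auto
  qed
  moreover have "\<rho> y \<in> adjoin F x" if y: "y \<in> adjoin F x" for y
  proof -
    have "Domain ?G = F"
      by auto
    moreover have "Domain ?A = adjoin (Domain ?G) x"
      by (rule Domain_adjoin_rel[OF G vanish])
    ultimately have "y \<in> Domain ?A"
      using y by simp
    then obtain p p' q q' where "(p, p') \<in> poly_rel ?G" "(q, q') \<in> poly_rel ?G" "poly q x \<noteq> 0"
      "y = poly p x / poly q x" and *: "(y, poly p' x / poly q' x) \<in> ?A"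
      unfolding adjoin_rel_def by blast
    hence "p' \<in> polys_over F" "q' \<in> polys_over F" "poly q' x \<noteq> 0"
      using over vanish by blast+
    hence "poly p' x / poly q' x \<in> adjoin F x"
      unfolding adjoin_eq_fractions[OF K(2)] by blast
    moreover have "\<rho> y = poly p' x / poly q' x"
      using \<rho>(2) * by auto
    ultimately show ?thesis
      by simp
  qed
  ultimately show ?thesis
    using \<rho>(1) by blast
qed

text \<open>Transport of structure: \<open>\<rho> (x - z) = x - \<tau> z\<close>, and
  \<open>\<tau>\<close> preserves the distance of \<open>a\<close> and \<open>z\<close>. Agreement
  on constants and linear elements suffices.\<close>

lemma monomial_val_field_aut:
  fixes F :: "'f::alg_closed_field set"
  assumes KF: "alg_closure_of K F" and v: "valuation_on F v" and a: "a \<in> F"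
    and x: "\<forall>p\<in>polys_over F. poly p x = 0 \<longrightarrow> p = 0"
    and \<tau>: "\<tau> \<in> decomposition_group F v K"
    and \<rho>: "\<rho> \<in> field_auts UNIV (adjoin K x)" "\<forall>y\<in>F. \<rho> y = \<tau> y" "\<rho> ` adjoin F x \<subseteq> adjoin F x"
    and y: "y \<in> adjoin F x"
  shows "monomial_val F v x (\<tau> a) \<gamma> (\<rho> y) = monomial_val F v x a \<gamma> y"
proof -
  note F = alg_closure_ofD(2)[OF KF]
  have U: "subfield (UNIV :: 'f set) \<Omega>"
    by (simp add: subfield_ambient_iff)
  have \<tau>': "\<tau> \<in> field_auts F K" "\<And>y. y \<in> F \<Longrightarrow> v (\<tau> y) = v y"
    using \<tau> by (auto simp: decomposition_group_def)
  have \<tau>a: "\<tau> a \<in> F"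
    by (rule field_auts_mem[OF \<tau>'(1) a])
  let ?V = "monomial_val F v x"
  have "\<rho> x = x"
    using \<rho>(1) adjoin_incl(2)[of x K] by (simp add: mem_field_auts_iff)
  show ?thesis
  proof (rule valuations_eq_on_adjoin[OF KF _ _ _ _ y])
    show "valuation_on (adjoin F x) (?V a \<gamma>)"
      by (rule valuation_on_monomial_val[OF F v a x])
    have V: "valuation_on (adjoin F x) (?V (\<tau> a) \<gamma>)"
      by (rule valuation_on_monomial_val[OF F v \<tau>a x])
    show "valuation_on (adjoin F x) (\<lambda>y. ?V (\<tau> a) \<gamma> (\<rho> y))"
      using V \<rho>(3) field_auts_add[OF U \<rho>(1)] field_auts_mult[OF U \<rho>(1)] field_auts_0_iff[OF U \<rho>(1)]
      unfolding valuation_on_def by (simp add: image_subset_iff)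
    show "?V (\<tau> a) \<gamma> (\<rho> c) = ?V a \<gamma> c" if "c \<in> F" for c
    proof -
      have "\<rho> c = \<tau> c" "\<tau> c \<in> F"
        using \<rho>(2) that field_auts_mem[OF \<tau>'(1)] by auto
      thus ?thesis
        using monomial_val_const[OF F v \<tau>a x, of "\<tau> c" \<gamma>] monomial_val_const[OF F v a x that, of \<gamma>]
          \<tau>'(2)[OF that] by simp
    qed
    show "?V (\<tau> a) \<gamma> (\<rho> (x - z)) = ?V a \<gamma> (x - z)" if z: "z \<in> F" for z
    proof -
      have "\<rho> (x - z) = x - \<tau> z"
        using field_auts_diff[OF U \<rho>(1), of x z] \<open>\<rho> x = x\<close> \<rho>(2) z by simp
      moreover have "\<tau> z \<in> F"
        by (rule field_auts_mem[OF \<tau>'(1) z])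
      moreover have "v (\<tau> a - \<tau> z) = v (a - z)"
        using \<tau>'(2)[OF subfield_diff[OF F a z]] field_auts_diff[OF F \<tau>'(1) a z] by simp
      ultimately show ?thesis
        using monomial_val_diff[OF F v \<tau>a x, of "\<tau> z" \<gamma>] monomial_val_diff[OF F v a x z, of \<gamma>] by simp
    qed
  qed
qed

text \<open>
  The coefficients of a minimal polynomial over \<open>M\<close>, made monic, are up to sign elementary symmetric
  in roots that lie in \<open>F\<close>, hence they lie in \<open>F \<inter> M\<close>.
\<close>

lemma minimal_poly_over_Int:
  fixes F :: "'f::alg_closed_field set"
  assumes KF: "alg_closure_of K F" and M: "subfield M \<Omega>" "K \<subseteq> M" and a: "a \<in> F"
  obtains m where "minimal_poly M a m" and "m \<in> polys_over (F \<inter> M)"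
proof -
  note K = alg_closure_ofD(1,2,3)[OF KF]
  obtain p where p: "p \<in> polys_over K" "p \<noteq> 0" "poly p a = 0"
    using alg_closure_ofD(4)[OF KF a] by blast
  have pM: "p \<in> polys_over M" and pF: "p \<in> polys_over F"
    using p(1) M(2) K(3) by auto
  obtain m where m: "minimal_poly M a m"
    using minimal_poly_exists[OF pM p(2,3)] .
  hence m0: "m \<in> polys_over M" "m \<noteq> 0" "poly m a = 0"
    by (auto simp: minimal_poly_def)
  have G: "partial_iso (Id_on M)"
    using M(1) by (simp add: partial_iso_Id_on)
  have "y \<in> F" if y: "poly m y = 0" for y
  proof -
    have "poly p a = 0 \<longleftrightarrow> poly p y = 0"
      by (rule minimal_poly_root_iff[OF G])
        (use m m0 pM y in \<open>simp_all add: poly_rel_Id_on Id_on_iff\<close>)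
    thus ?thesis
      using alg_closure_ofD(5)[OF KF pF p(2)] p(3) by blast
  qed
  moreover obtain A where A: "m = smult (lead_coeff m) (\<Prod>y\<in>#A. [:- y, 1:])"
    using alg_closed_imp_factorization[OF m0(2)] by metis
  have "poly m y = 0" if "y \<in># A" for y
    using that by (subst A) (auto simp: poly_prod_mset intro!: image_eqI[of _ _ y])
  ultimately have AF: "y \<in> F" if "y \<in># A" for y
    using that by blast
  define q where "q = (\<Prod>y\<in>#A. [:- y, 1:])"
  have "q \<in> polys_over F"
    unfolding q_def using AF
  proof (induction A)
    case empty
    show ?case
      using polys_over_closed(1)[OF K(2)] by simp
  next
    case (add y A)
    have "[:- y, 1:] \<in> polys_over F"
      using add.prems subfield_closed[OF K(2)] by (auto simp: coeff_pCons split: nat.split)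
    thus ?case
      unfolding image_mset_add_mset prod_mset.add_mset
      using add by (intro polys_over_closed(3)[OF K(2)]) auto
  qed
  moreover have q: "q = smult (inverse (lead_coeff m)) m"
    using A m0(2) unfolding q_def by (metis left_inverse leading_coeff_0_iff smult_1_left smult_smult)
  have "q \<in> polys_over M"
    unfolding q using m0(1) by (auto intro: subfield_mult[OF M(1)] subfield_inverse[OF M(1)])
  ultimately have "q \<in> polys_over (F \<inter> M)"
    by blast
  moreover have "minimal_poly M a q"
    using m \<open>q \<in> polys_over M\<close> m0(2,3) unfolding minimal_poly_def by (simp add: q)
  ultimately show ?thesis
    by (intro that)
qed

text \<open>The minimal polynomial of \<open>a\<close> over \<open>M\<close> already has its
  coefficients in \<open>F \<inter> M\<close>, so \<open>\<sigma> a\<close> is another of its roots.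
  Only the image of \<open>a\<close> is matched; \<open>\<tau>\<close> need not extend
  \<open>\<sigma>\<close>.\<close>

lemma conjugate_over_Int_extends:
  fixes F :: "'f::alg_closed_field set"
  assumes KF: "alg_closure_of K F" and MU: "alg_closure_of M UNIV" and "K \<subseteq> M" and a: "a \<in> F"
    and \<sigma>: "\<sigma> \<in> field_auts F (F \<inter> M)"
  shows "\<exists>\<tau>\<in>field_auts UNIV M. \<tau> a = \<sigma> a"
proof (rule conjugate_if_same_vanishing[OF MU])
  note K = alg_closure_ofD(1,2,3)[OF KF]
  note M = alg_closure_ofD(1)[OF MU]
  obtain m where m: "minimal_poly M a m" "m \<in> polys_over (F \<inter> M)"
    using minimal_poly_over_Int[OF KF M \<open>K \<subseteq> M\<close> a] .
  have m0: "m \<in> polys_over M" "poly m a = 0"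
    using m(1) by (auto simp: minimal_poly_def)
  have "poly m (\<sigma> a) = \<sigma> (poly m a)"
    using field_auts_poly[OF K(2) \<sigma> m(2) _ a] by simp
  hence root: "poly m (\<sigma> a) = 0"
    using m0(2) field_auts_0_iff[OF K(2) \<sigma> subfield_0[OF K(2)]] by simp
  fix p assume p: "p \<in> polys_over M"
  have G: "partial_iso (Id_on M)"
    using M by (simp add: partial_iso_Id_on)
  show "poly p a = 0 \<longleftrightarrow> poly p (\<sigma> a) = 0"
    by (rule minimal_poly_root_iff[OF G])
      (use m m0 p root in \<open>auto simp: poly_rel_Id_on Id_on_iff\<close>)
qed auto

theorem theorem1p2:
  fixes K Kbar :: "'f::alg_closed_field set"
    and x a a' :: 'f
    and v vbar w wbar W :: "'f \<Rightarrow> 'g::linordered_ab_group_add extended"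
    and \<gamma> :: 'g
  assumes "subfield K \<Omega>" and "valuation_on K v"
    and "algebraic_closure (\<Omega>\<lparr>carrier := Kbar\<rparr>) K"
    and "valuation_on Kbar vbar" and "extends_on K v vbar"
    and "(ring.transcendental \<Omega> over K) x"
    and "valuation_on (adjoin K x) w" and "extends_on K v w"
    and "valuation_transcendental K x v w"
    and "common_extension K Kbar x w vbar wbar"
    and "algebraic_closure (\<Omega> :: 'f ring) (adjoin K x)"
    and "valuation_on UNIV W" and "extends_on (adjoin Kbar x) wbar W"
    and "minimal_pair_of_definition K Kbar x w vbar a \<gamma>"
    and "\<forall>z\<in>adjoin Kbar x. wbar z = monomial_val Kbar vbar x a \<gamma> z"
    and "conjugate Kbar K a a'"
  shows "((\<forall>z\<in>adjoin Kbar x. monomial_val Kbar vbar x a \<gamma> z = monomial_val Kbar vbar x a' \<gamma> z)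
            \<longleftrightarrow> conjugate Kbar (implicit_constant_field K Kbar x W) a a') \<and>
         ((\<forall>z\<in>adjoin K x. monomial_val Kbar vbar x a \<gamma> z = w z \<and>
                            w z = monomial_val Kbar vbar x a' \<gamma> z)
            \<longleftrightarrow> conjugate Kbar (henselization Kbar vbar K) a a')"
proof -
  let ?V = "\<lambda>b. monomial_val Kbar vbar x b \<gamma>"
  let ?KX = "adjoin K x" and ?FX = "adjoin Kbar x"
  have "K \<subseteq> Kbar"
    using subfieldE(3)[OF algebraic_closure.axioms(2)[OF assms(3)]] by simp
  hence KF: "alg_closure_of K Kbar"
    by (rule alg_closure_of_algebraic_closure[OF assms(1) _ assms(3)])
  note K = alg_closure_ofD(1,2,3)[OF KF]
  have KX: "alg_closure_of ?KX UNIV"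
    by (rule alg_closure_of_algebraic_closure[OF subfield_adjoin])
      (simp_all add: ambient_UNIV assms(11))
  note U = alg_closure_ofD(2)[OF KX]
  note v = assms(4)
  note u = ring_valuation_on_subfield[OF K(2) v]
  \<comment> \<open>Transcendence passes from \<open>K\<close> to \<open>Kbar\<close>: a root of a
    nonzero polynomial over \<open>Kbar\<close> lies in \<open>Kbar\<close> and is thus algebraic
    over \<open>K\<close>.\<close>
  have "x \<notin> Kbar"
    using alg_closure_ofD(4)[OF KF] transcendental_ambientD[OF assms(6)] by blast
  hence x: "\<forall>p\<in>polys_over Kbar. poly p x = 0 \<longrightarrow> p = 0"
    using alg_closure_ofD(5)[OF KF] by blast
  have KX_FX: "?KX \<subseteq> ?FX"
    using K(3) adjoin_incl by (intro adjoin_least subfield_adjoin) auto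
  have a: "a \<in> Kbar" and Vw: "\<And>z. z \<in> ?KX \<Longrightarrow> ?V a z = w z"
    using assms(14) by (auto simp: minimal_pair_of_definition_def pair_of_definition_def
        common_extension_def extends_on_def)
  have min: "ext_degree K a \<le> ext_degree K b" if "b \<in> Kbar" "Fin \<gamma> \<le> vbar (a - b)" for b
    using assms(14) that by (auto simp: minimal_pair_of_definition_def)
  obtain \<sigma> where \<sigma>: "\<sigma> \<in> field_auts Kbar K" "a' = \<sigma> a"
    using assms(16) by (auto simp: conjugate_def)
  have a': "a' \<in> Kbar"
    unfolding \<sigma>(2) by (rule field_auts_mem[OF \<sigma>(1) a])
  have V_eq_W: "?V a z = W z" if "z \<in> ?FX" for z
    using assms(13,15) that by (simp add: extends_on_def)
  have v_eq_W: "vbar c = W c" if "c \<in> Kbar" for c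
  proof -
    have "c \<in> ?FX"
      using that adjoin_incl by auto
    thus ?thesis
      using V_eq_W monomial_val_const[OF K(2) v a x that, of \<gamma>] by simp
  qed
  have xz: "x - z \<in> ?FX" if "z \<in> Kbar" for z
    using that adjoin_incl(1)[where E = Kbar and z = x] adjoin_incl(2)[where E = Kbar and z = x]
    by (auto intro: subfield_diff[OF subfield_adjoin])

  obtain p0 where "p0 \<in> polys_over K" "p0 \<noteq> 0" "poly p0 a = 0"
    using alg_closure_ofD(4)[OF KF a] by blast
  then obtain m where m: "minimal_poly K a m"
    using minimal_poly_exists by blast
  have small: "vbar (a - c) < Fin \<gamma>"
    if p: "p \<in> polys_over K" "degree p < degree m" "p \<noteq> 0" and c: "c \<in> Kbar" "poly p c = 0" for p c
  proof (rule ccontr)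
    assume "\<not> vbar (a - c) < Fin \<gamma>"
    hence "ext_degree K a \<le> ext_degree K c"
      using min[OF c(1)] by simp
    moreover obtain m' where "minimal_poly K c m'" "degree m' \<le> degree p"
      using minimal_poly_exists[OF p(1,3) c(2)] .
    ultimately show False
      using p(2) ext_degree_eq_degree[OF K(1)] m by simp
  qed

  \<comment> \<open>Shared by the forward directions of both equivalences: agreement on
    \<open>K(x)\<close> is enough to realise \<open>a'\<close> by the decomposition group over
    \<open>K\<close>.\<close>
  have conj: "\<exists>\<tau>\<in>decomposition_group Kbar vbar K. \<tau> a = a'"
    if V: "\<And>z. z \<in> ?KX \<Longrightarrow> ?V a z = ?V a' z"
    unfolding \<sigma>(2)
  proof (rule decomposition_group_conjugate[OF KF v \<sigma>(1) a m])
    fix p assume p: "p \<in> polys_over K" "p = 0 \<or> degree p < degree m"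
    have pF: "p \<in> polys_over Kbar"
      using p(1) K(3) by blast
    have "poly p x \<in> ?KX"
      using p(1) adjoin_incl(1)[where E = K and z = x] adjoin_incl(2)[where E = K and z = x]
      by (intro poly_mem_subfield[OF subfield_adjoin]) auto
    hence "?V a (poly p x) = ?V a' (poly p x)"
      by (rule V)
    moreover have "?V a (poly p x) = vbar (poly p a)"
      by (rule monomial_val_eq_at_root[OF KF v a x pF]) (use small p in blast)
    moreover have "?V a' (poly p x) \<le> vbar (poly p a')"
      by (rule monomial_val_le[OF K(2) v a' x pF])
    ultimately show "vbar (poly p a) \<le> vbar (poly p (\<sigma> a))"
      by (simp add: \<sigma>(2))
  qed

  \<comment> \<open>Transport of the monomial valuation at \<open>a\<close> to the one at
    \<open>\<tau> a\<close>, shared by the forward direction of the first equivalence and the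
    converse of the second.\<close>
  have lift: "\<exists>\<rho>\<in>field_auts UNIV ?KX. (\<forall>y\<in>Kbar. \<rho> y = \<tau> y) \<and> (\<forall>y\<in>?FX. \<rho> y \<in> ?FX \<and> ?V (\<tau> a) (\<rho> y) = ?V a y)"
    if \<tau>: "\<tau> \<in> decomposition_group Kbar vbar K" for \<tau>
  proof -
    have "\<tau> \<in> field_auts Kbar K"
      using \<tau> by (simp add: decomposition_group_def)
    from field_aut_extends_to_function_field[OF KF KX x this] obtain \<rho> where
      \<rho>: "\<rho> \<in> field_auts UNIV ?KX" "\<forall>y\<in>Kbar. \<rho> y = \<tau> y" "\<rho> ` ?FX \<subseteq> ?FX"
      by blast
    have "?V (\<tau> a) (\<rho> y) = ?V a y" if "y \<in> ?FX" for y
      by (rule monomial_val_field_aut[OF KF v a x \<tau> \<rho> that])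
    thus ?thesis
      using \<rho> by (intro bexI[of _ \<rho>]) auto
  qed

  let ?M = "henselization UNIV W ?KX"
  note MB = henselization_bounds[OF KX, of W]
  have IC: "implicit_constant_field K Kbar x W = Kbar \<inter> ?M"
    by (simp add: implicit_constant_field_def)

  \<comment> \<open>Equality on \<open>Kbar(x)\<close> and conjugacy over the implicit constant
    field\<close>
  have "(\<forall>z\<in>?FX. ?V a z = ?V a' z) \<longleftrightarrow> conjugate Kbar (Kbar \<inter> ?M) a a'"
  proof
    assume V: "\<forall>z\<in>?FX. ?V a z = ?V a' z"
    then obtain \<tau> where \<tau>: "\<tau> \<in> decomposition_group Kbar vbar K" "\<tau> a = a'"
      using conj KX_FX by blast
    from lift[OF \<tau>(1)] obtain \<rho> where \<rho>: "\<rho> \<in> field_auts UNIV ?KX" "\<And>y. y \<in> Kbar \<Longrightarrow> \<rho> y = \<tau> y"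
      "\<And>y. y \<in> ?FX \<Longrightarrow> \<rho> y \<in> ?FX" "\<And>y. y \<in> ?FX \<Longrightarrow> ?V a' (\<rho> y) = ?V a y"
      unfolding \<tau>(2) by blast
    have FX: "alg_closure_of ?FX UNIV"
      by (rule alg_closure_of_mono[OF KX subfield_adjoin KX_FX]) simp
    have "W y = W (\<rho> y)" if "y \<in> ?FX" for y
      using V \<rho>(3,4)[OF that] V_eq_W that by metis
    \<comment> \<open>\<open>\<rho>\<close> preserves \<open>W\<close> only on
      \<open>Kbar(x)\<close>. The correction \<open>\<kappa>\<close> fixes \<open>Kbar(x)\<close>,
      so \<open>\<rho> \<circ> \<kappa>\<close> still acts as \<open>\<tau>\<close> on
      \<open>Kbar\<close>.\<close>
    then obtain \<kappa> where \<kappa>: "\<kappa> \<in> field_auts UNIV ?FX" "\<And>y. W y = W (\<rho> (\<kappa> y))"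
      using valuations_conjugate[OF FX valuation_on_comp_field_aut[OF U assms(12) \<rho>(1)] assms(12)]
      by blast
    have "\<kappa> \<in> field_auts UNIV ?KX"
      using \<kappa>(1) field_auts_mono[OF KX_FX] by blast
    hence "(\<lambda>y. \<rho> (\<kappa> y)) \<in> field_auts UNIV ?KX"
      by (rule field_auts_comp[OF \<rho>(1)])
    hence D: "(\<lambda>y. \<rho> (\<kappa> y)) \<in> decomposition_group UNIV W ?KX"
      using \<kappa>(2) by (simp add: decomposition_group_def)
    have "\<tau> y = y" if y: "y \<in> Kbar \<inter> ?M" for y
    proof -
      have "\<rho> (\<kappa> y) = y"
        using decomposition_group_fixes_henselization[OF KX assms(12) D] y by blast
      moreover have "\<kappa> y = y"
        using \<kappa>(1) y adjoin_incl(1)[where E = Kbar and z = x] by (auto simp: mem_field_auts_iff)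
      ultimately show ?thesis
        using \<rho>(2) y by simp
    qed
    hence "\<tau> \<in> field_auts Kbar (Kbar \<inter> ?M)"
      using \<tau>(1) by (simp add: decomposition_group_def field_auts_def)
    thus "conjugate Kbar (Kbar \<inter> ?M) a a'"
      using \<tau>(2) by (auto simp: conjugate_def)
  next
    assume "conjugate Kbar (Kbar \<inter> ?M) a a'"
    then obtain \<sigma>' where \<sigma>': "\<sigma>' \<in> field_auts Kbar (Kbar \<inter> ?M)" "a' = \<sigma>' a"
      by (auto simp: conjugate_def)
    have MU: "alg_closure_of ?M UNIV"
      by (rule alg_closure_of_mono[OF KX MB])
    have KM: "K \<subseteq> ?M"
      using MB(2) adjoin_incl(1)[where E = K and z = x] by order
    obtain \<tau> where \<tau>: "\<tau> \<in> field_auts UNIV ?M" "\<tau> a = a'"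
      using conjugate_over_Int_extends[OF KF MU KM a \<sigma>'(1)] \<sigma>'(2) by blast
    hence \<tau>W: "\<tau> \<in> field_auts UNIV ?KX" "\<And>y. W (\<tau> y) = W y"
      using field_auts_henselization[OF KX assms(12)] by (auto simp: decomposition_group_def)
    have "\<tau> x = x"
      using \<tau>W(1) adjoin_incl(2)[where E = K and z = x] by (simp add: mem_field_auts_iff)
    \<comment> \<open>A \<open>W\<close>-preserving automorphism fixing \<open>x\<close> and sending
      \<open>a\<close> to \<open>a'\<close> forces \<open>x - a'\<close> to have value
      \<open>\<gamma>\<close> too, so \<open>a'\<close> lies in the ball of radius
      \<open>\<gamma>\<close> around \<open>a\<close>.\<close>
    hence "W (x - a') = W (x - a)"
      using \<tau>W(2)[of "x - a"] field_auts_diff[OF U \<tau>W(1), of x a] \<tau>(2) by simp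
    also have "W (x - a) = ?V a (x - a)"
      using V_eq_W[OF xz[OF a]] by simp
    also have "\<dots> = Fin \<gamma>"
      using monomial_val_diff[OF K(2) v a x a, of \<gamma>] ring_valuation_0[OF u] by simp
    finally have "Fin \<gamma> = ?V a (x - a')"
      using V_eq_W[OF xz[OF a']] by simp
    also have "\<dots> = min (vbar (a - a')) (Fin \<gamma>)"
      by (rule monomial_val_diff[OF K(2) v a x a'])
    finally have ge: "Fin \<gamma> \<le> vbar (a - a')"
      by (metis min.cobounded1)
    \<comment> \<open>Two centres of the same ultrametric ball have the same distances once these
      are truncated at the radius.\<close>
    have diff: "min (vbar (a' - z)) (Fin \<gamma>) = min (vbar (a - z)) (Fin \<gamma>)" if z: "z \<in> Kbar" for z
    proof -
      note mem = subfield_diff[OF K(2) a z] subfield_diff[OF K(2) a' z] subfield_diff[OF K(2) a a']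
      have "min (vbar (a - z)) (vbar (a - a')) \<le> vbar ((a - z) - (a - a'))"
        by (rule ring_valuation_diff[OF u mem(1,3)])
      moreover have "min (vbar (a' - z)) (vbar (a - a')) \<le> vbar ((a' - z) + (a - a'))"
        by (rule ring_valuation_add[OF u mem(2,3)])
      ultimately have "min (vbar (a - z)) (vbar (a - a')) \<le> vbar (a' - z)"
        "min (vbar (a' - z)) (vbar (a - a')) \<le> vbar (a - z)"
        by simp_all
      thus ?thesis
        using ge by (auto simp: min_def split: if_splits)
    qed
    show "\<forall>z\<in>?FX. ?V a z = ?V a' z"
    proof
      fix z assume z: "z \<in> ?FX"
      have "?V a' z = ?V a z"
      proof (rule valuations_eq_on_adjoin[OF KF _ _ _ _ z])
        show "valuation_on ?FX (?V a)" "valuation_on ?FX (?V a')"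
          by (rule valuation_on_monomial_val[OF K(2) v _ x], rule a a')+
        show "?V a' c = ?V a c" if "c \<in> Kbar" for c
          using monomial_val_const[OF K(2) v a x that] monomial_val_const[OF K(2) v a' x that] by simp
        show "?V a' (x - z) = ?V a (x - z)" if "z \<in> Kbar" for z
          using monomial_val_diff[OF K(2) v a x that] monomial_val_diff[OF K(2) v a' x that] diff[OF that]
          by simp
      qed
      thus "?V a z = ?V a' z"
        by simp
    qed
  qed

  \<comment> \<open>Agreement on \<open>K(x)\<close> and conjugacy over the henselization of
    \<open>K\<close>\<close>
  moreover have "(\<forall>z\<in>?KX. ?V a z = w z \<and> w z = ?V a' z) \<longleftrightarrow>
    conjugate Kbar (henselization Kbar vbar K) a a'"
  proof
    assume "\<forall>z\<in>?KX. ?V a z = w z \<and> w z = ?V a' z"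
    then obtain \<tau> where "\<tau> \<in> decomposition_group Kbar vbar K" "\<tau> a = a'"
      using conj by metis
    thus "conjugate Kbar (henselization Kbar vbar K) a a'"
      using field_auts_henselization[OF KF v] by (auto simp: conjugate_def)
  next
    assume "conjugate Kbar (henselization Kbar vbar K) a a'"
    then obtain \<tau> where \<tau>: "\<tau> \<in> decomposition_group Kbar vbar K" "a' = \<tau> a"
      using field_auts_henselization[OF KF v] by (auto simp: conjugate_def)
    from lift[OF \<tau>(1)] obtain \<rho> where \<rho>: "\<rho> \<in> field_auts UNIV ?KX"
      "\<And>y. y \<in> ?FX \<Longrightarrow> ?V a' (\<rho> y) = ?V a y"
      unfolding \<tau>(2)[symmetric] by blast
    \<comment> \<open>\<open>\<rho>\<close> moves the centre from \<open>a\<close> to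
      \<open>a'\<close> but fixes \<open>K(x)\<close> pointwise, so both monomial valuations
      restrict to \<open>w\<close> there.\<close>
    have "?V a' z = w z" if z: "z \<in> ?KX" for z
    proof -
      have "\<rho> z = z"
        using \<rho>(1) z by (simp add: mem_field_auts_iff)
      thus ?thesis
        using \<rho>(2)[of z] z KX_FX Vw[OF z] by auto
    qed
    thus "\<forall>z\<in>?KX. ?V a z = w z \<and> w z = ?V a' z"
      using Vw by simp
  qed
  ultimately show ?thesis
    unfolding IC by blast
qed

end
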